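(* Let $K$ be a one-relator group given by an ordinary presentation $\langle \mathbf{y}, z; S(\mathbf{y}, z)\rangle$, where $\mathbf{y}$ is a set, $z$ is a further letter, and $S(\mathbf{y},z)$ is a word on $(\mathbf{y}\cup\{z\})^{\pm 1}$. Let $H$ be a group and let $\mathcal{P} = \langle \mathbf{x}, H; R\rangle$ be an $\mathcal{M}_H$-presentation (with $\mathbf{x}$ disjoint from $\mathbf{y} \cup \{z\}$). Then the group given by the relative presentation $\langle \mathbf{x}, \mathbf{y}, H; S(\mathbf{y}, R)\rangle$, that is, the quotient of $H * F(\mathbf{x} \cup \mathbf{y})$ by the normal closure of the element $S(\mathbf{y},R)$ obtained by substituting $R$ for $z$ in $S(\mathbf{y},z)$, is residually finite if and only if both $H$ and $K$ are residually finite.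
   Context: $F(\mathbf{a})$ denotes the free group on a set $\mathbf{a}$. A one-relator relative presentation $\mathcal{P} = \langle \mathbf{x}, H; R\rangle$ consists of a set $\mathbf{x}$, a group $H$, and an expression $R = x_1^{\varepsilon_1} h_1 x_2^{\varepsilon_2} h_2 \cdots x_r^{\varepsilon_r} h_r$ with $r>0$, $x_i \in \mathbf{x}$, $\varepsilon_i = \pm 1$, $h_i \in H$. The word $W = x_1^{\varepsilon_1} x_2^{\varepsilon_2} \cdots x_r^{\varepsilon_r}$ is the $\mathbf{x}$-skeleton of $R$; it is not required to be reduced or cyclically reduced. The group defined by $\mathcal{P}$ is the quotient of $H * F(\mathbf{x})$ by the normal closure of the element represented by $R$. A weight function on $\mathbf{x}$ is a function $\theta: \mathbf{x} \to \mathbb{Z}$ whose image generates the additive group $\mathbb{Z}$; it is strict if $\theta(x) \neq 0$ for all $x \in \mathbf{x}$. Given $W$ and $\theta$, define $\phi:\{0,1,\ldots,r\} \to \mathbb{Z}$ by $\phi(j) = \sum_{i=1}^{j} \varepsilon_i \theta(x_i)$ (so $\phi(0)=0$). The weight function is admissible for $W$ if $\phi(r)=0$. $W$ has the unique max-min property if there are an admissible strict weight function $\theta$ and $k,l \in \{1,\ldots,r\}$ such that $\phi(j) < \phi(k)$ for all $j \in \{1,\ldots,r\}\setminus\{k\}$, $\phi(j) > \phi(l)$ for all $j \in \{1,\ldots,r\}\setminus\{l\}$, $x_k \neq x_{k+1}$ and $x_l \neq x_{l+1}$ (subscripts modulo $r$). An $\mathcal{M}_H$-presentation is a one-relator relative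 presentation $\langle \mathbf{x}, H; R\rangle$ whose $\mathbf{x}$-skeleton has the unique max-min property. *)

theory Defs
  imports "HOL-Algebra.Elementary_Groups"
begin

section \<open>Monoids given by generators and relations\<close>

inductive_set word_cong :: "'c set \<Rightarrow> ('c list \<times> 'c list) set \<Rightarrow> ('c list \<times> 'c list) set"
  for A :: "'c set" and E :: "('c list \<times> 'c list) set" where
  base: "(u, v) \<in> E \<Longrightarrow> u \<in> lists A \<Longrightarrow> v \<in> lists A \<Longrightarrow> (u, v) \<in> word_cong A E"
| refl: "u \<in> lists A \<Longrightarrow> (u, u) \<in> word_cong A E"
| sym: "(u, v) \<in> word_cong A E \<Longrightarrow> (v, u) \<in> word_cong A E"
| trans: "(u, v) \<in> word_cong A E \<Longrightarrow> (v, w) \<in> word_cong A E \<Longrightarrow> (u, w) \<in> word_cong A E"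
| append: "(u, u') \<in> word_cong A E \<Longrightarrow> (v, v') \<in> word_cong A E \<Longrightarrow>
    (u @ v, u' @ v') \<in> word_cong A E"

definition presented_monoid :: "'c set \<Rightarrow> ('c list \<times> 'c list) set \<Rightarrow> 'c list set monoid" where
  "presented_monoid A E =
    \<lparr>carrier = lists A // word_cong A E,
     monoid.mult = (\<lambda>P Q. \<Union>p\<in>P. \<Union>q\<in>Q. word_cong A E `` {p @ q}),
     one = word_cong A E `` {[]}\<rparr>"

lemma word_cong_lists: "(u, v) \<in> word_cong A E \<Longrightarrow> u \<in> lists A \<and> v \<in> lists A"
  by (induction rule: word_cong.induct) auto

lemma equiv_word_cong: "equiv (lists A) (word_cong A E)"
proof (rule equivI)
  show "word_cong A E \<subseteq> lists A \<times> lists A"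
    by (rule subrelI) (simp add: word_cong_lists del: in_lists_conv_set)
  show "refl_on (lists A) (word_cong A E)"
    by (auto intro!: refl_onI word_cong.refl)
  show "sym (word_cong A E)" by (auto intro: symI word_cong.sym)
  show "trans (word_cong A E)" by (auto intro: transI word_cong.trans)
qed

lemma presented_monoid_mult:
  assumes "u \<in> lists A" "v \<in> lists A"
  shows "(word_cong A E `` {u}) \<otimes>\<^bsub>presented_monoid A E\<^esub> (word_cong A E `` {v})
    = word_cong A E `` {u @ v}"
proof -
  have "word_cong A E `` {p @ q} = word_cong A E `` {u @ v}"
    if "(u, p) \<in> word_cong A E" "(v, q) \<in> word_cong A E" for p q
    using that by (meson equiv_class_eq equiv_word_cong word_cong.append word_cong.sym)
  then have "(\<Union>p\<in>word_cong A E `` {u}. \<Union>q\<in>word_cong A E `` {v}. word_cong A E `` {p @ q})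
      = (\<Union>p\<in>word_cong A E `` {u}. \<Union>q\<in>word_cong A E `` {v}. word_cong A E `` {u @ v})"
    by (intro SUP_cong HOL.refl) simp
  moreover have "u \<in> word_cong A E `` {u}" "v \<in> word_cong A E `` {v}"
    using assms by (simp_all add: word_cong.refl del: in_lists_conv_set)
  then have "word_cong A E `` {u} \<noteq> {}" "word_cong A E `` {v} \<noteq> {}"
    by blast+
  ultimately show ?thesis
    unfolding presented_monoid_def by simp
qed

lemma group_presented_monoid:
  assumes inv: "\<And>a. a \<in> A \<Longrightarrow> \<exists>w\<in>lists A. (w @ [a], []) \<in> word_cong A E"
  shows "group (presented_monoid A E)"
proof -
  let ?M = "presented_monoid A E" and ?c = "\<lambda>u. word_cong A E `` {u}"
  have carr: "P \<in> carrier ?M \<longleftrightarrow> (\<exists>u\<in>lists A. P = ?c u)" for P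
    by (auto simp: presented_monoid_def quotient_def)
  have one: "\<one>\<^bsub>?M\<^esub> = ?c []" by (simp add: presented_monoid_def)
  have ex_inv: "\<exists>w\<in>lists A. (w @ u, []) \<in> word_cong A E" if "u \<in> lists A" for u
    using that
  proof (induction u)
    case Nil
    then show ?case by (auto intro!: bexI[of _ "[]"] word_cong.refl)
  next
    case (Cons a u)
    then obtain w where w: "w \<in> lists A" "(w @ u, []) \<in> word_cong A E" by auto
    have "a \<in> A" using Cons by simp
    then obtain b where b: "b \<in> lists A" "(b @ [a], []) \<in> word_cong A E"
      using inv by blast
    have "(w @ ((b @ [a]) @ u), w @ ([] @ u)) \<in> word_cong A E"
      using w b Cons by (intro word_cong.append word_cong.refl) auto
    with w have "((w @ b) @ a # u, []) \<in> word_cong A E"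
      by (auto intro: word_cong.trans)
    with w b show ?case by (intro bexI[of _ "w @ b"]) auto
  qed
  show ?thesis
  proof (rule groupI)
    fix P assume "P \<in> carrier ?M"
    then obtain u where u: "u \<in> lists A" "P = ?c u" by (auto simp: carr)
    obtain w where w: "w \<in> lists A" "(w @ u, []) \<in> word_cong A E" using ex_inv u by blast
    then have "?c w \<otimes>\<^bsub>?M\<^esub> P = \<one>\<^bsub>?M\<^esub>"
      using u by (auto simp: presented_monoid_mult one intro!: equiv_class_eq[OF equiv_word_cong])
    moreover have "?c w \<in> carrier ?M" using w carr by blast
    ultimately show "\<exists>Q\<in>carrier ?M. Q \<otimes>\<^bsub>?M\<^esub> P = \<one>\<^bsub>?M\<^esub>" by blast
  next
    fix P Q T assume "P \<in> carrier ?M" "Q \<in> carrier ?M" "T \<in> carrier ?M"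
    then obtain u v w where "u \<in> lists A" "v \<in> lists A" "w \<in> lists A"
      "P = ?c u" "Q = ?c v" "T = ?c w" by (auto simp: carr)
    then show "P \<otimes>\<^bsub>?M\<^esub> Q \<otimes>\<^bsub>?M\<^esub> T = P \<otimes>\<^bsub>?M\<^esub> (Q \<otimes>\<^bsub>?M\<^esub> T)"
      by (simp add: presented_monoid_mult del: in_lists_conv_set)
  next
    fix P Q assume "P \<in> carrier ?M" "Q \<in> carrier ?M"
    then obtain u v where "u \<in> lists A" "v \<in> lists A" "P = ?c u" "Q = ?c v"
      by (auto simp: carr)
    then have "P \<otimes>\<^bsub>?M\<^esub> Q = ?c (u @ v)" "u @ v \<in> lists A"
      by (simp_all add: presented_monoid_mult del: in_lists_conv_set)
    then show "P \<otimes>\<^bsub>?M\<^esub> Q \<in> carrier ?M" using carr by blast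
  next
    show "\<one>\<^bsub>?M\<^esub> \<in> carrier ?M" unfolding carr one by blast
  next
    fix P assume "P \<in> carrier ?M"
    then obtain u where u: "u \<in> lists A" "P = ?c u" by (auto simp: carr)
    then show "\<one>\<^bsub>?M\<^esub> \<otimes>\<^bsub>?M\<^esub> P = P"
      by (simp add: one presented_monoid_mult del: in_lists_conv_set)
  qed
qed


section \<open>Free groups and free products\<close>

text \<open>Words on \<open>Xs\<^sup>\<plusminus>\<^sup>1\<close>: the pair \<open>(x, e)\<close> stands for \<open>x\<close> raised to the exponent \<open>e\<close>.\<close>

definition signed_words :: "'a set \<Rightarrow> ('a \<times> int) list set" where
  "signed_words Xs = lists (Xs \<times> {1, -1})"

definition free_group_rels :: "'a set \<Rightarrow> (('a \<times> int) list \<times> ('a \<times> int) list) set" where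
  "free_group_rels Xs = {([(x, e), (x, - e)], []) | x e. x \<in> Xs \<and> e \<in> {1, -1}}"

definition free_group :: "'a set \<Rightarrow> ('a \<times> int) list set monoid" where
  "free_group Xs = presented_monoid (Xs \<times> {1, -1}) (free_group_rels Xs)"

definition free_gen :: "'a set \<Rightarrow> 'a \<Rightarrow> ('a \<times> int) list set" where
  "free_gen Xs x = word_cong (Xs \<times> {1, -1}) (free_group_rels Xs) `` {[(x, 1)]}"

definition free_product_rels ::
  "('g, 'm) monoid_scheme \<Rightarrow> ('h, 'n) monoid_scheme \<Rightarrow> (('g + 'h) list \<times> ('g + 'h) list) set" where
  "free_product_rels G H =
     {([Inl a, Inl b], [Inl (a \<otimes>\<^bsub>G\<^esub> b)]) | a b. a \<in> carrier G \<and> b \<in> carrier G} \<union>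
     {([Inr a, Inr b], [Inr (a \<otimes>\<^bsub>H\<^esub> b)]) | a b. a \<in> carrier H \<and> b \<in> carrier H} \<union>
     {([Inl \<one>\<^bsub>G\<^esub>], []), ([Inr \<one>\<^bsub>H\<^esub>], [])}"

definition free_product ::
  "('g, 'm) monoid_scheme \<Rightarrow> ('h, 'n) monoid_scheme \<Rightarrow> ('g + 'h) list set monoid" where
  "free_product G H = presented_monoid (Inl ` carrier G \<union> Inr ` carrier H) (free_product_rels G H)"

definition free_product_inl ::
  "('g, 'm) monoid_scheme \<Rightarrow> ('h, 'n) monoid_scheme \<Rightarrow> 'g \<Rightarrow> ('g + 'h) list set" where
  "free_product_inl G H g =
     word_cong (Inl ` carrier G \<union> Inr ` carrier H) (free_product_rels G H) `` {[Inl g]}"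

definition free_product_inr ::
  "('g, 'm) monoid_scheme \<Rightarrow> ('h, 'n) monoid_scheme \<Rightarrow> 'h \<Rightarrow> ('g + 'h) list set" where
  "free_product_inr G H h =
     word_cong (Inl ` carrier G \<union> Inr ` carrier H) (free_product_rels G H) `` {[Inr h]}"

lemma group_free_group: "group (free_group Xs)"
  unfolding free_group_def
proof (rule group_presented_monoid)
  let ?E = "free_group_rels Xs"
  fix a assume "a \<in> Xs \<times> {1, -1 :: int}"
  then obtain x e where a: "a = (x, e)" "x \<in> Xs" "e \<in> {1, -1}" by blast
  then have "([(x, - e), (x, - (- e))], []) \<in> word_cong (Xs \<times> {1, -1}) ?E"
    by (intro word_cong.base) (auto simp: free_group_rels_def)
  with a show "\<exists>w\<in>lists (Xs \<times> {1, -1}). (w @ [a], []) \<in> word_cong (Xs \<times> {1, -1}) ?E"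
    by (intro bexI[of _ "[(x, - e)]"]) auto
qed

lemma group_free_product:
  assumes "group G" "group H"
  shows "group (free_product G H)"
  unfolding free_product_def
proof (rule group_presented_monoid)
  interpret G: group G by fact
  interpret H: group H by fact
  let ?A = "Inl ` carrier G \<union> Inr ` carrier H" and ?E = "free_product_rels G H"
  fix a assume "a \<in> ?A"
  then consider g where "a = Inl g" "g \<in> carrier G" | h where "a = Inr h" "h \<in> carrier H"
    by blast
  then show "\<exists>w\<in>lists ?A. (w @ [a], []) \<in> word_cong ?A ?E" (is ?goal)
  proof cases
    case g: 1
    then have "([Inl (inv\<^bsub>G\<^esub> g), Inl g], [Inl (inv\<^bsub>G\<^esub> g \<otimes>\<^bsub>G\<^esub> g)]) \<in> word_cong ?A ?E"
      by (intro word_cong.base) (auto simp: free_product_rels_def)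
    moreover have "([Inl \<one>\<^bsub>G\<^esub>], []) \<in> word_cong ?A ?E"
      by (intro word_cong.base) (auto simp: free_product_rels_def)
    ultimately show ?goal
      using g by (intro bexI[of _ "[Inl (inv\<^bsub>G\<^esub> g)]"]) (auto intro: word_cong.trans)
  next
    case h: 2
    then have "([Inr (inv\<^bsub>H\<^esub> h), Inr h], [Inr (inv\<^bsub>H\<^esub> h \<otimes>\<^bsub>H\<^esub> h)]) \<in> word_cong ?A ?E"
      by (intro word_cong.base) (auto simp: free_product_rels_def)
    moreover have "([Inr \<one>\<^bsub>H\<^esub>], []) \<in> word_cong ?A ?E"
      by (intro word_cong.base) (auto simp: free_product_rels_def)
    ultimately show ?goal
      using h by (intro bexI[of _ "[Inr (inv\<^bsub>H\<^esub> h)]"]) (auto intro: word_cong.trans)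
  qed
qed


section \<open>Presentations\<close>

definition normal_closure :: "('g, 'm) monoid_scheme \<Rightarrow> 'g set \<Rightarrow> 'g set" where
  "normal_closure G A = \<Inter>{N. N \<lhd> G \<and> A \<subseteq> N}"

text \<open>The element of \<open>G\<close> obtained from a signed word by substituting \<open>f a\<close> for each letter \<open>a\<close>.\<close>

definition word_value :: "('g, 'm) monoid_scheme \<Rightarrow> ('a \<Rightarrow> 'g) \<Rightarrow> ('a \<times> int) list \<Rightarrow> 'g" where
  "word_value G f w = foldr (\<lambda>(a, e) g. (f a [^]\<^bsub>G\<^esub> e) \<otimes>\<^bsub>G\<^esub> g) w \<one>\<^bsub>G\<^esub>"

definition one_relator_group :: "'a set \<Rightarrow> ('a \<times> int) list \<Rightarrow> ('a \<times> int) list set set monoid" where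
  "one_relator_group A S =
     free_group A Mod normal_closure (free_group A) {word_value (free_group A) (free_gen A) S}"

text \<open>The free product \<open>H * F(Xs)\<close> with the images in it of the elements of \<open>H\<close> and of \<open>Xs\<close>.\<close>

definition rel_free :: "('h, 'm) monoid_scheme \<Rightarrow> 'a set \<Rightarrow> ('h + ('a \<times> int) list set) list set monoid" where
  "rel_free H Xs = free_product H (free_group Xs)"

definition rel_coeff ::
  "('h, 'm) monoid_scheme \<Rightarrow> 'a set \<Rightarrow> 'h \<Rightarrow> ('h + ('a \<times> int) list set) list set" where
  "rel_coeff H Xs = free_product_inl H (free_group Xs)"

definition rel_gen ::
  "('h, 'm) monoid_scheme \<Rightarrow> 'a set \<Rightarrow> 'a \<Rightarrow> ('h + ('a \<times> int) list set) list set" where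
  "rel_gen H Xs x = free_product_inr H (free_group Xs) (free_gen Xs x)"

definition rel_presented_group ::
  "('h, 'm) monoid_scheme \<Rightarrow> 'a set \<Rightarrow> ('h + ('a \<times> int) list set) list set \<Rightarrow>
   ('h + ('a \<times> int) list set) list set set monoid" where
  "rel_presented_group H Xs r = rel_free H Xs Mod normal_closure (rel_free H Xs) {r}"

text \<open>An expression \<open>x\<^sub>1^e\<^sub>1 h\<^sub>1 \<dots> x\<^sub>r^e\<^sub>r h\<^sub>r\<close> is the list of the triples \<open>(x\<^sub>i, e\<^sub>i, h\<^sub>i)\<close>.\<close>

definition one_relator_rel_presentation ::
  "'a set \<Rightarrow> ('h, 'm) monoid_scheme \<Rightarrow> ('a \<times> int \<times> 'h) list \<Rightarrow> bool" where
  "one_relator_rel_presentation Xs H R \<longleftrightarrow>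
     group H \<and> R \<noteq> [] \<and> R \<in> lists (Xs \<times> {1, -1} \<times> carrier H)"

definition skeleton :: "('a \<times> int \<times> 'h) list \<Rightarrow> ('a \<times> int) list" where
  "skeleton R = map (\<lambda>(x, e, h). (x, e)) R"

definition rel_expr_value ::
  "('h, 'm) monoid_scheme \<Rightarrow> 'a set \<Rightarrow> ('a \<times> int \<times> 'h) list \<Rightarrow>
   ('h + ('a \<times> int) list set) list set" where
  "rel_expr_value H Xs R =
     foldr (\<lambda>(x, e, h) g. (rel_gen H Xs x [^]\<^bsub>rel_free H Xs\<^esub> e)
                 \<otimes>\<^bsub>rel_free H Xs\<^esub> (rel_coeff H Xs h \<otimes>\<^bsub>rel_free H Xs\<^esub> g)) R \<one>\<^bsub>rel_free H Xs\<^esub>"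

text \<open>The element \<open>S(Ys, R)\<close> of \<open>H * F(Xs \<union> Ys)\<close>, where \<open>S\<close> is a word on \<open>(Ys \<union> {z})\<^sup>\<plusminus>\<^sup>1\<close>.\<close>

definition substituted_relator ::
  "('h, 'm) monoid_scheme \<Rightarrow> 'a set \<Rightarrow> 'a set \<Rightarrow> 'a \<Rightarrow> ('a \<times> int) list \<Rightarrow>
   ('a \<times> int \<times> 'h) list \<Rightarrow> ('h + ('a \<times> int) list set) list set" where
  "substituted_relator H Xs Ys z S R =
     word_value (rel_free H (Xs \<union> Ys))
       ((rel_gen H (Xs \<union> Ys))(z := rel_expr_value H (Xs \<union> Ys) R)) S"


section \<open>The unique max-min property\<close>

text \<open>
  Letters of a word \<open>W\<close> are numbered from 1 to \<open>r = length W\<close>, with subscripts read modulo \<open>r\<close>;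
  list positions start at 0.
\<close>

definition letter_at :: "('a \<times> int) list \<Rightarrow> nat \<Rightarrow> 'a" where
  "letter_at W i = fst (W ! ((i - 1) mod length W))"

definition exponent_at :: "('a \<times> int) list \<Rightarrow> nat \<Rightarrow> int" where
  "exponent_at W i = snd (W ! ((i - 1) mod length W))"

definition weight_function :: "'a set \<Rightarrow> ('a \<Rightarrow> int) \<Rightarrow> bool" where
  "weight_function Xs \<theta> \<longleftrightarrow> generate integer_group (\<theta> ` Xs) = carrier integer_group"

definition strict_weight :: "'a set \<Rightarrow> ('a \<Rightarrow> int) \<Rightarrow> bool" where
  "strict_weight Xs \<theta> \<longleftrightarrow> (\<forall>x\<in>Xs. \<theta> x \<noteq> 0)"

definition height :: "('a \<Rightarrow> int) \<Rightarrow> ('a \<times> int) list \<Rightarrow> nat \<Rightarrow> int" where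
  "height \<theta> W j = (\<Sum>i=1..j. exponent_at W i * \<theta> (letter_at W i))"

definition admissible :: "('a \<Rightarrow> int) \<Rightarrow> ('a \<times> int) list \<Rightarrow> bool" where
  "admissible \<theta> W \<longleftrightarrow> height \<theta> W (length W) = 0"

definition unique_max_min :: "'a set \<Rightarrow> ('a \<times> int) list \<Rightarrow> bool" where
  "unique_max_min Xs W \<longleftrightarrow>
     (\<exists>\<theta>. weight_function Xs \<theta> \<and> strict_weight Xs \<theta> \<and> admissible \<theta> W \<and>
       (\<exists>k\<in>{1..length W}. \<exists>l\<in>{1..length W}.
          (\<forall>j\<in>{1..length W} - {k}. height \<theta> W j < height \<theta> W k) \<and>
          (\<forall>j\<in>{1..length W} - {l}. height \<theta> W j > height \<theta> W l) \<and>
          letter_at W k \<noteq> letter_at W (k + 1) \<and>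
          letter_at W l \<noteq> letter_at W (l + 1)))"

definition M_presentation ::
  "'a set \<Rightarrow> ('h, 'm) monoid_scheme \<Rightarrow> ('a \<times> int \<times> 'h) list \<Rightarrow> bool" where
  "M_presentation Xs H R \<longleftrightarrow>
     one_relator_rel_presentation Xs H R \<and> unique_max_min Xs (skeleton R)"


section \<open>Residual finiteness\<close>

definition residually_finite :: "('g, 'm) monoid_scheme \<Rightarrow> bool" where
  "residually_finite G \<longleftrightarrow>
     (\<forall>g\<in>carrier G. g \<noteq> \<one>\<^bsub>G\<^esub> \<longrightarrow> (\<exists>N. N \<lhd> G \<and> finite (rcosets\<^bsub>G\<^esub> N) \<and> g \<notin> N))"

end

theory Submission
  imports Defs "HOL-Combinatorics.Permutations"
begin

text \<open>
  The group \<open>G\<close> of the theorem is the quotient of \<open>H * K * F(Xs)\<close> by the single relation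
  \<open>R = z\<close>. A homomorphism from \<open>G\<close> to the wreath product of a group \<open>Q\<close> with the integers that
  lies over the weight \<open>\<theta>\<close> and is constant on \<open>H\<close> and \<open>K\<close> assigns an element of \<open>Q\<close> to each
  edge \<open>(x, n)\<close>, which runs from height \<open>n\<close> to height \<open>n + \<theta> x\<close>, such that for each \<open>i\<close> the
  value of the path \<open>R\<close> started at height \<open>i\<close> is the image of \<open>z\<close>. The unique maximum and minimum
  give two different letters: the highest edge of the first kind and the lowest edge of the
  second kind occur just once in each path. If the edges of both kinds are read off one sequence
  in \<open>Q\<close> (the second with a delay), each relation determines the last term of the segment of the
  sequence that it sees from the others, and likewise the first. So any initial segment extends
  uniquely to all integers, and periodically if \<open>Q\<close> is finite.

  With \<open>Q = H \<times> K\<close> this embeds \<open>H\<close> and \<open>K\<close> into \<open>G\<close>. Conversely, let \<open>H\<close> and \<open>K\<close> be residually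
  finite, and \<open>g \<noteq> 1\<close> in \<open>G\<close>. Then \<open>P = H * K * F(Xs)\<close> is residually finite. Solve the relations in
  \<open>P\<close> from an initial segment that consists of the letters themselves: mapped to \<open>G\<close>, the solution
  is constant on a long interval of heights, so the value of \<open>g\<close> in \<open>P\<close> is not 1. It survives
  in a finite quotient of \<open>P\<close>, where the solution is periodic, and this gives a finite quotient
  of \<open>G\<close> in which \<open>g\<close> survives.
\<close>

section \<open>Preliminaries on words and finite images\<close>

lemma word_value_Nil [simp]: "word_value G f [] = \<one>\<^bsub>G\<^esub>"
  by (simp add: word_value_def)

lemma word_value_Cons [simp]:
  "word_value G f ((a, e) # w) = (f a [^]\<^bsub>G\<^esub> e) \<otimes>\<^bsub>G\<^esub> word_value G f w"
  by (simp add: word_value_def)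

lemma finite_image_factor:
  assumes "finite (\<tau> ` A)" "\<And>x y. x \<in> A \<Longrightarrow> y \<in> A \<Longrightarrow> \<tau> x = \<tau> y \<Longrightarrow> f x = f y"
  shows "finite (f ` A)"
proof -
  have "f ` A \<subseteq> (\<lambda>t. f (SOME x. x \<in> A \<and> \<tau> x = t)) ` \<tau> ` A"
  proof clarify
    fix x assume x: "x \<in> A"
    have "(SOME y. y \<in> A \<and> \<tau> y = \<tau> x) \<in> A \<and> \<tau> (SOME y. y \<in> A \<and> \<tau> y = \<tau> x) = \<tau> x"
      by (rule someI[of "\<lambda>y. y \<in> A \<and> \<tau> y = \<tau> x" x]) (simp add: x)
    then have "f x = f (SOME y. y \<in> A \<and> \<tau> y = \<tau> x)"
      using assms(2) x by metis
    then show "f x \<in> (\<lambda>t. f (SOME x. x \<in> A \<and> \<tau> x = t)) ` \<tau> ` A" using x by blast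
  qed
  then show ?thesis using assms(1) finite_surj by blast
qed


section \<open>Residual finiteness\<close>

text \<open>Each fibre of \<open>\<tau>\<close> lies in one coset, so the index is at most the
  number of values of \<open>\<tau>\<close>. Any invariant may serve as \<open>\<tau>\<close>; later
  it is a homomorphism, a pair of cosets, or one period of a function together with a shift modulo
  the period.\<close>

lemma (in group) finite_rcosets_if_separated:
  assumes N: "N \<lhd> G" and "finite (\<tau> ` carrier G)"
    and sep: "\<And>x y. x \<in> carrier G \<Longrightarrow> y \<in> carrier G \<Longrightarrow> \<tau> x = \<tau> y \<Longrightarrow> x \<otimes> inv y \<in> N"
  shows "finite (rcosets N)"
proof -
  have sub: "subgroup N G" using N by (simp add: normal_imp_subgroup)
  have "N #> x = N #> y" if "x \<in> carrier G" "y \<in> carrier G" "\<tau> x = \<tau> y" for x y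
    using repr_independence[OF subgroup.rcos_module_rev[OF sub is_group that(2,1) sep[OF that]] that(2) sub]
    by simp
  then have "finite ((\<lambda>x. N #> x) ` carrier G)"
    by (rule finite_image_factor[OF assms(2)])
  then show ?thesis unfolding RCOSETS_def UNION_singleton_eq_range .
qed

lemma (in group) finite_image_r_coset:
  assumes "N \<lhd> G" "finite (rcosets N)"
  shows "finite ((\<lambda>x. N #> x) ` carrier G)"
  using assms(2) unfolding RCOSETS_def UNION_singleton_eq_range .

lemma group_homI: "group G \<Longrightarrow> group H \<Longrightarrow> h \<in> hom G H \<Longrightarrow> group_hom G H h"
  by (simp add: group_hom_def group_hom_axioms_def)

lemma (in group_hom) finite_index_kernel:
  assumes "finite (h ` carrier G)"
  shows "finite (rcosets\<^bsub>G\<^esub> (kernel G H h))"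
proof (rule G.finite_rcosets_if_separated[where \<tau> = h])
  show "kernel G H h \<lhd> G" by (rule normal_kernel)
  show "x \<otimes>\<^bsub>G\<^esub> inv\<^bsub>G\<^esub> y \<in> kernel G H h" if "x \<in> carrier G" "y \<in> carrier G" "h x = h y" for x y
    using that by (simp add: kernel_def)
qed fact

text \<open>\<open>M\<close> is the kernel of the composite map to \<open>H Mod N\<close>, whose
  image is finite.\<close>

lemma (in group_hom) finite_index_preimage:
  assumes N: "N \<lhd> H" "finite (rcosets\<^bsub>H\<^esub> N)"
  obtains M where "M \<lhd> G" "finite (rcosets\<^bsub>G\<^esub> M)" "\<And>g. g \<in> carrier G \<Longrightarrow> g \<in> M \<longleftrightarrow> h g \<in> N"
proof -
  interpret N: normal N H by fact
  let ?q = "\<lambda>g. N #>\<^bsub>H\<^esub> h g"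
  have "?q \<in> hom G (H Mod N)"
    using N.r_coset_hom_Mod by (auto simp: hom_def)
  then interpret q: group_hom G "H Mod N" ?q
    using N.factorgroup_is_group by (intro group_homI) auto
  have fin: "finite (?q ` carrier G)"
    by (rule finite_subset[OF _ H.finite_image_r_coset[OF N]]) auto
  have "g \<in> kernel G (H Mod N) ?q \<longleftrightarrow> h g \<in> N" if "g \<in> carrier G" for g
    using that N.rcos_const[of "h g"] H.rcos_self[OF hom_closed[OF that] N.subgroup_axioms]
    by (auto simp: kernel_def FactGroup_def H.is_group)
  then show ?thesis using that q.normal_kernel q.finite_index_kernel[OF fin] by blast
qed

text \<open>A finite-index subgroup of the target pulls back along \<open>h\<close>. Target and
  \<open>h\<close> may depend on \<open>g\<close>, but all targets live on one type.\<close>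

lemma residually_finite_if_separated:
  fixes G :: "('g, 'm) monoid_scheme"
  assumes G: "group G"
    and sep: "\<And>g. g \<in> carrier G \<Longrightarrow> g \<noteq> \<one>\<^bsub>G\<^esub> \<Longrightarrow>
      \<exists>(Q :: ('q, 'n) monoid_scheme) h. h \<in> hom G Q \<and> group Q \<and> residually_finite Q \<and> h g \<noteq> \<one>\<^bsub>Q\<^esub>"
  shows "residually_finite G"
  unfolding residually_finite_def
proof (intro ballI impI)
  fix g assume g: "g \<in> carrier G" "g \<noteq> \<one>\<^bsub>G\<^esub>"
  obtain Q :: "('q, 'n) monoid_scheme" and h
    where h: "h \<in> hom G Q" "group Q" "residually_finite Q" "h g \<noteq> \<one>\<^bsub>Q\<^esub>"
    using sep[OF g] by blast
  interpret group_hom G Q h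
    using G h by (intro group_homI)
  obtain N where "N \<lhd> Q" "finite (rcosets\<^bsub>Q\<^esub> N)" "h g \<notin> N"
    using h g unfolding residually_finite_def by (meson hom_closed)
  then show "\<exists>M. M \<lhd> G \<and> finite (rcosets\<^bsub>G\<^esub> M) \<and> g \<notin> M"
    using finite_index_preimage g by metis
qed

lemma residually_finite_embed:
  assumes "group G" "group Q" "h \<in> hom G Q" "residually_finite Q"
    and "\<And>g. g \<in> carrier G \<Longrightarrow> h g = \<one>\<^bsub>Q\<^esub> \<Longrightarrow> g = \<one>\<^bsub>G\<^esub>"
  shows "residually_finite G"
  by (rule residually_finite_if_separated) (use assms in blast)+

lemma residually_finite_if_finite:
  assumes G: "group G" and fin: "finite (carrier G)"
  shows "residually_finite G"
  unfolding residually_finite_def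
proof (intro ballI impI)
  fix g assume g: "g \<in> carrier G" "g \<noteq> \<one>\<^bsub>G\<^esub>"
  interpret group G by fact
  have "{\<one>\<^bsub>G\<^esub>} \<lhd> G" by (rule one_is_normal)
  moreover have "finite (rcosets\<^bsub>G\<^esub> {\<one>\<^bsub>G\<^esub>})" using fin by (simp add: RCOSETS_def)
  ultimately show "\<exists>N. N \<lhd> G \<and> finite (rcosets\<^bsub>G\<^esub> N) \<and> g \<notin> N" using g by blast
qed

lemma residually_finite_DirProd:
  assumes "group G" "group H" "residually_finite G" "residually_finite H"
  shows "residually_finite (G \<times>\<times> H)"
  unfolding residually_finite_def
proof (intro ballI impI)
  interpret G: group G by fact
  interpret H: group H by fact
  have P: "group (G \<times>\<times> H)" by (simp add: DirProd_group assms)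
  fix g assume g: "g \<in> carrier (G \<times>\<times> H)" "g \<noteq> \<one>\<^bsub>G \<times>\<times> H\<^esub>"
  interpret f: group_hom "G \<times>\<times> H" G fst
    using P assms by (auto intro!: group_homI simp: hom_def)
  interpret s: group_hom "G \<times>\<times> H" H snd
    using P assms by (auto intro!: group_homI simp: hom_def)
  consider "fst g \<noteq> \<one>\<^bsub>G\<^esub>" | "snd g \<noteq> \<one>\<^bsub>H\<^esub>" using g by (cases g) auto
  then show "\<exists>N. N \<lhd> (G \<times>\<times> H) \<and> finite (rcosets\<^bsub>G \<times>\<times> H\<^esub> N) \<and> g \<notin> N"
  proof cases
    case 1
    then obtain N where "N \<lhd> G" "finite (rcosets\<^bsub>G\<^esub> N)" "fst g \<notin> N"
      using assms(3) g unfolding residually_finite_def by (meson f.hom_closed)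
    then show ?thesis using f.finite_index_preimage g by metis
  next
    case 2
    then obtain N where "N \<lhd> H" "finite (rcosets\<^bsub>H\<^esub> N)" "snd g \<notin> N"
      using assms(4) g unfolding residually_finite_def by (meson s.hom_closed)
    then show ?thesis using s.finite_index_preimage g by metis
  qed
qed

lemma residually_finite_integer_group: "residually_finite integer_group"
  unfolding residually_finite_def
proof (intro ballI impI)
  fix n assume "n \<in> carrier integer_group" "n \<noteq> \<one>\<^bsub>integer_group\<^esub>"
  then have n: "n \<noteq> 0" by simp
  \<comment> \<open>The modulus exceeds \<bar>n\<bar>, so it cannot divide \<open>n\<close>.\<close>
  let ?m = "nat \<bar>n\<bar> + 1"
  interpret q: group_hom integer_group "integer_mod_group ?m" "\<lambda>x. x mod int ?m"
    by (intro group_homI) (auto simp: hom_def mod_simps mult_integer_mod_group carrier_integer_mod_group)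
  have "finite ((\<lambda>x. x mod int ?m) ` carrier integer_group)"
    by (rule finite_subset[of _ "{0..<int ?m}"]) auto
  moreover have "n mod int ?m \<noteq> 0"
    using n zdvd_imp_le[of "int ?m" "\<bar>n\<bar>"] by (auto simp flip: dvd_eq_mod_eq_0)
  ultimately show "\<exists>N. N \<lhd> integer_group \<and> finite (rcosets\<^bsub>integer_group\<^esub> N) \<and> n \<notin> N"
    using q.normal_kernel q.finite_index_kernel by (auto simp: kernel_def)
qed

text \<open>Finitely many elements are avoided at once by intersecting one subgroup for each of
  them.\<close>

lemma (in group) residually_finite_finite_set:
  assumes G: "residually_finite G" and "finite F" "F \<subseteq> carrier G" "\<one> \<notin> F"
  shows "\<exists>N. N \<lhd> G \<and> finite (rcosets N) \<and> F \<inter> N = {}"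
  using assms(2-)
proof (induction F)
  case empty
  have "carrier G \<lhd> G" by (simp add: normal_inv_iff subgroup_self)
  moreover have "finite (rcosets (carrier G))"
    by (rule finite_rcosets_if_separated[where \<tau> = "\<lambda>_. ()"]) (auto intro: calculation)
  ultimately show ?case by blast
next
  case (insert g F)
  obtain N where N: "N \<lhd> G" "finite (rcosets N)" "F \<inter> N = {}" using insert by auto
  obtain M where M: "M \<lhd> G" "finite (rcosets M)" "g \<notin> M"
    using insert G unfolding residually_finite_def by auto
  interpret N: normal N G by fact
  interpret M: normal M G by fact
  let ?t = "\<lambda>x. (N #> x, M #> x)"
  have "N \<inter> M \<lhd> G"
    unfolding normal_inv_iff using N.inv_op_closed2 M.inv_op_closed2
    by (simp add: subgroups_Inter_pair N.subgroup_axioms M.subgroup_axioms)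
  \<comment> \<open>The pair of cosets determines the coset of \<open>N \<inter> M\<close> and takes
    finitely many values.\<close>
  moreover have "finite (?t ` carrier G)"
    by (rule finite_subset[of _ "(\<lambda>x. N #> x) ` carrier G \<times> (\<lambda>x. M #> x) ` carrier G"])
      (use finite_image_r_coset N M in auto)
  then have "finite (rcosets (N \<inter> M))"
  proof (rule finite_rcosets_if_separated[OF calculation])
    fix x y assume xy: "x \<in> carrier G" "y \<in> carrier G" "?t x = ?t y"
    have "x \<in> N #> y" "x \<in> M #> y"
      using rcos_self[OF xy(1) N.subgroup_axioms] rcos_self[OF xy(1) M.subgroup_axioms] xy(3) by auto
    then show "x \<otimes> inv y \<in> N \<inter> M"
      using N.rcos_module_imp[OF is_group] M.rcos_module_imp[OF is_group] xy by blast
  qed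
  ultimately show ?case using N M by (intro exI[of _ "N \<inter> M"]) auto
qed


section \<open>Universal properties\<close>

definition letter_prod :: "('g, 'm) monoid_scheme \<Rightarrow> ('c \<Rightarrow> 'g) \<Rightarrow> 'c list \<Rightarrow> 'g" where
  "letter_prod Q m w = foldr (\<lambda>c g. m c \<otimes>\<^bsub>Q\<^esub> g) w \<one>\<^bsub>Q\<^esub>"

lemma letter_prod_simps [simp]:
  "letter_prod Q m [] = \<one>\<^bsub>Q\<^esub>" "letter_prod Q m (c # w) = m c \<otimes>\<^bsub>Q\<^esub> letter_prod Q m w"
  by (simp_all add: letter_prod_def)

context monoid
begin

lemma letter_prod_closed: "(\<And>c. c \<in> A \<Longrightarrow> m c \<in> carrier G) \<Longrightarrow> w \<in> lists A \<Longrightarrow> letter_prod G m w \<in> carrier G"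
  by (induction w) auto

lemma letter_prod_append:
  "(\<And>c. c \<in> A \<Longrightarrow> m c \<in> carrier G) \<Longrightarrow> u \<in> lists A \<Longrightarrow> v \<in> lists A \<Longrightarrow>
    letter_prod G m (u @ v) = letter_prod G m u \<otimes> letter_prod G m v"
proof (induction u)
  case (Cons c u)
  moreover from Cons have "letter_prod G m u \<in> carrier G" "letter_prod G m v \<in> carrier G" "m c \<in> carrier G"
    by (auto simp del: in_lists_conv_set intro!: letter_prod_closed[of A])
  ultimately show ?case by (simp add: m_assoc)
qed (simp add: letter_prod_closed[of A] del: in_lists_conv_set)

text \<open>Evaluation of words respects the congruence, so \<open>h\<close> may evaluate a
  representative picked by \<open>SOME\<close>. The relations to check are those between words over
  \<open>A\<close>, as in the rule \<open>base\<close> of \<open>word_cong\<close>.\<close>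

lemma presented_monoid_universal:
  assumes m: "\<And>c. c \<in> A \<Longrightarrow> m c \<in> carrier G"
    and E: "\<And>u v. (u, v) \<in> E \<Longrightarrow> u \<in> lists A \<Longrightarrow> v \<in> lists A \<Longrightarrow> letter_prod G m u = letter_prod G m v"
  obtains h where "h \<in> hom (presented_monoid A E) G"
    "\<And>u. u \<in> lists A \<Longrightarrow> h (word_cong A E `` {u}) = letter_prod G m u"
proof -
  have eq: "letter_prod G m u = letter_prod G m v" if "(u, v) \<in> word_cong A E" for u v
    using that
  proof induction
    case (append u u' v v')
    then show ?case
      using word_cong_lists[OF append.hyps(1)] word_cong_lists[OF append.hyps(2)]
      by (simp add: letter_prod_append[of A m, OF m] del: in_lists_conv_set)
  next
    case (base u v)
    then show ?case by (rule E)
  qed simp_all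
  let ?h = "\<lambda>P. letter_prod G m (SOME u. u \<in> P)"
  have h: "?h (word_cong A E `` {u}) = letter_prod G m u" if "u \<in> lists A" for u
  proof -
    have "(SOME v. v \<in> word_cong A E `` {u}) \<in> word_cong A E `` {u}"
      by (rule someI[of "\<lambda>v. v \<in> word_cong A E `` {u}" u])
        (simp add: that word_cong.refl del: in_lists_conv_set)
    then show ?thesis using eq[of u "SOME v. v \<in> word_cong A E `` {u}"] by simp
  qed
  have "?h \<in> hom (presented_monoid A E) G"
  proof (rule homI)
    fix P assume "P \<in> carrier (presented_monoid A E)"
    then obtain u where u: "u \<in> lists A" "P = word_cong A E `` {u}"
      by (auto simp: presented_monoid_def quotient_def)
    then show "?h P \<in> carrier G" using h[OF u(1)] letter_prod_closed[of A m, OF m u(1)] by simp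
    fix Q assume "Q \<in> carrier (presented_monoid A E)"
    then obtain v where v: "v \<in> lists A" "Q = word_cong A E `` {v}"
      by (auto simp: presented_monoid_def quotient_def)
    have "u @ v \<in> lists A" using u v by simp
    then show "?h (P \<otimes>\<^bsub>presented_monoid A E\<^esub> Q) = ?h P \<otimes> ?h Q"
      using u v by (simp only: presented_monoid_mult h letter_prod_append[OF m])
  qed
  with h that show thesis by blast
qed

end

text \<open>The induction peels the first letter off a representative. It serves to show that a
  subgroup containing the generators is everything.\<close>

lemma presented_monoid_induct [consumes 1, case_names one step]:
  assumes "P \<in> carrier (presented_monoid A E)"
    and one: "S \<one>\<^bsub>presented_monoid A E\<^esub>"
    and step: "\<And>a P. a \<in> A \<Longrightarrow> P \<in> carrier (presented_monoid A E) \<Longrightarrow> S P \<Longrightarrow>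
      S ((word_cong A E `` {[a]}) \<otimes>\<^bsub>presented_monoid A E\<^esub> P)"
  shows "S P"
proof -
  obtain u where u: "u \<in> lists A" "P = word_cong A E `` {u}"
    using assms(1) by (auto simp: presented_monoid_def quotient_def)
  have "S (word_cong A E `` {u})" using u(1)
  proof (induction u)
    case Nil
    then show ?case using one by (simp add: presented_monoid_def)
  next
    case (Cons a u)
    then have "word_cong A E `` {u} \<in> carrier (presented_monoid A E)"
      by (auto simp: presented_monoid_def quotient_def)
    moreover have "word_cong A E `` {[a]} \<otimes>\<^bsub>presented_monoid A E\<^esub> (word_cong A E `` {u}) = word_cong A E `` {a # u}"
      using Cons by (subst presented_monoid_mult) auto
    ultimately show ?case using step[OF Cons.hyps(1) _ Cons.IH] by simp
  qed
  with u show ?thesis by simp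
qed

lemma presented_monoid_gen_closed:
  "a \<in> A \<Longrightarrow> word_cong A E `` {[a]} \<in> carrier (presented_monoid A E)"
  by (auto simp: presented_monoid_def quotient_def)

section \<open>Free products of copies of a group\<close>

definition copower_rels :: "'i set \<Rightarrow> ('g, 'm) monoid_scheme \<Rightarrow> (('i \<times> 'g) list \<times> ('i \<times> 'g) list) set" where
  "copower_rels I A =
     {([(i, a), (i, b)], [(i, a \<otimes>\<^bsub>A\<^esub> b)]) | i a b. i \<in> I \<and> a \<in> carrier A \<and> b \<in> carrier A} \<union>
     {([(i, \<one>\<^bsub>A\<^esub>)], []) | i. i \<in> I}"

text \<open>All factors are copies of one group, so a single finite quotient can be chosen for all
  of them. Different groups are accommodated by taking \<open>A\<close> to be their direct product,
  as in \<open>free_product_cover\<close>.\<close>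

definition copower :: "'i set \<Rightarrow> ('g, 'm) monoid_scheme \<Rightarrow> ('i \<times> 'g) list set monoid" where
  "copower I A = presented_monoid (I \<times> carrier A) (copower_rels I A)"

definition copower_in :: "'i set \<Rightarrow> ('g, 'm) monoid_scheme \<Rightarrow> 'i \<Rightarrow> 'g \<Rightarrow> ('i \<times> 'g) list set" where
  "copower_in I A i a = word_cong (I \<times> carrier A) (copower_rels I A) `` {[(i, a)]}"

context group
begin

lemma copower_cong_mult:
  assumes "i \<in> I" "a \<in> carrier G" "b \<in> carrier G"
  shows "([(i, a), (i, b)], [(i, a \<otimes> b)]) \<in> word_cong (I \<times> carrier G) (copower_rels I G)"
  using assms by (intro word_cong.base) (auto simp: copower_rels_def)

lemma copower_cong_one:
  "i \<in> I \<Longrightarrow> ([(i, \<one>)], []) \<in> word_cong (I \<times> carrier G) (copower_rels I G)"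
  by (intro word_cong.base) (auto simp: copower_rels_def)

lemma group_copower: "group (copower I G)"
  unfolding copower_def
proof (rule group_presented_monoid)
  fix c assume "c \<in> I \<times> carrier G"
  then obtain i a where c: "c = (i, a)" "i \<in> I" "a \<in> carrier G" by blast
  then have "([(i, inv a), (i, a)], [(i, inv a \<otimes> a)]) \<in> word_cong (I \<times> carrier G) (copower_rels I G)"
    by (intro copower_cong_mult) auto
  then have "([(i, inv a)] @ [c], []) \<in> word_cong (I \<times> carrier G) (copower_rels I G)"
    using copower_cong_one[of i I] c by (auto intro: word_cong.trans)
  then show "\<exists>w\<in>lists (I \<times> carrier G). (w @ [c], []) \<in> word_cong (I \<times> carrier G) (copower_rels I G)"
    using c by (intro bexI[of _ "[(i, inv a)]"]) auto
qed

lemma copower_in_hom: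
  assumes "i \<in> I"
  shows "copower_in I G i \<in> hom G (copower I G)"
proof (rule homI)
  fix a b assume a: "a \<in> carrier G"
  then show "copower_in I G i a \<in> carrier (copower I G)"
    using assms by (auto simp: copower_in_def copower_def intro!: presented_monoid_gen_closed)
  assume b: "b \<in> carrier G"
  have "copower_in I G i a \<otimes>\<^bsub>copower I G\<^esub> copower_in I G i b =
    word_cong (I \<times> carrier G) (copower_rels I G) `` {[(i, a)] @ [(i, b)]}"
    unfolding copower_in_def copower_def using a b assms by (intro presented_monoid_mult) auto
  also have "\<dots> = copower_in I G i (a \<otimes> b)"
    unfolding copower_in_def using copower_cong_mult[OF assms a b]
    by (simp add: equiv_class_eq[OF equiv_word_cong])
  finally show "copower_in I G i (a \<otimes> b) = copower_in I G i a \<otimes>\<^bsub>copower I G\<^esub> copower_in I G i b" ..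
qed

lemma copower_universal:
  assumes "group Q" and f: "\<And>i. i \<in> I \<Longrightarrow> f i \<in> hom G Q"
  obtains h where "h \<in> hom (copower I G) Q"
    "\<And>w. w \<in> lists (I \<times> carrier G) \<Longrightarrow>
      h (word_cong (I \<times> carrier G) (copower_rels I G) `` {w}) = letter_prod Q (\<lambda>(i, a). f i a) w"
    "\<And>i a. i \<in> I \<Longrightarrow> a \<in> carrier G \<Longrightarrow> h (copower_in I G i a) = f i a"
proof -
  interpret Q: group Q by fact
  have m: "(case c of (i, a) \<Rightarrow> f i a) \<in> carrier Q" if "c \<in> I \<times> carrier G" for c
    using that f by (auto simp: hom_def)
  have E: "letter_prod Q (\<lambda>(i, a). f i a) u = letter_prod Q (\<lambda>(i, a). f i a) v"
    if "(u, v) \<in> copower_rels I G" for u v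
    using that f hom_one[OF f is_group \<open>group Q\<close>]
    by (auto simp: copower_rels_def hom_mult hom_in_carrier Q.m_assoc)
      (simp add: hom_def Pi_def)
  obtain h where h: "h \<in> hom (copower I G) Q"
    "\<And>w. w \<in> lists (I \<times> carrier G) \<Longrightarrow>
      h (word_cong (I \<times> carrier G) (copower_rels I G) `` {w}) = letter_prod Q (\<lambda>(i, a). f i a) w"
    using Q.presented_monoid_universal[of "I \<times> carrier G" "\<lambda>(i, a). f i a" "copower_rels I G"] m E
    unfolding copower_def by metis
  have "h (copower_in I G i a) = f i a" if "i \<in> I" "a \<in> carrier G" for i a
    unfolding copower_in_def using h(2)[of "[(i, a)]"] that m[of "(i, a)"] by simp
  with h that show thesis by blast
qed

lemma copower_reduced_word:
  assumes "w \<in> lists (I \<times> carrier G)"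
  shows "\<exists>v\<in>lists (I \<times> (carrier G - {\<one>})). distinct_adj (map fst v) \<and>
    (w, v) \<in> word_cong (I \<times> carrier G) (copower_rels I G)"
  using assms
proof (induction w)
  case Nil
  then show ?case by (auto intro!: bexI[of _ "[]"] word_cong.refl)
next
  case (Cons c w)
  let ?C = "word_cong (I \<times> carrier G) (copower_rels I G)"
  obtain i a where c: "c = (i, a)" "i \<in> I" "a \<in> carrier G" using Cons by blast
  obtain v where v: "v \<in> lists (I \<times> (carrier G - {\<one>}))" "distinct_adj (map fst v)" "(w, v) \<in> ?C"
    using Cons by blast
  have v': "v \<in> lists (I \<times> carrier G)" using v by auto
  have "([c] @ w, [c] @ v) \<in> ?C"
    using c v by (intro word_cong.append word_cong.refl) auto
  then have cw: "(c # w, c # v) \<in> ?C" by simp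
  show ?case
  proof (cases "a = \<one>")
    case True
    then have "([c] @ v, [] @ v) \<in> ?C"
      using c v' by (intro word_cong.append word_cong.refl) (auto simp: copower_cong_one)
    then have "(c # w, v) \<in> ?C" using cw by (auto intro: word_cong.trans)
    then show ?thesis using v by blast
  next
    case a: False
    show ?thesis
    proof (cases "v \<noteq> [] \<and> fst (hd v) = i")
      case False
      then have "distinct_adj (map fst (c # v))"
        using v c by (auto simp: distinct_adj_Cons hd_map)
      moreover have "c # v \<in> lists (I \<times> (carrier G - {\<one>}))" using v c a by auto
      ultimately show ?thesis using cw by blast
    next
      case True
      then obtain b t where t: "v = (i, b) # t" by (cases v) auto
      have b: "b \<in> carrier G" using v t by auto
      have tl: "t \<in> lists (I \<times> (carrier G - {\<one>}))" "t \<in> lists (I \<times> carrier G)" "distinct_adj (map fst t)"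
        using v t by (auto dest: distinct_adj_ConsD)
      have "([(i, a), (i, b)] @ t, [(i, a \<otimes> b)] @ t) \<in> ?C"
        using c b tl by (intro word_cong.append word_cong.refl copower_cong_mult) auto
      then have ab: "(c # w, [(i, a \<otimes> b)] @ t) \<in> ?C"
        using cw c t by (auto intro: word_cong.trans)
      show ?thesis
      proof (cases "a \<otimes> b = \<one>")
        case True
        have "([(i, a \<otimes> b)] @ t, [] @ t) \<in> ?C"
          unfolding True using c tl by (intro word_cong.append word_cong.refl copower_cong_one) auto
        then have "(c # w, t) \<in> ?C" using ab by (auto intro: word_cong.trans)
        then show ?thesis using tl by blast
      next
        case False
        have "distinct_adj (map fst ((i, a \<otimes> b) # t))" using v t by simp
        moreover have "(i, a \<otimes> b) # t \<in> lists (I \<times> (carrier G - {\<one>}))"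
          using tl c b False by auto
        ultimately show ?thesis using ab by (intro bexI[of _ "(i, a \<otimes> b) # t"]) simp_all
      qed
    qed
  qed
qed

end

section \<open>Permutation groups as finite targets\<close>

definition perm_group :: "'v set \<Rightarrow> ('v \<Rightarrow> 'v) monoid" where
  "perm_group V = \<lparr>carrier = {p. p permutes V}, monoid.mult = (\<circ>), one = id\<rparr>"

lemma perm_group_simps [simp]:
  "carrier (perm_group V) = {p. p permutes V}" "p \<otimes>\<^bsub>perm_group V\<^esub> q = p \<circ> q" "\<one>\<^bsub>perm_group V\<^esub> = id"
  by (simp_all add: perm_group_def)

lemma group_perm_group: "group (perm_group V)"
proof (rule groupI)
  fix p assume p: "p \<in> carrier (perm_group V)"
  show "\<exists>q\<in>carrier (perm_group V). q \<otimes>\<^bsub>perm_group V\<^esub> p = \<one>\<^bsub>perm_group V\<^esub>"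
    by (rule bexI[of _ "Hilbert_Choice.inv p"]) (use p in \<open>simp_all add: permutes_inv permutes_inv_o\<close>)
qed (auto simp: permutes_compose o_assoc)

text \<open>Each \<open>act b\<close> is a bijection of \<open>V\<close> with inverse
  \<open>act (inv b)\<close>; outside \<open>V\<close> it is completed by the identity, as
  \<open>permutes\<close> demands.\<close>

lemma (in group) action_perm_hom:
  assumes closed: "\<And>b v. b \<in> carrier G \<Longrightarrow> v \<in> V \<Longrightarrow> act b v \<in> V"
    and one: "\<And>v. v \<in> V \<Longrightarrow> act \<one> v = v"
    and mult: "\<And>a b v. a \<in> carrier G \<Longrightarrow> b \<in> carrier G \<Longrightarrow> v \<in> V \<Longrightarrow> act (a \<otimes> b) v = act a (act b v)"
  shows "(\<lambda>b v. if v \<in> V then act b v else v) \<in> hom G (perm_group V)"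
proof (rule homI)
  fix a b assume a: "a \<in> carrier G"
  have "act (inv a) (act a v) = v" "act a (act (inv a) v) = v" if "v \<in> V" for v
    using mult[of "inv a" a v] mult[of a "inv a" v] one a that by auto
  then have "bij_betw (\<lambda>v. if v \<in> V then act a v else v) V V"
    using closed a by (intro bij_betwI[where g = "act (inv a)"]) auto
  then show "(\<lambda>v. if v \<in> V then act a v else v) \<in> carrier (perm_group V)"
    by (auto intro: bij_imp_permutes)
  assume "b \<in> carrier G"
  then show "(\<lambda>v. if v \<in> V then act (a \<otimes> b) v else v) =
      (\<lambda>v. if v \<in> V then act a v else v) \<otimes>\<^bsub>perm_group V\<^esub> (\<lambda>v. if v \<in> V then act b v else v)"
    using a mult closed by auto
qed


subsection \<open>The action on reduced words of bounded length\<close>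

text \<open>The first half of van der Waerden's action on normal forms: a word is split into its
  leading syllable in factor \<open>i\<close>, taken to be \<open>\<one>\<close> if there is none,
  and the rest. Multiplication in factor \<open>i\<close> then changes the syllable only, and
  \<open>word_push\<close> puts the result back.\<close>

definition word_pop :: "('g, 'm) monoid_scheme \<Rightarrow> 'i \<Rightarrow> ('i \<times> 'g) list \<Rightarrow> 'g \<times> ('i \<times> 'g) list" where
  "word_pop B i v = (if v \<noteq> [] \<and> fst (hd v) = i then (snd (hd v), tl v) else (\<one>\<^bsub>B\<^esub>, v))"

definition word_push :: "('g, 'm) monoid_scheme \<Rightarrow> 'i \<Rightarrow> 'g \<Rightarrow> ('i \<times> 'g) list \<Rightarrow> ('i \<times> 'g) list" where
  "word_push B i b t = (if b = \<one>\<^bsub>B\<^esub> then t else (i, b) # t)"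

text \<open>Words that would become longer than \<open>n\<close> are fixed, which keeps the action finite.\<close>

definition word_act :: "nat \<Rightarrow> ('g, 'm) monoid_scheme \<Rightarrow> 'i \<Rightarrow> 'g \<Rightarrow> ('i \<times> 'g) list \<Rightarrow> ('i \<times> 'g) list" where
  "word_act n B i b v =
     (case word_pop B i v of (c, t) \<Rightarrow> if length t < n then word_push B i (b \<otimes>\<^bsub>B\<^esub> c) t else v)"

definition reduced_words :: "nat \<Rightarrow> ('g, 'm) monoid_scheme \<Rightarrow> 'i set \<Rightarrow> ('i \<times> 'g) list set" where
  "reduced_words n B J =
     {v \<in> lists (J \<times> (carrier B - {\<one>\<^bsub>B\<^esub>})). distinct_adj (map fst v) \<and> length v \<le> n}"

lemma finite_reduced_words:
  assumes "finite (carrier B)" "finite J"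
  shows "finite (reduced_words n B J)"
proof (rule finite_subset)
  show "reduced_words n B J \<subseteq> {v. set v \<subseteq> J \<times> carrier B \<and> length v \<le> n}"
    by (auto simp: reduced_words_def)
  show "finite {v. set v \<subseteq> J \<times> carrier B \<and> length v \<le> n}"
    using assms by (intro finite_lists_length_le) auto
qed

lemma (in group) word_pop_cases:
  assumes "v \<in> reduced_words n G J"
  obtains c t where "word_pop G i v = (c, t)" "word_push G i c t = v" "c \<in> carrier G"
    "t \<in> reduced_words n G J" "t = [] \<or> fst (hd t) \<noteq> i"
proof (cases "v \<noteq> [] \<and> fst (hd v) = i")
  case True
  then obtain c t where v: "v = (i, c) # t" by (cases v) auto
  then show thesis
    using assms that[of c t]
    by (cases t) (auto simp: word_pop_def word_push_def reduced_words_def)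
next
  case False
  then show thesis
    using assms that[of \<one> v] by (auto simp: word_pop_def word_push_def)
qed

lemma word_pop_push:
  "t = [] \<or> fst (hd t) \<noteq> i \<Longrightarrow> word_pop B i (word_push B i c t) = (c, t)"
  by (auto simp: word_pop_def word_push_def)

lemma (in group) word_push_reduced:
  assumes "t \<in> reduced_words n G J" "t = [] \<or> fst (hd t) \<noteq> i" "length t < n" "i \<in> J" "c \<in> carrier G"
  shows "word_push G i c t \<in> reduced_words n G J"
  using assms by (auto simp: reduced_words_def word_push_def distinct_adj_Cons hd_map)

text \<open>The rest \<open>t\<close> is the same for all words in an orbit, hence so is the outcome
  of the test \<open>length t < n\<close>. An orbit is therefore either fixed pointwise or acted on
  by left multiplication of the syllable, and the length bound does not spoil the action.\<close>

lemma (in group) word_act_hom: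
  assumes "i \<in> J"
  shows "(\<lambda>b v. if v \<in> reduced_words n G J then word_act n G i b v else v)
    \<in> hom G (perm_group (reduced_words n G J))"
proof (rule action_perm_hom)
  fix a b v assume b: "b \<in> carrier G" and v: "v \<in> reduced_words n G J"
  obtain c t where ct: "word_pop G i v = (c, t)" "word_push G i c t = v" "c \<in> carrier G"
    "t \<in> reduced_words n G J" "t = [] \<or> fst (hd t) \<noteq> i"
    using word_pop_cases[OF v] .
  show "word_act n G i b v \<in> reduced_words n G J"
    using ct b v assms by (auto simp: word_act_def intro!: word_push_reduced)
  assume "a \<in> carrier G"
  then show "word_act n G i (a \<otimes> b) v = word_act n G i a (word_act n G i b v)"
    using ct b by (auto simp: word_act_def word_pop_push m_assoc)
next
  fix v assume v: "v \<in> reduced_words n G J"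
  obtain c t where "word_pop G i v = (c, t)" "word_push G i c t = v" "c \<in> carrier G"
    using word_pop_cases[OF v] .
  then show "word_act n G i \<one> v = v" by (simp add: word_act_def)
qed

text \<open>In a permutation action on finitely many words, a reduced word carries the empty word to
  its own image over a finite quotient of \<open>G\<close>, hence acts nontrivially.\<close>

theorem (in group) residually_finite_copower:
  fixes I :: "'i set"
  assumes rf: "residually_finite G"
  shows "residually_finite (copower I G)"
proof (rule residually_finite_if_separated[OF group_copower])
  let ?C = "word_cong (I \<times> carrier G) (copower_rels I G)"
  fix x assume x: "x \<in> carrier (copower I G)" "x \<noteq> \<one>\<^bsub>copower I G\<^esub>"
  obtain u where u: "u \<in> lists (I \<times> carrier G)" "x = ?C `` {u}"
    using x by (auto simp: copower_def presented_monoid_def quotient_def)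
  obtain w where w: "w \<in> lists (I \<times> (carrier G - {\<one>}))" "distinct_adj (map fst w)" "(u, w) \<in> ?C"
    using copower_reduced_word[OF u(1)] by blast
  have xw: "x = ?C `` {w}" using u w(3) by (simp add: equiv_class_eq[OF equiv_word_cong])
  have w_ne: "w \<noteq> []" using x(2) xw by (auto simp: copower_def presented_monoid_def)
  \<comment> \<open>No syllable of \<open>w\<close> lies in \<open>N\<close>, so the images of the
    syllables are nontrivial and still form a reduced word.\<close>
  obtain N where N: "N \<lhd> G" "finite (rcosets N)" "snd ` set w \<inter> N = {}"
    using residually_finite_finite_set[OF rf, of "snd ` set w"] w(1) by fastforce
  interpret N: normal N G by fact
  interpret B: group "G Mod N" by (rule N.factorgroup_is_group)
  let ?J = "fst ` set w" and ?n = "length w"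
  let ?V = "reduced_words ?n (G Mod N) ?J"
  \<comment> \<open>Factors that do not occur in \<open>w\<close> act trivially, so the words acted
    on use finitely many factors and form a finite set.\<close>
  define f where "f i a = (if i \<in> ?J then (\<lambda>v. if v \<in> ?V then word_act ?n (G Mod N) i (N #> a) v else v)
    else id)" for i a
  have f_hom: "f i \<in> hom G (perm_group ?V)" for i
  proof (cases "i \<in> ?J")
    case True
    have "(\<lambda>a v. if v \<in> ?V then word_act ?n (G Mod N) i (N #> a) v else v) \<in> hom G (perm_group ?V)"
      using Group.hom_compose[OF N.r_coset_hom_Mod B.word_act_hom[OF True, of ?n]]
      unfolding o_def by simp
    then show ?thesis using True unfolding f_def by presburger
  qed (auto simp: f_def hom_def)
  obtain h where h: "h \<in> hom (copower I G) (perm_group ?V)"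
    "\<And>w. w \<in> lists (I \<times> carrier G) \<Longrightarrow> h (?C `` {w}) = letter_prod (perm_group ?V) (\<lambda>(i, a). f i a) w"
    by (rule copower_universal[where I = I and f = f, OF group_perm_group f_hom]) blast
  \<comment> \<open>Read from the right, the letters of \<open>w\<close> are pushed one by one onto
    the empty word. Before each push the length is below \<open>?n\<close>, so the length bound
    never interferes.\<close>
  have "letter_prod (perm_group ?V) (\<lambda>(i, a). f i a) v [] = map (\<lambda>(i, a). (i, N #> a)) v \<and>
      map (\<lambda>(i, a). (i, N #> a)) v \<in> ?V"
    if "set v \<subseteq> set w" "distinct_adj (map fst v)" "length v \<le> ?n" for v
    using that
  proof (induction v)
    case Nil
    then show ?case by (simp add: reduced_words_def)
  next
    case (Cons c v)
    let ?m = "map (\<lambda>(i, a). (i, N #> a))"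
    obtain i a where c: "c = (i, a)" by fastforce
    have i: "i \<in> ?J" "a \<in> carrier G" "a \<notin> N"
      using Cons.prems(1) c w(1) N(3) by force+
    have na: "N #> a \<noteq> \<one>\<^bsub>G Mod N\<^esub>" "N #> a \<in> carrier (G Mod N)"
      using i rcos_self[OF i(2) N.subgroup_axioms] rcosetsI[OF N.subset i(2)]
      by (auto simp: FactGroup_def)
    have hd: "?m v = [] \<or> fst (hd (?m v)) \<noteq> i"
      using Cons.prems(2) c by (cases v) (auto split: prod.splits)
    have IH: "letter_prod (perm_group ?V) (\<lambda>(i, a). f i a) v [] = ?m v" "?m v \<in> ?V"
      using Cons by (auto dest: distinct_adj_ConsD)
    have "word_pop (G Mod N) i (?m v) = (\<one>\<^bsub>G Mod N\<^esub>, ?m v)"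
      using hd by (auto simp: word_pop_def)
    then have "word_act ?n (G Mod N) i (N #> a) (?m v) = word_push (G Mod N) i (N #> a) (?m v)"
      using na Cons.prems(3) by (simp add: word_act_def del: mult_FactGroup one_FactGroup)
    also have "\<dots> = ?m (c # v)"
      using na by (simp add: word_push_def c)
    finally have "word_act ?n (G Mod N) i (N #> a) (?m v) = ?m (c # v)" .
    moreover have "?m (c # v) \<in> ?V"
      using B.word_push_reduced[OF IH(2) hd _ i(1) na(2)] na Cons.prems(3)
      by (simp add: word_push_def c)
    ultimately show ?case using IH i(1) by (simp add: c f_def)
  qed
  moreover have "w \<in> lists (I \<times> carrier G)" using w(1) by auto
  ultimately have "h x [] = map (\<lambda>(i, a). (i, N #> a)) w"
    using h(2) w(2) xw by simp
  then have "h x [] \<noteq> []" using w_ne by simp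
  then have "h x \<noteq> \<one>\<^bsub>perm_group ?V\<^esub>" by auto
  moreover have "finite (carrier (G Mod N))" using N by (simp add: FactGroup_def)
  then have "finite (carrier (perm_group ?V))"
    by (simp add: finite_permutations finite_reduced_words)
  then have "residually_finite (perm_group ?V)"
    by (rule residually_finite_if_finite[OF group_perm_group])
  ultimately show "\<exists>(Q :: (('i \<times> 'a set) list \<Rightarrow> ('i \<times> 'a set) list) monoid) h.
      h \<in> hom (copower I G) Q \<and> group Q \<and> residually_finite Q \<and> h x \<noteq> \<one>\<^bsub>Q\<^esub>"
    using h(1) group_perm_group by blast
qed

section \<open>Bi-infinite sequences with a local constraint solvable at both ends\<close>

text \<open>There is one relation \<open>sat i E\<close> for each height \<open>i\<close>. It sees
  the entries from \<open>i + q\<close> to \<open>i + p\<close> and determines either end entry from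
  the remaining ones, so \<open>p - q\<close> consecutive entries are free initial data.\<close>

locale two_sided_recursion =
  fixes C :: "'q set" and p q :: int and sat :: "int \<Rightarrow> (int \<Rightarrow> 'q) \<Rightarrow> bool"
  assumes less: "q < p"
    and sat_cong: "\<And>i E E'. sat i E \<Longrightarrow> (\<And>n. i + q \<le> n \<Longrightarrow> n \<le> i + p \<Longrightarrow> E n = E' n) \<Longrightarrow> sat i E'"
    and top_ex: "\<And>i E. range E \<subseteq> C \<Longrightarrow> \<exists>v\<in>C. sat i (E(i + p := v))"
    and bot_ex: "\<And>i E. range E \<subseteq> C \<Longrightarrow> \<exists>v\<in>C. sat i (E(i + q := v))"
    and top_unique: "\<And>i E E'. range E \<subseteq> C \<Longrightarrow> range E' \<subseteq> C \<Longrightarrow> sat i E \<Longrightarrow> sat i E' \<Longrightarrow>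
      (\<And>n. i + q \<le> n \<Longrightarrow> n < i + p \<Longrightarrow> E n = E' n) \<Longrightarrow> E (i + p) = E' (i + p)"
    and bot_unique: "\<And>i E E'. range E \<subseteq> C \<Longrightarrow> range E' \<subseteq> C \<Longrightarrow> sat i E \<Longrightarrow> sat i E' \<Longrightarrow>
      (\<And>n. i + q < n \<Longrightarrow> n \<le> i + p \<Longrightarrow> E n = E' n) \<Longrightarrow> E (i + q) = E' (i + q)"
begin

text \<open>Relations are solved one by one at both ends of a growing interval. Entries are never
  changed once they are fixed, so the stages converge pointwise.\<close>

lemma solution_ex:
  fixes s :: int
  assumes E0: "range E0 \<subseteq> C"
  obtains E where "range E \<subseteq> C" "\<And>i. sat i E" "\<And>n. s \<le> n \<Longrightarrow> n < s + (p - q) \<Longrightarrow> E n = E0 n"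
proof -
  \<comment> \<open>At stage \<open>N\<close> the relations hold whose windows fit into the initial
    interval enlarged by \<open>N\<close> on both sides. None fits at stage 0, as a window has
    \<open>p - q + 1\<close> entries.\<close>
  define P where "P N E \<longleftrightarrow> range E \<subseteq> C \<and> (\<forall>n. s \<le> n \<and> n < s + (p - q) \<longrightarrow> E n = E0 n) \<and>
    (\<forall>i. s - int N \<le> i + q \<and> i + p < s + (p - q) + int N \<longrightarrow> sat i E)" for N E
  define Q where "Q N E E' \<longleftrightarrow> (\<forall>n. s - int N \<le> n \<and> n < s + (p - q) + int N \<longrightarrow> E' n = E n)"
    for N and E E' :: "int \<Rightarrow> 'q"
  have "\<exists>f. \<forall>N. P N (f N) \<and> Q N (f N) (f (Suc N))"
  proof (rule dependent_nat_choice)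
    have "\<not> (s - int 0 \<le> i + q \<and> i + p < s + (p - q) + int 0)" for i by linarith
    then have "P 0 E0" using E0 unfolding P_def by blast
    then show "\<exists>E. P 0 E" by (rule exI[of "P 0" E0])
  next
    fix E N assume E: "P N E"
    \<comment> \<open>The windows of \<open>?i\<close> and \<open>?j\<close> stick out of the
      interval of stage \<open>N\<close> by exactly one entry, at the top and at the bottom
      respectively.\<close>
    let ?i = "s - q + int N" and ?j = "s - q - int N - 1"
    have E': "range E \<subseteq> C" using E by (simp add: P_def)
    obtain v where v: "v \<in> C" "sat ?i (E(?i + p := v))"
      using top_ex[OF E'] by blast
    have E1: "range (E(?i + p := v)) \<subseteq> C" using E' v(1) by auto
    obtain u where u: "u \<in> C" "sat ?j ((E(?i + p := v))(?j + q := u))"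
      using bot_ex[OF E1] by blast
    let ?E = "(E(?i + p := v))(?j + q := u)"
    have "Q N E ?E" using less unfolding Q_def by auto
    moreover have "P (Suc N) ?E"
      unfolding P_def
    proof (intro conjI allI impI)
      show "range ?E \<subseteq> C" using E1 u by auto
      show "?E n = E0 n" if "s \<le> n \<and> n < s + (p - q)" for n
        using that E less unfolding P_def by auto
      fix i assume i: "s - int (Suc N) \<le> i + q \<and> i + p < s + (p - q) + int (Suc N)"
      consider "i = ?j" | "i = ?i" | "s - int N \<le> i + q \<and> i + p < s + (p - q) + int N"
        using i by linarith
      then show "sat i ?E"
      proof cases
        case 2
        show ?thesis unfolding 2 by (rule sat_cong[OF v(2)]) (use less in auto)
      next
        case 3
        then have "sat i E" using E unfolding P_def by blast
        then show ?thesis by (rule sat_cong) (use less 3 in auto)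
      qed (use u in simp)
    qed
    ultimately show "\<exists>E'. P (Suc N) E' \<and> Q N E E'" by blast
  qed
  then obtain f where P: "\<And>N. P N (f N)" and Q: "\<And>N. Q N (f N) (f (Suc N))" by blast
  have stable: "f M n = f N n" if "N \<le> M" "s - int N \<le> n" "n < s + (p - q) + int N" for M N n
    using that(1)
  proof (induction M rule: dec_induct)
    case (step M)
    then show ?case using Q[of M] that unfolding Q_def by auto
  qed simp
  \<comment> \<open>Entry \<open>n\<close> is final at stage \<bar>n - s\<bar>, because
    \<open>q < p\<close>.\<close>
  define F where "F n = f (nat \<bar>n - s\<bar>) n" for n
  have F: "F n = f N n" if "s - int N \<le> n" "n < s + (p - q) + int N" for N n
  proof (cases "N \<le> nat \<bar>n - s\<bar>")
    case True
    then show ?thesis unfolding F_def using that by (intro stable) auto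
  next
    case False
    then show ?thesis unfolding F_def using less by (intro stable[symmetric]) auto
  qed
  show thesis
  proof
    show "range F \<subseteq> C" using P unfolding F_def P_def by blast
    show "F n = E0 n" if "s \<le> n" "n < s + (p - q)" for n
      using F[of 0 n] P[of 0] that unfolding P_def by simp
    fix i
    let ?N = "nat (\<bar>i + q - s\<bar> + \<bar>i + p - s\<bar> + 1)"
    have "s - int ?N \<le> i + q \<and> i + p < s + (p - q) + int ?N" using less by linarith
    then have "sat i (f ?N)" using P[of ?N] unfolding P_def by blast
    then show "sat i F" by (rule sat_cong) (use F[of ?N] less in auto)
  qed
qed

text \<open>Upward induction by \<open>top_unique\<close>. The relations are assumed on a bounded
  interval only, because the step function compared in \<open>separates_if_covered\<close> is known
  to satisfy them just there.\<close>

lemma unique_up: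
  assumes C: "range E \<subseteq> C" "range E' \<subseteq> C"
    and sat: "\<And>i. s \<le> i + q \<Longrightarrow> i + p \<le> t \<Longrightarrow> sat i E \<and> sat i E'"
    and init: "\<And>n. s \<le> n \<Longrightarrow> n < s + (p - q) \<Longrightarrow> E n = E' n"
    and n: "s \<le> n" "n \<le> t"
  shows "E n = E' n"
  using n
proof (induction "nat (n - s)" arbitrary: n rule: less_induct)
  case less
  show ?case
  proof (cases "n < s + (p - q)")
    case True
    then show ?thesis using init less by simp
  next
    case False
    have "E ((n - p) + p) = E' ((n - p) + p)"
    proof (rule top_unique[OF C])
      show "sat (n - p) E" "sat (n - p) E'" using sat[of "n - p"] False less.prems by auto
      fix m assume "n - p + q \<le> m" "m < n - p + p"
      then show "E m = E' m" using False less.prems by (intro less.hyps) auto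
    qed
    then show ?thesis by simp
  qed
qed

lemma unique_down:
  assumes C: "range E \<subseteq> C" "range E' \<subseteq> C"
    and sat: "\<And>i. sat i E" "\<And>i. sat i E'"
    and init: "\<And>n. s \<le> n \<Longrightarrow> n < s + (p - q) \<Longrightarrow> E n = E' n"
    and n: "n < s + (p - q)"
  shows "E n = E' n"
  using n
proof (induction "nat (s - n)" arbitrary: n rule: less_induct)
  case less
  show ?case
  proof (cases "s \<le> n")
    case True
    then show ?thesis using init less by simp
  next
    case False
    have "E ((n - q) + q) = E' ((n - q) + q)"
    proof (rule bot_unique[OF C sat])
      fix m assume "n - q + q < m" "m \<le> n - q + p"
      then show "E m = E' m" using False less.prems by (intro less.hyps) auto
    qed
    then show ?thesis by simp
  qed
qed

lemma solution_unique:
  assumes "range E \<subseteq> C" "range E' \<subseteq> C" "\<And>i. sat i E" "\<And>i. sat i E'"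
    and "\<And>n. s \<le> n \<Longrightarrow> n < s + (p - q) \<Longrightarrow> E n = E' n"
  shows "E = E'"
proof
  fix n
  show "E n = E' n"
  proof (cases "s \<le> n")
    case True
    then show ?thesis using unique_up[of E E' s n n] assms by blast
  next
    case False
    then show ?thesis using unique_down[of E E' s n] assms less by simp
  qed
qed

text \<open>Pigeonhole: as \<open>C\<close> is finite, two windows of \<open>p - q\<close> entries
  coincide. Uniqueness in both directions makes \<open>E\<close> equal to its translate, so it is
  periodic everywhere and not just eventually.\<close>

lemma solution_periodic:
  assumes "finite C" and shift: "\<And>i E k. sat (i + k) E \<Longrightarrow> sat i (\<lambda>n. E (n + k))"
    and E: "range E \<subseteq> C" "\<And>i. sat i E"
  obtains M where "M > 0" "\<And>n. E (n + M) = E n"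
proof -
  define f where "f j = map (\<lambda>t. E (int j + int t)) [0..<nat (p - q)]" for j
  have "range f \<subseteq> {xs. set xs \<subseteq> C \<and> length xs = nat (p - q)}"
    unfolding f_def using E(1) by (force simp: image_subset_iff)
  then have "finite (range f)"
    using finite_lists_length_eq[OF \<open>finite C\<close>] finite_subset by blast
  then have "\<not> inj f" using finite_imageD infinite_UNIV_nat by blast
  then obtain i j where ij: "i < j" "f i = f j"
    by (metis injI linorder_neqE_nat)
  let ?M = "int j - int i"
  have "(\<lambda>n. E (n + ?M)) = E"
  proof (rule solution_unique[where s = "int i"])
    show "range (\<lambda>n. E (n + ?M)) \<subseteq> C" using E(1) by auto
    show "sat k (\<lambda>n. E (n + ?M))" for k using shift E(2) by blast
    fix n assume n: "int i \<le> n" "n < int i + (p - q)"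
    have "f i ! nat (n - int i) = f j ! nat (n - int i)" using ij by simp
    then show "E (n + ?M) = E n" using n by (simp add: f_def nat_less_iff algebra_simps)
  qed (use E in auto)
  then have "E (n + ?M) = E n" for n by (rule fun_cong)
  then show thesis using that[of ?M] ij by simp
qed

end


section \<open>Words along a weight function\<close>

definition total_weight :: "('a \<Rightarrow> int) \<Rightarrow> ('a \<times> int) list \<Rightarrow> int" where
  "total_weight \<theta> W = (\<Sum>(x, e)\<leftarrow>W. e * \<theta> x)"

lemma total_weight_simps [simp]:
  "total_weight \<theta> [] = 0" "total_weight \<theta> ((x, e) # W) = e * \<theta> x + total_weight \<theta> W"
  by (simp_all add: total_weight_def)

text \<open>
  A letter \<open>x\<close> is an edge from height \<open>n\<close> to height \<open>n + \<theta> x\<close>. The \<open>j\<close>-th letter (from 0) of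
  a word read from height 0 runs along the edge that starts at height \<open>edge_start \<theta> W j\<close>,
  backwards if its exponent is \<open>-1\<close>.
\<close>

definition edge_start :: "('a \<Rightarrow> int) \<Rightarrow> ('a \<times> int) list \<Rightarrow> nat \<Rightarrow> int" where
  "edge_start \<theta> W j = total_weight \<theta> (take j W) + (if snd (W ! j) = 1 then 0 else - \<theta> (fst (W ! j)))"

lemma edge_start_Cons [simp]:
  "edge_start \<theta> ((x, e) # W) 0 = (if e = 1 then 0 else - \<theta> x)"
  "edge_start \<theta> ((x, e) # W) (Suc j) = e * \<theta> x + edge_start \<theta> W j"
  by (simp_all add: edge_start_def)

lemma skeleton_simps [simp]:
  "skeleton [] = []" "skeleton ((x, e, h) # R) = (x, e) # skeleton R" "length (skeleton R) = length R"
  by (simp_all add: skeleton_def)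

text \<open>Extends \<open>rel_expr_value\<close> to arbitrary images of the coefficients and
  letters; see \<open>rel_expr_value_eq\<close>.\<close>

definition rel_word_value ::
  "('q, 'm) monoid_scheme \<Rightarrow> ('h \<Rightarrow> 'q) \<Rightarrow> ('a \<Rightarrow> 'q) \<Rightarrow> ('a \<times> int \<times> 'h) list \<Rightarrow> 'q" where
  "rel_word_value Q f a R =
     foldr (\<lambda>(x, e, h) g. (a x [^]\<^bsub>Q\<^esub> e) \<otimes>\<^bsub>Q\<^esub> (f h \<otimes>\<^bsub>Q\<^esub> g)) R \<one>\<^bsub>Q\<^esub>"

lemma rel_word_value_simps [simp]:
  "rel_word_value Q f a [] = \<one>\<^bsub>Q\<^esub>"
  "rel_word_value Q f a ((x, e, h) # R) = (a x [^]\<^bsub>Q\<^esub> e) \<otimes>\<^bsub>Q\<^esub> (f h \<otimes>\<^bsub>Q\<^esub> rel_word_value Q f a R)"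
  by (simp_all add: rel_word_value_def)

text \<open>\<open>R\<close> is read as a path from height \<open>i\<close>, with
  \<open>a x n\<close> as the label of the edge of kind \<open>x\<close> that starts at
  \<open>n\<close>. Exponent \<open>-1\<close> runs an edge backwards, hence the offset
  \<open>- \<theta> x\<close> to its start.\<close>

fun path_value ::
  "('q, 'm) monoid_scheme \<Rightarrow> ('a \<Rightarrow> int) \<Rightarrow> ('h \<Rightarrow> 'q) \<Rightarrow> ('a \<Rightarrow> int \<Rightarrow> 'q) \<Rightarrow> ('a \<times> int \<times> 'h) list \<Rightarrow> int \<Rightarrow> 'q" where
  "path_value Q \<theta> f a [] i = \<one>\<^bsub>Q\<^esub>"
| "path_value Q \<theta> f a ((x, e, h) # R) i =
     (a x (i + (if e = 1 then 0 else - \<theta> x)) [^]\<^bsub>Q\<^esub> e) \<otimes>\<^bsub>Q\<^esub>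
     (f h \<otimes>\<^bsub>Q\<^esub> path_value Q \<theta> f a R (i + e * \<theta> x))"

lemma path_value_cong:
  assumes "\<And>j. j < length R \<Longrightarrow>
    a (fst (skeleton R ! j)) (i + edge_start \<theta> (skeleton R) j) =
    a' (fst (skeleton R ! j)) (i + edge_start \<theta> (skeleton R) j)"
  shows "path_value Q \<theta> f a R i = path_value Q \<theta> f a' R i"
  using assms
proof (induction R arbitrary: i)
  case (Cons c R)
  obtain x e h where c: "c = (x, e, h)" by (cases c) auto
  have "path_value Q \<theta> f a R (i + e * \<theta> x) = path_value Q \<theta> f a' R (i + e * \<theta> x)"
    by (rule Cons.IH) (use Cons.prems[of "Suc _"] in \<open>simp add: c add.assoc\<close>)
  then show ?case using Cons.prems[of 0] by (simp add: c)
qed simp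

context group
begin

lemma path_value_closed:
  assumes "R \<in> lists (X \<times> {1, -1} \<times> B)" "\<And>h. h \<in> B \<Longrightarrow> f h \<in> carrier G" "\<And>x n. x \<in> X \<Longrightarrow> a x n \<in> carrier G"
  shows "path_value G \<theta> f a R i \<in> carrier G"
  using assms by (induction R arbitrary: i) auto

text \<open>\<open>A\<close> and \<open>B\<close> are the values of the path before and after letter
  \<open>j\<close>. They are chosen before \<open>a'\<close>, so all labellings that agree at the
  other positions share them, and the path value becomes a function of the label at position
  \<open>j\<close>.\<close>

lemma path_value_isolate:
  assumes "R \<in> lists (X \<times> {1, -1} \<times> B)" and f: "\<forall>h\<in>B. f h \<in> carrier G"
    and a: "\<forall>x\<in>X. \<forall>n. a x n \<in> carrier G" and "j < length R"
  shows "\<exists>A\<in>carrier G. \<exists>B\<in>carrier G. \<forall>a'. (\<forall>x\<in>X. \<forall>n. a' x n \<in> carrier G) \<longrightarrow>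
    (\<forall>k<length R. k \<noteq> j \<longrightarrow>
      a' (fst (skeleton R ! k)) (i + edge_start \<theta> (skeleton R) k) =
      a (fst (skeleton R ! k)) (i + edge_start \<theta> (skeleton R) k)) \<longrightarrow>
    path_value G \<theta> f a' R i =
      A \<otimes> (a' (fst (skeleton R ! j)) (i + edge_start \<theta> (skeleton R) j) [^] snd (skeleton R ! j)) \<otimes> B"
  using assms(1,4)
proof (induction R arbitrary: i j)
  case (Cons c R)
  obtain x e h where c: "c = (x, e, h)" by (cases c) auto
  have R: "R \<in> lists (X \<times> {1, -1} \<times> B)" "x \<in> X" "h \<in> B" "e \<in> {1, -1}"
    using Cons.hyps unfolding c by auto
  show ?case
  proof (cases j)
    case 0
    have cl: "path_value G \<theta> f a R (i + e * \<theta> x) \<in> carrier G"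
      using path_value_closed[where X = X and B = B] R f a by blast
    have "path_value G \<theta> f a' (c # R) i = \<one> \<otimes> (a' x (i + edge_start \<theta> (skeleton (c # R)) 0) [^] e) \<otimes>
        (f h \<otimes> path_value G \<theta> f a R (i + e * \<theta> x))"
      if a': "\<forall>x\<in>X. \<forall>n. a' x n \<in> carrier G"
        and eq: "\<forall>k<length (c # R). k \<noteq> j \<longrightarrow>
          a' (fst (skeleton (c # R) ! k)) (i + edge_start \<theta> (skeleton (c # R)) k) =
          a (fst (skeleton (c # R) ! k)) (i + edge_start \<theta> (skeleton (c # R)) k)" for a'
    proof -
      have "path_value G \<theta> f a' R (i + e * \<theta> x) = path_value G \<theta> f a R (i + e * \<theta> x)"
        by (rule path_value_cong) (use eq[rule_format, of "Suc _"] 0 in \<open>simp add: c add.assoc\<close>)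
      then show ?thesis using a' R f cl by (simp add: c)
    qed
    then show ?thesis
      using 0 f R cl
      by (intro bexI[of _ \<one>] bexI[of _ "f h \<otimes> path_value G \<theta> f a R (i + e * \<theta> x)"]) (auto simp: c)
  next
    case (Suc m)
    then have m: "m < length R" using Cons.prems by simp
    obtain A B' where AB: "A \<in> carrier G" "B' \<in> carrier G"
      and eq: "\<And>a'. (\<forall>x\<in>X. \<forall>n. a' x n \<in> carrier G) \<Longrightarrow>
        (\<forall>k<length R. k \<noteq> m \<longrightarrow>
          a' (fst (skeleton R ! k)) (i + e * \<theta> x + edge_start \<theta> (skeleton R) k) =
          a (fst (skeleton R ! k)) (i + e * \<theta> x + edge_start \<theta> (skeleton R) k)) \<Longrightarrow>
        path_value G \<theta> f a' R (i + e * \<theta> x) =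
          A \<otimes> (a' (fst (skeleton R ! m)) (i + e * \<theta> x + edge_start \<theta> (skeleton R) m) [^] snd (skeleton R ! m)) \<otimes> B'"
      using Cons.IH[OF m, of "i + e * \<theta> x"] by blast
    let ?x = "fst (skeleton R ! m)"
    have x: "?x \<in> X" using R(1) m by (force simp: skeleton_def in_set_conv_nth split: prod.splits)
    let ?A = "(a x (i + (if e = 1 then 0 else - \<theta> x)) [^] e) \<otimes> (f h \<otimes> A)"
    have "path_value G \<theta> f a' (c # R) i =
        ?A \<otimes> (a' ?x (i + edge_start \<theta> (skeleton (c # R)) j) [^] snd (skeleton R ! m)) \<otimes> B'"
      if a': "\<forall>x\<in>X. \<forall>n. a' x n \<in> carrier G"
        and eq': "\<forall>k<length (c # R). k \<noteq> j \<longrightarrow>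
          a' (fst (skeleton (c # R) ! k)) (i + edge_start \<theta> (skeleton (c # R)) k) =
          a (fst (skeleton (c # R) ! k)) (i + edge_start \<theta> (skeleton (c # R)) k)" for a'
    proof -
      have "path_value G \<theta> f a' R (i + e * \<theta> x) =
          A \<otimes> (a' ?x (i + e * \<theta> x + edge_start \<theta> (skeleton R) m) [^] snd (skeleton R ! m)) \<otimes> B'"
        using eq'[rule_format, of "Suc _"] Suc by (intro eq[OF a']) (simp add: c add.assoc)
      moreover have "a' x (i + (if e = 1 then 0 else - \<theta> x)) = a x (i + (if e = 1 then 0 else - \<theta> x))"
        using eq'[rule_format, of 0] Suc by (simp add: c)
      ultimately show ?thesis
        using a' x R f AB a Suc by (simp add: c m_assoc add.assoc)
    qed
    then show ?thesis
      using Suc AB R f a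
      by (intro bexI[of _ ?A] bexI[of _ B']) (auto simp: c)
  qed
qed simp

lemma sandwich_solvable:
  assumes "A \<in> carrier G" "B \<in> carrier G" "k \<in> carrier G" "e \<in> {1, -1 :: int}"
  shows "\<exists>v\<in>carrier G. A \<otimes> (v [^] e) \<otimes> B = k"
proof -
  \<comment> \<open>\<open>?v\<close> is the value required of \<open>v [^] e\<close>; as
    \<open>e * e = 1\<close>, its power with exponent \<open>e\<close> is the required
    \<open>v\<close>.\<close>
  let ?v = "inv A \<otimes> k \<otimes> inv B"
  have "A \<otimes> ?v \<otimes> B = k" using assms by (simp add: m_assoc flip: m_assoc[of A "inv A"])
  then show ?thesis
    using assms by (intro bexI[of _ "?v [^] e"]) (auto simp: int_pow_neg)
qed

lemma sandwich_unique:
  assumes "A \<in> carrier G" "B \<in> carrier G" "u \<in> carrier G" "v \<in> carrier G" "e \<in> {1, -1 :: int}"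
    and "A \<otimes> (u [^] e) \<otimes> B = A \<otimes> (v [^] e) \<otimes> B"
  shows "u = v"
proof -
  have "u [^] e = v [^] e" using assms by (simp add: m_assoc)
  then show ?thesis using assms inv_inj by (auto simp: int_pow_neg inj_on_eq_iff)
qed

end

lemma hom_path_value:
  assumes "group Q" "group Q'" "\<pi> \<in> hom Q Q'"
    and "R \<in> lists (X \<times> {1, -1} \<times> B)" "\<And>h. h \<in> B \<Longrightarrow> f h \<in> carrier Q" "\<And>x n. x \<in> X \<Longrightarrow> a x n \<in> carrier Q"
  shows "\<pi> (path_value Q \<theta> f a R i) = path_value Q' \<theta> (\<lambda>h. \<pi> (f h)) (\<lambda>x n. \<pi> (a x n)) R i"
  using assms(4)
proof (induction R arbitrary: i)
  case (Cons c R)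
  interpret group_hom Q Q' \<pi> using assms by (intro group_homI)
  have "path_value Q \<theta> f a R i \<in> carrier Q" for i
    using Cons G.path_value_closed[where X = X and B = B] assms(5,6) by blast
  then show ?case using Cons assms(5,6) by (cases c) (auto simp: hom_int_pow int_pow_closed)
qed (use assms in \<open>auto intro: hom_one\<close>)


section \<open>The unrestricted wreath product with the integers\<close>

text \<open>The semidirect product of all functions on the integers with the shifts. In
  \<open>(c, s)\<close>, \<open>c i\<close> is meant as the value of a path started at height
  \<open>i\<close> and \<open>s\<close> as its rise; so the second factor of a product is read from
  \<open>i + s\<close>.\<close>

definition wreath :: "('q, 'm) monoid_scheme \<Rightarrow> ((int \<Rightarrow> 'q) \<times> int) monoid" where
  "wreath Q = \<lparr>carrier = {(c, s). \<forall>i. c i \<in> carrier Q},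
     monoid.mult = (\<lambda>(c, s) (d, t). (\<lambda>i. c i \<otimes>\<^bsub>Q\<^esub> d (i + s), s + t)),
     one = (\<lambda>_. \<one>\<^bsub>Q\<^esub>, 0)\<rparr>"

lemma wreath_simps [simp]:
  "(c, s) \<in> carrier (wreath Q) \<longleftrightarrow> (\<forall>i. c i \<in> carrier Q)"
  "(c, s) \<otimes>\<^bsub>wreath Q\<^esub> (d, t) = (\<lambda>i. c i \<otimes>\<^bsub>Q\<^esub> d (i + s), s + t)"
  "\<one>\<^bsub>wreath Q\<^esub> = (\<lambda>_. \<one>\<^bsub>Q\<^esub>, 0)"
  by (simp_all add: wreath_def)

context group
begin

lemma group_wreath: "group (wreath G)"
proof (rule groupI)
  fix x assume "x \<in> carrier (wreath G)"
  then show "\<exists>y\<in>carrier (wreath G). y \<otimes>\<^bsub>wreath G\<^esub> x = \<one>\<^bsub>wreath G\<^esub>"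
    by (intro bexI[of _ "(\<lambda>i. inv (fst x (i - snd x)), - snd x)"]) (cases x; auto)+
qed (auto simp: m_assoc add.assoc)

lemma inv_wreath:
  assumes "\<And>i. c i \<in> carrier G"
  shows "inv\<^bsub>wreath G\<^esub> (c, s) = (\<lambda>i. inv (c (i - s)), - s)"
  by (rule group.inv_equality[OF group_wreath]) (use assms in auto)

text \<open>One element of the wreath product collects the values of the relator from all starting
  heights. The shift in \<open>inv_wreath\<close> yields the offset of an edge run
  backwards.\<close>

lemma rel_word_value_wreath:
  assumes "R \<in> lists (X \<times> {1, -1} \<times> B)" "\<And>h. h \<in> B \<Longrightarrow> f h \<in> carrier G" "\<And>x n. x \<in> X \<Longrightarrow> a x n \<in> carrier G"
  shows "rel_word_value (wreath G) (\<lambda>h. (\<lambda>_. f h, 0)) (\<lambda>x. (a x, \<theta> x)) R =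
    (path_value G \<theta> f a R, total_weight \<theta> (skeleton R))"
  using assms(1)
proof (induction R)
  case Nil
  then show ?case by (simp add: fun_eq_iff)
next
  case (Cons c R)
  obtain x e h where c: "c = (x, e, h)" by (cases c) auto
  interpret W: group "wreath G" by (rule group_wreath)
  have R: "R \<in> lists (X \<times> {1, -1} \<times> B)" "x \<in> X" "h \<in> B" "e = 1 \<or> e = -1" using Cons c by auto
  have x: "(a x, \<theta> x) \<in> carrier (wreath G)" using R assms by simp
  have "(a x, \<theta> x) [^]\<^bsub>wreath G\<^esub> e = (\<lambda>i. a x (i + (if e = 1 then 0 else - \<theta> x)) [^] e, e * \<theta> x)"
    using R(4) assms(3)[OF R(2)] x by (auto simp: int_pow_neg W.int_pow_neg inv_wreath)
  then show ?case using Cons R by (simp add: c)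
qed

end

section \<open>Highest and lowest edges of a balanced word\<close>

lemma total_weight_uminus: "total_weight (\<lambda>x. - \<theta> x) W = - total_weight \<theta> W"
  by (induction W) auto

text \<open>Reflecting the heights exchanges maximum and minimum, so results on the top of a path
  transfer to its bottom.\<close>

lemma edge_start_uminus: "edge_start (\<lambda>x. - \<theta> x) W j = - edge_start \<theta> W j"
  by (simp add: edge_start_def total_weight_uminus)

lemma total_weight_take_Suc:
  "m < length W \<Longrightarrow> total_weight \<theta> (take (Suc m) W) = total_weight \<theta> (take m W) + snd (W ! m) * \<theta> (fst (W ! m))"
  by (simp add: total_weight_def take_Suc_conv_app_nth case_prod_beta)

lemma height_eq_total_weight:
  "j \<le> length W \<Longrightarrow> height \<theta> W j = total_weight \<theta> (take j W)"
proof (induction j)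
  case (Suc j)
  then have "height \<theta> W (Suc j) = height \<theta> W j + snd (W ! j) * \<theta> (fst (W ! j))"
    by (simp add: height_def letter_at_def exponent_at_def)
  then show ?case using Suc by (simp add: total_weight_take_Suc)
qed (simp add: height_def)

text \<open>
  Only the letters \<open>k - 1\<close> and \<open>k mod length W\<close> (from 0) touch the highest point of the path, and
  they are different; so either of them is the highest edge of its kind, and occurs only once.
\<close>

lemma edge_start_less_top:
  assumes W: "W \<in> lists (UNIV \<times> {1, -1})" "total_weight \<theta> W = 0"
    and k: "k \<in> {1..length W}" "\<And>j. j \<in> {1..length W} - {k} \<Longrightarrow> height \<theta> W j < height \<theta> W k"
    and ne: "fst (W ! (k - 1)) \<noteq> fst (W ! (k mod length W))"
    and j: "j = k - 1 \<or> j = k mod length W" and m: "m < length W" "m \<noteq> j" "fst (W ! m) = fst (W ! j)"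
  shows "edge_start \<theta> W m < edge_start \<theta> W j"
proof -
  let ?h = "\<lambda>j. total_weight \<theta> (take j W)" and ?r = "length W"
  let ?t = "\<theta> (fst (W ! j))"
  have h0: "?h 0 = ?h ?r" using W by simp
  \<comment> \<open>Position \<open>k mod ?r\<close> follows position \<open>k - 1\<close>
    cyclically. For \<open>k = ?r\<close> it is position 0, at the same height because the path
    closes up.\<close>
  have hmod: "?h (k mod ?r) = ?h k" using k(1) h0 by (cases "k = ?r") auto
  have less: "?h i < ?h k" if "i \<in> {1..?r}" "i \<noteq> k" for i
    using k(2)[of i] that k(1) by (simp add: height_eq_total_weight)
  have less_mod: "?h i < ?h k" if "i < ?r" "i \<noteq> k mod ?r" for i
  proof (cases "i = 0")
    case True
    have "k \<noteq> ?r" using that True by auto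
    then have "?h ?r < ?h k" using k(1) by (intro less) auto
    then show ?thesis using h0 True by simp
  next
    case False
    then show ?thesis using that k(1) by (intro less) (auto simp: mod_if split: if_splits)
  qed
  \<comment> \<open>The two letters at the maximum differ, so \<open>m\<close>, which carries the
    letter of \<open>j\<close>, is neither of them; both its ends lie strictly below the
    top.\<close>
  have "m \<noteq> k - 1" "m \<noteq> k mod ?r" using j m ne by auto
  then have hm: "?h m < ?h k" "?h (Suc m) < ?h k"
    using less_mod[of m] less[of "Suc m"] m by auto
  have jr: "j < ?r" using j k(1) by (auto intro!: mod_less_divisor)
  have hj: "?h j \<le> ?h k" "?h (Suc j) \<le> ?h k" "?h j = ?h k \<or> ?h (Suc j) = ?h k"
  proof -
    show "?h j \<le> ?h k" using less_mod[of j] hmod jr by (cases "j = k mod ?r") auto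
    show "?h (Suc j) \<le> ?h k" using less[of "Suc j"] jr by (cases "Suc j = k") auto
    show "?h j = ?h k \<or> ?h (Suc j) = ?h k" using j hmod k(1) by auto
  qed
  have e: "snd (W ! i) = 1 \<or> snd (W ! i) = -1" if "i < ?r" for i
    using W(1) nth_mem[OF that] by (cases "W ! i") auto
  \<comment> \<open>The left side is the upper end of the edge, for either sign of the weight. Equal
    letters have equal weights, so comparing starts amounts to comparing upper ends.\<close>
  have top: "edge_start \<theta> W i + max 0 (\<theta> (fst (W ! i))) = max (?h i) (?h (Suc i))" if "i < ?r" for i
    using e[OF that] total_weight_take_Suc[OF that, of \<theta>] by (auto simp: edge_start_def)
  show ?thesis using top[OF m(1)] top[OF jr] hm hj m(3) by auto
qed

text \<open>Positions \<open>jt\<close> and \<open>jb\<close> count from 0. By strictness, each of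
  these two edges is met only once by the path. Their kinds differ, so both ends of a single
  sequence can be tied to them, and \<open>D\<close> says how long a delay keeps the two kinds
  apart.\<close>

locale peaks =
  fixes \<theta> :: "'a \<Rightarrow> int" and W :: "('a \<times> int) list" and jt jb :: nat and D :: int
  assumes distinct: "fst (W ! jt) \<noteq> fst (W ! jb)" and jt: "jt < length W" and jb: "jb < length W"
    and top: "\<And>j. j < length W \<Longrightarrow> j \<noteq> jt \<Longrightarrow> fst (W ! j) = fst (W ! jt) \<Longrightarrow> edge_start \<theta> W j < edge_start \<theta> W jt"
    and bottom: "\<And>j. j < length W \<Longrightarrow> j \<noteq> jb \<Longrightarrow> fst (W ! j) = fst (W ! jb) \<Longrightarrow> edge_start \<theta> W jb < edge_start \<theta> W j"
    and bound: "\<And>j. j < length W \<Longrightarrow> \<bar>edge_start \<theta> W j\<bar> \<le> D"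
    and balanced: "total_weight \<theta> W = 0"

lemma unique_max_min_peaks:
  assumes "unique_max_min Xs W" and W: "W \<in> lists (UNIV \<times> {1, -1})"
  obtains \<theta> jt jb D where "peaks \<theta> W jt jb D"
proof -
  obtain \<theta> k l where adm: "admissible \<theta> W" and k: "k \<in> {1..length W}" and l: "l \<in> {1..length W}"
    and kmax: "\<And>j. j \<in> {1..length W} - {k} \<Longrightarrow> height \<theta> W j < height \<theta> W k"
    and lmin: "\<And>j. j \<in> {1..length W} - {l} \<Longrightarrow> height \<theta> W j > height \<theta> W l"
    and ne: "letter_at W k \<noteq> letter_at W (k + 1)" "letter_at W l \<noteq> letter_at W (l + 1)"
    using assms(1) unfolding unique_max_min_def by blast
  have bal: "total_weight \<theta> W = 0"
    using adm by (simp add: admissible_def height_eq_total_weight)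
  have idx: "letter_at W i = fst (W ! (i - 1))" "letter_at W (i + 1) = fst (W ! (i mod length W))"
    if "i \<in> {1..length W}" for i
    using that by (auto simp: letter_at_def)
  \<comment> \<open>The two letters that meet at the maximum differ, so one of them also differs
    from the letter at \<open>jb\<close>, which touches the minimum; \<open>jt\<close> is that
    one.\<close>
  define jb where "jb = l - 1"
  define jt where "jt = (if fst (W ! (k - 1)) = fst (W ! jb) then k mod length W else k - 1)"
  define D where "D = Max ((\<lambda>j. \<bar>edge_start \<theta> W j\<bar>) ` {..<length W})"
  have "peaks \<theta> W jt jb D"
  proof
    show "fst (W ! jt) \<noteq> fst (W ! jb)" using ne(1) idx[OF k] by (auto simp: jt_def)
    show "jt < length W" "jb < length W" using k l by (auto simp: jt_def jb_def intro!: mod_less_divisor)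
    show "edge_start \<theta> W j < edge_start \<theta> W jt"
      if "j < length W" "j \<noteq> jt" "fst (W ! j) = fst (W ! jt)" for j
      using that ne(1) idx[OF k] by (intro edge_start_less_top[OF W bal k kmax]) (auto simp: jt_def)
    \<comment> \<open>The minimum is the maximum for the negated weight.\<close>
    have "edge_start (\<lambda>x. - \<theta> x) W j < edge_start (\<lambda>x. - \<theta> x) W jb"
      if "j < length W" "j \<noteq> jb" "fst (W ! j) = fst (W ! jb)" for j
      using that ne(2) idx[OF l] bal lmin
      by (intro edge_start_less_top[OF W _ l]) (auto simp: jb_def height_def sum_negf total_weight_uminus)
    then show "edge_start \<theta> W jb < edge_start \<theta> W j"
      if "j < length W" "j \<noteq> jb" "fst (W ! j) = fst (W ! jb)" for j
      using that by (simp add: edge_start_uminus)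
    show "\<bar>edge_start \<theta> W j\<bar> \<le> D" if "j < length W" for j
      unfolding D_def using that by (intro Max_ge) auto
    show "total_weight \<theta> W = 0" by fact
  qed
  then show thesis by (rule that)
qed

text \<open>
  One sequence \<open>E\<close> provides the values of the edges of both kinds \<open>a\<close> and \<open>b\<close>; the delay \<open>c\<close>
  keeps the two ranges of indices that one relator sees apart.
\<close>

definition linked_edges :: "'a \<Rightarrow> 'a \<Rightarrow> int \<Rightarrow> ('a \<Rightarrow> 'q) \<Rightarrow> (int \<Rightarrow> 'q) \<Rightarrow> 'a \<Rightarrow> int \<Rightarrow> 'q" where
  "linked_edges a b c \<xi> E x n = (if x = a then E n else if x = b then E (n - c) else \<xi> x)"

lemma path_value_shift:
  "path_value Q \<theta> f (\<lambda>x n. a x (n + k)) R i = path_value Q \<theta> f a R (i + k)"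
proof (induction R arbitrary: i)
  case (Cons c R)
  then show ?case by (cases c) (simp add: ac_simps)
qed simp

lemma path_value_const: "path_value Q \<theta> f (\<lambda>x _. \<xi> x) R i = rel_word_value Q f \<xi> R"
proof (induction R arbitrary: i)
  case (Cons c R)
  then show ?case by (cases c) simp
qed simp

section \<open>The relations as a recursion on one sequence\<close>

context peaks
begin

definition edges :: "int \<Rightarrow> ('a \<Rightarrow> 'q) \<Rightarrow> (int \<Rightarrow> 'q) \<Rightarrow> 'a \<Rightarrow> int \<Rightarrow> 'q" where
  "edges = linked_edges (fst (W ! jt)) (fst (W ! jb))"

lemma edges_closed:
  "range E \<subseteq> C \<Longrightarrow> (\<And>x. x \<in> X \<Longrightarrow> \<xi> x \<in> C) \<Longrightarrow> x \<in> X \<Longrightarrow> edges c \<xi> E x n \<in> C"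
  by (auto simp: edges_def linked_edges_def)

lemma edges_hom: "\<pi> (edges c \<xi> E x n) = edges c (\<lambda>x. \<pi> (\<xi> x)) (\<lambda>n. \<pi> (E n)) x n"
  by (simp add: edges_def linked_edges_def)

lemma edges_shift: "edges c \<xi> (\<lambda>n. E (n + k)) x n = edges c \<xi> E x (n + k)"
  by (simp add: edges_def linked_edges_def algebra_simps)

lemma edges_simps:
  "edges c \<xi> E (fst (W ! jt)) n = E n" "edges c \<xi> E (fst (W ! jb)) n = E (n - c)"
  using distinct by (simp_all add: edges_def linked_edges_def)

lemma edges_cong:
  assumes "fst (W ! j) = fst (W ! jt) \<Longrightarrow> E (i + edge_start \<theta> W j) = E' (i + edge_start \<theta> W j)"
    and "fst (W ! j) = fst (W ! jb) \<Longrightarrow> E (i + edge_start \<theta> W j - c) = E' (i + edge_start \<theta> W j - c)"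
  shows "edges c \<xi> E (fst (W ! j)) (i + edge_start \<theta> W j) = edges c \<xi> E' (fst (W ! j)) (i + edge_start \<theta> W j)"
  using assms by (auto simp: edges_def linked_edges_def)

text \<open>Relative to \<open>i\<close>, the relation at \<open>i\<close> sees indices from
  \<open>- D\<close> to \<open>D\<close> for the first kind and from \<open>- D - c\<close> to
  \<open>D - c\<close> for the second; \<open>2 * D < c\<close> keeps them apart. So edge
  \<open>jt\<close> has the largest index and edge \<open>jb\<close> the smallest, each is met once,
  and the relation is a sandwich equation in either of them.\<close>

lemma recursion:
  fixes R :: "('a \<times> int \<times> 'h) list"
  assumes Q: "group Q" and R: "R \<in> lists (X \<times> {1, -1} \<times> B)" "skeleton R = W"
    and f: "\<And>h. h \<in> B \<Longrightarrow> f h \<in> carrier Q" and \<xi>: "\<And>x. x \<in> X \<Longrightarrow> \<xi> x \<in> carrier Q"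
    and v: "v \<in> carrier Q" and c: "2 * D < c"
  shows "two_sided_recursion (carrier Q) (edge_start \<theta> W jt) (edge_start \<theta> W jb - c)
    (\<lambda>i E. path_value Q \<theta> f (edges c \<xi> E) R i = v)"
proof -
  interpret Q: group Q by fact
  let ?n = "edge_start \<theta> W" and ?p = "edge_start \<theta> W jt" and ?q = "edge_start \<theta> W jb - c"
  let ?V = "\<lambda>E i. path_value Q \<theta> f (edges c \<xi> E) R i"
  have len: "length R = length W" using R(2) skeleton_simps(3) by metis
  have "-D \<le> ?n j \<and> ?n j \<le> D" if "j < length W" for j using bound[OF that] by linarith
  note bd = this
  have letter: "snd (W ! j) \<in> {1, -1}" "fst (W ! j) \<in> X" if "j < length W" for j
  proof -
    have "R ! j \<in> X \<times> {1, -1} \<times> B"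
      using bspec[OF in_listsD[OF R(1)] nth_mem[of j R]] that len by simp
    moreover obtain x e h where c: "R ! j = (x, e, h)" by (cases "R ! j") auto
    moreover have "skeleton R ! j = (x, e)" using c that len by (simp add: skeleton_def)
    then have "W ! j = (x, e)" unfolding R(2) .
    ultimately show "snd (W ! j) \<in> {1, -1}" "fst (W ! j) \<in> X" by simp_all
  qed
  have cl: "\<And>x n. x \<in> X \<Longrightarrow> edges c \<xi> E x n \<in> carrier Q" if "range E \<subseteq> carrier Q" for E
    using edges_closed[OF that, of X \<xi>] \<xi> by blast
  \<comment> \<open>\<open>path_value_isolate\<close> for labellings that come from sequences.
    \<open>E'\<close> is quantified inside, so one pair of outer factors serves both solutions in
    the uniqueness proofs.\<close>
  have isolate: "\<exists>A\<in>carrier Q. \<exists>B\<in>carrier Q. \<forall>E'. range E' \<subseteq> carrier Q \<longrightarrow>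
      (\<forall>k<length W. k \<noteq> j \<longrightarrow> edges c \<xi> E' (fst (W ! k)) (i + ?n k) = edges c \<xi> E (fst (W ! k)) (i + ?n k)) \<longrightarrow>
      ?V E' i = A \<otimes>\<^bsub>Q\<^esub> (edges c \<xi> E' (fst (W ! j)) (i + ?n j) [^]\<^bsub>Q\<^esub> snd (W ! j)) \<otimes>\<^bsub>Q\<^esub> B"
    if E: "range E \<subseteq> carrier Q" and j: "j < length W" for E i j
  proof -
    have jR: "j < length R" using j len by simp
    have f': "\<forall>h\<in>B. f h \<in> carrier Q" and a: "\<forall>x\<in>X. \<forall>n. edges c \<xi> E x n \<in> carrier Q"
      using f cl[OF E] by blast+
    note ex = Q.path_value_isolate[where a = "edges c \<xi> E" and j = j and \<theta> = \<theta> and i = i and f = f,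
        OF R(1) f' a jR, unfolded R(2) len]
    from ex obtain A where A: "A \<in> carrier Q" and exB: "\<exists>B\<in>carrier Q. \<forall>a'.
      (\<forall>x\<in>X. \<forall>n. a' x n \<in> carrier Q) \<longrightarrow>
      (\<forall>k<length W. k \<noteq> j \<longrightarrow> a' (fst (W ! k)) (i + ?n k) = edges c \<xi> E (fst (W ! k)) (i + ?n k)) \<longrightarrow>
      path_value Q \<theta> f a' R i = A \<otimes>\<^bsub>Q\<^esub> (a' (fst (W ! j)) (i + ?n j) [^]\<^bsub>Q\<^esub> snd (W ! j)) \<otimes>\<^bsub>Q\<^esub> B"
      by (rule bexE)
    from exB obtain B' where B': "B' \<in> carrier Q" and eq: "\<forall>a'.
      (\<forall>x\<in>X. \<forall>n. a' x n \<in> carrier Q) \<longrightarrow>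
      (\<forall>k<length W. k \<noteq> j \<longrightarrow> a' (fst (W ! k)) (i + ?n k) = edges c \<xi> E (fst (W ! k)) (i + ?n k)) \<longrightarrow>
      path_value Q \<theta> f a' R i = A \<otimes>\<^bsub>Q\<^esub> (a' (fst (W ! j)) (i + ?n j) [^]\<^bsub>Q\<^esub> snd (W ! j)) \<otimes>\<^bsub>Q\<^esub> B'"
      by (rule bexE)
    show ?thesis
    proof (rule bexI[OF _ A], rule bexI[OF _ B'], intro allI impI)
      fix E' :: "int \<Rightarrow> _"
      assume E': "range E' \<subseteq> carrier Q"
        and agree: "\<forall>k<length W. k \<noteq> j \<longrightarrow>
          edges c \<xi> E' (fst (W ! k)) (i + ?n k) = edges c \<xi> E (fst (W ! k)) (i + ?n k)"
      have "\<forall>x\<in>X. \<forall>n. edges c \<xi> E' x n \<in> carrier Q" using cl[OF E'] by blast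
      then show "?V E' i = A \<otimes>\<^bsub>Q\<^esub> (edges c \<xi> E' (fst (W ! j)) (i + ?n j) [^]\<^bsub>Q\<^esub> snd (W ! j)) \<otimes>\<^bsub>Q\<^esub> B'"
        using eq[THEN spec[of _ "edges c \<xi> E'"], THEN mp, THEN mp] agree by blast
    qed
  qed
  show ?thesis
  proof
    show "?q < ?p" using bd[OF jt] bd[OF jb] c by linarith
  next
    fix i and E E' :: "int \<Rightarrow> _"
    assume V: "?V E i = v" and eq: "\<And>n. i + ?q \<le> n \<Longrightarrow> n \<le> i + ?p \<Longrightarrow> E n = E' n"
    have "?V E i = ?V E' i"
    proof (rule path_value_cong, unfold R(2) len)
      fix j assume j: "j < length W"
      show "edges c \<xi> E (fst (W ! j)) (i + ?n j) = edges c \<xi> E' (fst (W ! j)) (i + ?n j)"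
        using bd[OF j] bd[OF jt] bd[OF jb] c top[OF j] bottom[OF j]
        by (intro edges_cong eq; cases "j = jt"; cases "j = jb"; force)
    qed
    then show "?V E' i = v" using V by simp
  next
    fix i and E :: "int \<Rightarrow> _" assume E: "range E \<subseteq> carrier Q"
    obtain A B where AB: "A \<in> carrier Q" "B \<in> carrier Q"
      and eq: "\<And>E'. range E' \<subseteq> carrier Q \<Longrightarrow>
      (\<forall>k<length W. k \<noteq> jt \<longrightarrow> edges c \<xi> E' (fst (W ! k)) (i + ?n k) = edges c \<xi> E (fst (W ! k)) (i + ?n k)) \<Longrightarrow>
      ?V E' i = A \<otimes>\<^bsub>Q\<^esub> (E' (i + ?p) [^]\<^bsub>Q\<^esub> snd (W ! jt)) \<otimes>\<^bsub>Q\<^esub> B"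
      using isolate[OF E jt, of i] unfolding edges_simps by blast
    obtain u where u: "u \<in> carrier Q" "A \<otimes>\<^bsub>Q\<^esub> (u [^]\<^bsub>Q\<^esub> snd (W ! jt)) \<otimes>\<^bsub>Q\<^esub> B = v"
      using Q.sandwich_solvable[OF AB v letter(1)[OF jt]] by blast
    have "?V (E(i + ?p := u)) i = A \<otimes>\<^bsub>Q\<^esub> ((E(i + ?p := u)) (i + ?p) [^]\<^bsub>Q\<^esub> snd (W ! jt)) \<otimes>\<^bsub>Q\<^esub> B"
    proof (rule eq)
      show "range (E(i + ?p := u)) \<subseteq> carrier Q" using E u(1) by auto
      \<comment> \<open>The update reaches no other position: edges of the same kind start lower by
        \<open>top\<close>, and the delayed edges have indices below \<open>i - D\<close>.\<close>
      show "\<forall>k<length W. k \<noteq> jt \<longrightarrow> edges c \<xi> (E(i + ?p := u)) (fst (W ! k)) (i + ?n k) =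
        edges c \<xi> E (fst (W ! k)) (i + ?n k)"
        using top bd bd[OF jt] c by (intro allI impI edges_cong) force+
    qed
    then show "\<exists>u\<in>carrier Q. ?V (E(i + ?p := u)) i = v" using u by auto
  next
    fix i and E :: "int \<Rightarrow> _" assume E: "range E \<subseteq> carrier Q"
    obtain A B where AB: "A \<in> carrier Q" "B \<in> carrier Q"
      and eq: "\<And>E'. range E' \<subseteq> carrier Q \<Longrightarrow>
      (\<forall>k<length W. k \<noteq> jb \<longrightarrow> edges c \<xi> E' (fst (W ! k)) (i + ?n k) = edges c \<xi> E (fst (W ! k)) (i + ?n k)) \<Longrightarrow>
      ?V E' i = A \<otimes>\<^bsub>Q\<^esub> (E' (i + ?n jb - c) [^]\<^bsub>Q\<^esub> snd (W ! jb)) \<otimes>\<^bsub>Q\<^esub> B"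
      using isolate[OF E jb, of i] unfolding edges_simps by blast
    obtain u where u: "u \<in> carrier Q" "A \<otimes>\<^bsub>Q\<^esub> (u [^]\<^bsub>Q\<^esub> snd (W ! jb)) \<otimes>\<^bsub>Q\<^esub> B = v"
      using Q.sandwich_solvable[OF AB v letter(1)[OF jb]] by blast
    have "?V (E(i + ?q := u)) i = A \<otimes>\<^bsub>Q\<^esub> ((E(i + ?q := u)) (i + ?n jb - c) [^]\<^bsub>Q\<^esub> snd (W ! jb)) \<otimes>\<^bsub>Q\<^esub> B"
    proof (rule eq)
      show "range (E(i + ?q := u)) \<subseteq> carrier Q" using E u(1) by auto
      \<comment> \<open>Here edges of the same kind start higher by \<open>bottom\<close>, and the
        undelayed edges have indices at least \<open>i - D\<close>, which exceeds
        \<open>i + ?q\<close>.\<close>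
      show "\<forall>k<length W. k \<noteq> jb \<longrightarrow> edges c \<xi> (E(i + ?q := u)) (fst (W ! k)) (i + ?n k) =
        edges c \<xi> E (fst (W ! k)) (i + ?n k)"
        using bottom bd bd[OF jb] c by (intro allI impI edges_cong) force+
    qed
    then show "\<exists>u\<in>carrier Q. ?V (E(i + ?q := u)) i = v" using u by (auto simp: algebra_simps)
  next
    fix i and E E' :: "int \<Rightarrow> _"
    assume E: "range E \<subseteq> carrier Q" "range E' \<subseteq> carrier Q" and V: "?V E i = v" "?V E' i = v"
      and eqE: "\<And>n. i + ?q \<le> n \<Longrightarrow> n < i + ?p \<Longrightarrow> E n = E' n"
    have Ecl: "E n \<in> carrier Q" "E' n \<in> carrier Q" for n using E by blast+
    obtain A B where AB: "A \<in> carrier Q" "B \<in> carrier Q"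
      and eq: "\<And>E'. range E' \<subseteq> carrier Q \<Longrightarrow>
      (\<forall>k<length W. k \<noteq> jt \<longrightarrow> edges c \<xi> E' (fst (W ! k)) (i + ?n k) = edges c \<xi> E (fst (W ! k)) (i + ?n k)) \<Longrightarrow>
      ?V E' i = A \<otimes>\<^bsub>Q\<^esub> (E' (i + ?p) [^]\<^bsub>Q\<^esub> snd (W ! jt)) \<otimes>\<^bsub>Q\<^esub> B"
      using isolate[OF E(1) jt, of i] unfolding edges_simps by blast
    have "?V E' i = A \<otimes>\<^bsub>Q\<^esub> (E' (i + ?p) [^]\<^bsub>Q\<^esub> snd (W ! jt)) \<otimes>\<^bsub>Q\<^esub> B"
    proof (rule eq[OF E(2)], intro allI impI)
      fix j assume j: "j < length W" "j \<noteq> jt"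
      show "edges c \<xi> E' (fst (W ! j)) (i + ?n j) = edges c \<xi> E (fst (W ! j)) (i + ?n j)"
        using bd[OF j(1)] bd[OF jt] bd[OF jb] c top[OF j] bottom[OF j(1)]
        by (intro edges_cong eqE[symmetric]; cases "j = jb"; force)
    qed
    then have "A \<otimes>\<^bsub>Q\<^esub> (E (i + ?p) [^]\<^bsub>Q\<^esub> snd (W ! jt)) \<otimes>\<^bsub>Q\<^esub> B =
        A \<otimes>\<^bsub>Q\<^esub> (E' (i + ?p) [^]\<^bsub>Q\<^esub> snd (W ! jt)) \<otimes>\<^bsub>Q\<^esub> B"
      using eq[OF E(1)] V by simp
    then show "E (i + ?p) = E' (i + ?p)"
      by (rule Q.sandwich_unique[OF AB Ecl letter(1)[OF jt]])
  next
    fix i and E E' :: "int \<Rightarrow> _"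
    assume E: "range E \<subseteq> carrier Q" "range E' \<subseteq> carrier Q" and V: "?V E i = v" "?V E' i = v"
      and eqE: "\<And>n. i + ?q < n \<Longrightarrow> n \<le> i + ?p \<Longrightarrow> E n = E' n"
    have Ecl: "E n \<in> carrier Q" "E' n \<in> carrier Q" for n using E by blast+
    obtain A B where AB: "A \<in> carrier Q" "B \<in> carrier Q"
      and eq: "\<And>E'. range E' \<subseteq> carrier Q \<Longrightarrow>
      (\<forall>k<length W. k \<noteq> jb \<longrightarrow> edges c \<xi> E' (fst (W ! k)) (i + ?n k) = edges c \<xi> E (fst (W ! k)) (i + ?n k)) \<Longrightarrow>
      ?V E' i = A \<otimes>\<^bsub>Q\<^esub> (E' (i + ?n jb - c) [^]\<^bsub>Q\<^esub> snd (W ! jb)) \<otimes>\<^bsub>Q\<^esub> B"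
      using isolate[OF E(1) jb, of i] unfolding edges_simps by blast
    have "?V E' i = A \<otimes>\<^bsub>Q\<^esub> (E' (i + ?n jb - c) [^]\<^bsub>Q\<^esub> snd (W ! jb)) \<otimes>\<^bsub>Q\<^esub> B"
    proof (rule eq[OF E(2)], intro allI impI)
      fix j assume j: "j < length W" "j \<noteq> jb"
      show "edges c \<xi> E' (fst (W ! j)) (i + ?n j) = edges c \<xi> E (fst (W ! j)) (i + ?n j)"
        using bd[OF j(1)] bd[OF jt] bd[OF jb] c top[OF j(1)] bottom[OF j]
        by (intro edges_cong eqE[symmetric]; cases "j = jt"; force)
    qed
    then have "A \<otimes>\<^bsub>Q\<^esub> (E (i + ?n jb - c) [^]\<^bsub>Q\<^esub> snd (W ! jb)) \<otimes>\<^bsub>Q\<^esub> B =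
        A \<otimes>\<^bsub>Q\<^esub> (E' (i + ?n jb - c) [^]\<^bsub>Q\<^esub> snd (W ! jb)) \<otimes>\<^bsub>Q\<^esub> B"
      using eq[OF E(1)] V by simp
    then have "E (i + ?n jb - c) = E' (i + ?n jb - c)"
      by (rule Q.sandwich_unique[OF AB Ecl letter(1)[OF jb]])
    then show "E (i + ?q) = E' (i + ?q)" by (simp add: algebra_simps)
  qed
qed

text \<open>The relations have the same form at all heights, which is the invariance that
  \<open>solution_periodic\<close> asks for.\<close>

lemma path_value_edges_shift:
  "path_value Q \<theta> f (edges c \<xi> (\<lambda>n. E (n + k))) R i = path_value Q \<theta> f (edges c \<xi> E) R (i + k)"
  using path_value_shift[of Q \<theta> f "edges c \<xi> E" k R i] by (simp add: edges_shift[abs_def])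

end

section \<open>Universal properties of the presented groups\<close>

lemma (in group) normal_closure_normal:
  assumes "A \<subseteq> carrier G"
  shows "normal_closure G A \<lhd> G"
proof -
  let ?F = "{N. N \<lhd> G \<and> A \<subseteq> N}"
  have ne: "carrier G \<in> ?F" using assms by (simp add: normal_inv_iff subgroup_self)
  have "subgroup (\<Inter>?F) G"
    by (rule subgroups_Inter) (use ne normal_imp_subgroup in blast)+
  moreover have "x \<otimes> h \<otimes> inv x \<in> \<Inter>?F" if "x \<in> carrier G" "h \<in> \<Inter>?F" for x h
    using that by (auto simp: normal.inv_op_closed2)
  ultimately show ?thesis by (simp add: normal_closure_def normal_inv_iff)
qed

lemma normal_closure_incl: "A \<subseteq> normal_closure G A"
  by (auto simp: normal_closure_def)

lemma (in group_hom) Mod_normal_closure_universal: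
  assumes "r \<in> carrier G" "h r = \<one>\<^bsub>H\<^esub>"
  obtains h' where "h' \<in> hom (G Mod normal_closure G {r}) H"
    "\<And>g. g \<in> carrier G \<Longrightarrow> h' (normal_closure G {r} #> g) = h g"
proof -
  have "normal_closure G {r} \<subseteq> kernel G H h"
    using normal_kernel assms by (auto simp: normal_closure_def kernel_def)
  moreover have "normal_closure G {r} \<lhd> G" using assms by (intro G.normal_closure_normal) auto
  ultimately show thesis using FactGroup_universal_kernel that by metis
qed

lemma (in group) Mod_normal_closure:
  assumes "r \<in> carrier G"
  shows "group (G Mod normal_closure G {r})"
    and "(\<lambda>g. normal_closure G {r} #> g) \<in> hom G (G Mod normal_closure G {r})"
    and "normal_closure G {r} #> r = \<one>\<^bsub>G Mod normal_closure G {r}\<^esub>"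
    and "carrier (G Mod normal_closure G {r}) = (\<lambda>g. normal_closure G {r} #> g) ` carrier G"
proof -
  interpret N: normal "normal_closure G {r}" G
    using assms by (intro normal_closure_normal) auto
  show "group (G Mod normal_closure G {r})" by (rule N.factorgroup_is_group)
  show "(\<lambda>g. normal_closure G {r} #> g) \<in> hom G (G Mod normal_closure G {r})"
    by (rule N.r_coset_hom_Mod)
  have "r \<in> normal_closure G {r}" using normal_closure_incl[of "{r}" G] by simp
  then show "normal_closure G {r} #> r = \<one>\<^bsub>G Mod normal_closure G {r}\<^esub>"
    using N.rcos_const[OF is_group] by (simp add: FactGroup_def)
  show "carrier (G Mod normal_closure G {r}) = (\<lambda>g. normal_closure G {r} #> g) ` carrier G"
    by (simp add: FactGroup_def RCOSETS_def UNION_singleton_eq_range)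
qed

section \<open>Mapping properties and generators of free groups and free products\<close>

lemma free_gen_closed: "x \<in> X \<Longrightarrow> free_gen X x \<in> carrier (free_group X)"
  unfolding free_gen_def free_group_def by (intro presented_monoid_gen_closed) auto

lemma free_gen_inv:
  assumes "x \<in> X"
  shows "word_cong (X \<times> {1, -1}) (free_group_rels X) `` {[(x, -1)]} = inv\<^bsub>free_group X\<^esub> (free_gen X x)"
proof -
  interpret group "free_group X" by (rule group_free_group)
  let ?C = "word_cong (X \<times> {1, -1}) (free_group_rels X)"
  have cl: "?C `` {[(x, -1)]} \<in> carrier (free_group X)"
    unfolding free_group_def using assms by (intro presented_monoid_gen_closed) auto
  have "([(x, -1)] @ [(x, 1)], []) \<in> ?C"
    using assms by (intro word_cong.base) (force simp: free_group_rels_def)+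
  then have "?C `` {[(x, -1)] @ [(x, 1)]} = ?C `` {[]}"
    by (rule equiv_class_eq[OF equiv_word_cong])
  moreover have "?C `` {[(x, -1)]} \<otimes>\<^bsub>free_group X\<^esub> free_gen X x = ?C `` {[(x, -1)] @ [(x, 1)]}"
    unfolding free_group_def free_gen_def using assms by (intro presented_monoid_mult) auto
  ultimately have "?C `` {[(x, -1)]} \<otimes>\<^bsub>free_group X\<^esub> free_gen X x = \<one>\<^bsub>free_group X\<^esub>"
    by (simp add: free_group_def presented_monoid_def)
  then show ?thesis using inv_equality cl free_gen_closed[OF assms] by simp
qed

lemma (in group) free_group_universal:
  assumes f: "\<And>x. x \<in> X \<Longrightarrow> f x \<in> carrier G"
  obtains h where "h \<in> hom (free_group X) G" "\<And>x. x \<in> X \<Longrightarrow> h (free_gen X x) = f x"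
proof -
  let ?m = "\<lambda>(x, e :: int). f x [^] e"
  have E: "letter_prod G ?m u = letter_prod G ?m v" if "(u, v) \<in> free_group_rels X" for u v
    using that f by (auto simp: free_group_rels_def int_pow_neg)
  have m: "?m c \<in> carrier G" if "c \<in> X \<times> {1, -1}" for c using that f by auto
  obtain h where h: "h \<in> hom (free_group X) G"
    "\<And>u. u \<in> lists (X \<times> {1, -1}) \<Longrightarrow>
      h (word_cong (X \<times> {1, -1}) (free_group_rels X) `` {u}) = letter_prod G ?m u"
    using presented_monoid_universal[of "X \<times> {1, -1}" "\<lambda>(x, e :: int). f x [^] e" "free_group_rels X"] m E
    unfolding free_group_def by metis
  have "h (free_gen X x) = f x" if "x \<in> X" for x
    unfolding free_gen_def using h(2)[of "[(x, 1)]"] that f by simp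
  with h(1) show thesis by (rule that)
qed

lemma free_group_generated:
  assumes S: "subgroup S (free_group X)" "\<And>x. x \<in> X \<Longrightarrow> free_gen X x \<in> S"
  shows "carrier (free_group X) \<subseteq> S"
proof
  interpret group "free_group X" by (rule group_free_group)
  interpret S: subgroup S "free_group X" by fact
  fix P assume "P \<in> carrier (free_group X)"
  then show "P \<in> S"
    unfolding free_group_def
  proof (induction rule: presented_monoid_induct)
    case one
    show ?case using S.one_closed by (simp add: free_group_def)
  next
    case (step c P)
    then obtain x e where c: "c = (x, e)" "x \<in> X" "e = 1 \<or> e = -1" by auto
    then have "word_cong (X \<times> {1, -1}) (free_group_rels X) `` {[c]} \<in> S"
      using S(2) free_gen_inv[of x X] by (auto simp: free_gen_def)
    then show ?case using S.m_closed[OF _ step(3)] by (simp add: free_group_def)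
  qed
qed

lemma free_product_inl_hom: "free_product_inl G H \<in> hom G (free_product G H)"
  if "group G" for G H
proof (rule homI)
  let ?A = "Inl ` carrier G \<union> Inr ` carrier H"
  interpret group G by fact
  fix a b assume a: "a \<in> carrier G"
  then show "free_product_inl G H a \<in> carrier (free_product G H)"
    unfolding free_product_inl_def free_product_def by (intro presented_monoid_gen_closed) auto
  assume b: "b \<in> carrier G"
  have "([Inl a] @ [Inl b], [Inl (a \<otimes>\<^bsub>G\<^esub> b)]) \<in> word_cong ?A (free_product_rels G H)"
    using a b by (intro word_cong.base) (auto simp: free_product_rels_def)
  from equiv_class_eq[OF equiv_word_cong this]
  show "free_product_inl G H (a \<otimes>\<^bsub>G\<^esub> b) =
      free_product_inl G H a \<otimes>\<^bsub>free_product G H\<^esub> free_product_inl G H b"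
    unfolding free_product_inl_def free_product_def using a b by (subst presented_monoid_mult) auto
qed

lemma free_product_inr_hom: "free_product_inr G H \<in> hom H (free_product G H)"
  if "group H" for G H
proof (rule homI)
  let ?A = "Inl ` carrier G \<union> Inr ` carrier H"
  interpret group H by fact
  fix a b assume a: "a \<in> carrier H"
  then show "free_product_inr G H a \<in> carrier (free_product G H)"
    unfolding free_product_inr_def free_product_def by (intro presented_monoid_gen_closed) auto
  assume b: "b \<in> carrier H"
  have "([Inr a] @ [Inr b], [Inr (a \<otimes>\<^bsub>H\<^esub> b)]) \<in> word_cong ?A (free_product_rels G H)"
    using a b by (intro word_cong.base) (auto simp: free_product_rels_def)
  from equiv_class_eq[OF equiv_word_cong this]
  show "free_product_inr G H (a \<otimes>\<^bsub>H\<^esub> b) =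
      free_product_inr G H a \<otimes>\<^bsub>free_product G H\<^esub> free_product_inr G H b"
    unfolding free_product_inr_def free_product_def using a b by (subst presented_monoid_mult) auto
qed

lemma free_product_universal:
  assumes "group A" "group B" "group Q" and f: "f \<in> hom A Q" and g: "g \<in> hom B Q"
  obtains h where "h \<in> hom (free_product A B) Q"
    "\<And>a. a \<in> carrier A \<Longrightarrow> h (free_product_inl A B a) = f a"
    "\<And>b. b \<in> carrier B \<Longrightarrow> h (free_product_inr A B b) = g b"
proof -
  interpret f: group_hom A Q f using assms by (intro group_homI)
  interpret g: group_hom B Q g using assms by (intro group_homI)
  let ?A = "Inl ` carrier A \<union> Inr ` carrier B"
  have E: "letter_prod Q (case_sum f g) u = letter_prod Q (case_sum f g) v"
    if "(u, v) \<in> free_product_rels A B" for u v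
    using that by (auto simp: free_product_rels_def f.H.m_assoc)
  have m: "case_sum f g c \<in> carrier Q" if "c \<in> ?A" for c using that by auto
  obtain h where h: "h \<in> hom (free_product A B) Q"
    "\<And>u. u \<in> lists ?A \<Longrightarrow>
      h (word_cong ?A (free_product_rels A B) `` {u}) = letter_prod Q (case_sum f g) u"
    using f.H.presented_monoid_universal[of ?A "case_sum f g" "free_product_rels A B"] m E
    unfolding free_product_def by metis
  have "h (free_product_inl A B a) = f a" if "a \<in> carrier A" for a
    unfolding free_product_inl_def using h(2)[of "[Inl a]"] that by simp
  moreover have "h (free_product_inr A B b) = g b" if "b \<in> carrier B" for b
    unfolding free_product_inr_def using h(2)[of "[Inr b]"] that by simp
  ultimately show thesis using that h(1) by blast
qed

lemma free_product_generated:
  assumes "group A" "group B" and S: "subgroup S (free_product A B)"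
    "\<And>a. a \<in> carrier A \<Longrightarrow> free_product_inl A B a \<in> S" "\<And>b. b \<in> carrier B \<Longrightarrow> free_product_inr A B b \<in> S"
  shows "carrier (free_product A B) \<subseteq> S"
proof
  interpret S: subgroup S "free_product A B" by fact
  fix P assume "P \<in> carrier (free_product A B)"
  then show "P \<in> S"
    unfolding free_product_def
  proof (induction rule: presented_monoid_induct)
    case one
    show ?case using S.one_closed by (simp add: free_product_def)
  next
    case (step c P)
    then have "word_cong (Inl ` carrier A \<union> Inr ` carrier B) (free_product_rels A B) `` {[c]} \<in> S"
      using S(2,3) by (auto simp: free_product_inl_def free_product_inr_def)
    then show ?case using S.m_closed[OF _ step(3)] by (simp add: free_product_def)
  qed
qed

lemma (in group_hom) subgroup_preimage:
  assumes "subgroup S H"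
  shows "subgroup {g \<in> carrier G. h g \<in> S} G"
proof -
  interpret S: subgroup S H by fact
  show ?thesis by unfold_locales auto
qed

lemma (in group_hom) hom_word_value:
  assumes "w \<in> signed_words A" "\<And>a. a \<in> A \<Longrightarrow> f a \<in> carrier G"
  shows "word_value G f w \<in> carrier G" "h (word_value G f w) = word_value H (\<lambda>a. h (f a)) w"
proof -
  have "word_value G f w \<in> carrier G \<and> h (word_value G f w) = word_value H (\<lambda>a. h (f a)) w"
    using assms(1) unfolding signed_words_def
  proof (induction w)
    case (Cons c w)
    then obtain x e where c: "c = (x, e)" "x \<in> A" by auto
    then show ?case using Cons.IH assms(2)[OF c(2)] by (simp add: hom_int_pow)
  qed simp
  then show "word_value G f w \<in> carrier G" "h (word_value G f w) = word_value H (\<lambda>a. h (f a)) w"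
    by blast+
qed

lemma word_value_cong:
  assumes "w \<in> signed_words A" "\<And>a. a \<in> A \<Longrightarrow> f a = g a"
  shows "word_value G f w = word_value G g w"
  using assms(1) unfolding signed_words_def
proof (induction w)
  case (Cons c w)
  then show ?case using assms(2) by (cases c) auto
qed simp

lemma (in group_hom) hom_rel_word_value:
  assumes "R \<in> lists (X \<times> {1, -1} \<times> B)" "\<And>b. b \<in> B \<Longrightarrow> f b \<in> carrier G" "\<And>x. x \<in> X \<Longrightarrow> a x \<in> carrier G"
  shows "rel_word_value G f a R \<in> carrier G"
    "h (rel_word_value G f a R) = rel_word_value H (\<lambda>b. h (f b)) (\<lambda>x. h (a x)) R"
proof -
  have "rel_word_value G f a R \<in> carrier G \<and>
    h (rel_word_value G f a R) = rel_word_value H (\<lambda>b. h (f b)) (\<lambda>x. h (a x)) R"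
    using assms(1)
  proof (induction R)
    case (Cons c R)
    then obtain x e b where c: "c = (x, e, b)" "x \<in> X" "b \<in> B" by (cases c) auto
    then show ?case using Cons.IH assms(2)[OF c(3)] assms(3)[OF c(2)] by (simp add: hom_int_pow)
  qed simp
  then show "rel_word_value G f a R \<in> carrier G"
    "h (rel_word_value G f a R) = rel_word_value H (\<lambda>b. h (f b)) (\<lambda>x. h (a x)) R" by blast+
qed

lemma rel_word_value_cong:
  assumes "R \<in> lists (X \<times> {1, -1} \<times> B)" "\<And>b. b \<in> B \<Longrightarrow> f b = f' b" "\<And>x. x \<in> X \<Longrightarrow> a x = a' x"
  shows "rel_word_value G f a R = rel_word_value G f' a' R"
  using assms(1)
proof (induction R)
  case (Cons c R)
  then show ?case using assms(2,3) by (cases c) auto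
qed simp

section \<open>Mapping property and generators of \<open>rel_free\<close>\<close>

lemma rel_expr_value_eq: "rel_expr_value H X R = rel_word_value (rel_free H X) (rel_coeff H X) (rel_gen H X) R"
  by (simp add: rel_expr_value_def rel_word_value_def)

context
  fixes H :: "('h, 'm) monoid_scheme" and X :: "'a set"
  assumes H: "group H"
begin

lemma group_rel_free: "group (rel_free H X)"
  unfolding rel_free_def by (rule group_free_product[OF H group_free_group])

lemma rel_coeff_hom: "rel_coeff H X \<in> hom H (rel_free H X)"
  unfolding rel_coeff_def rel_free_def by (rule free_product_inl_hom[OF H])

lemma rel_gen_closed: "x \<in> X \<Longrightarrow> rel_gen H X x \<in> carrier (rel_free H X)"
  unfolding rel_gen_def rel_free_def
  using hom_in_carrier[OF free_product_inr_hom[OF group_free_group] free_gen_closed] .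

lemma rel_free_universal:
  assumes "group Q" "f \<in> hom H Q" "\<And>x. x \<in> X \<Longrightarrow> a x \<in> carrier Q"
  obtains h where "h \<in> hom (rel_free H X) Q"
    "\<And>b. b \<in> carrier H \<Longrightarrow> h (rel_coeff H X b) = f b" "\<And>x. x \<in> X \<Longrightarrow> h (rel_gen H X x) = a x"
proof -
  obtain g where g: "g \<in> hom (free_group X) Q" "\<And>x. x \<in> X \<Longrightarrow> g (free_gen X x) = a x"
    using group.free_group_universal[of Q X a] assms by blast
  obtain h where h: "h \<in> hom (rel_free H X) Q"
    "\<And>b. b \<in> carrier H \<Longrightarrow> h (rel_coeff H X b) = f b"
    "\<And>b. b \<in> carrier (free_group X) \<Longrightarrow> h (free_product_inr H (free_group X) b) = g b"
    unfolding rel_free_def rel_coeff_def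
    by (rule free_product_universal[OF H group_free_group assms(1,2) g(1)]) blast
  have "h (rel_gen H X x) = a x" if "x \<in> X" for x
    unfolding rel_gen_def using h(3) g(2) free_gen_closed that by metis
  with h show thesis using that by blast
qed

lemma rel_free_generated:
  assumes S: "subgroup S (rel_free H X)" "\<And>b. b \<in> carrier H \<Longrightarrow> rel_coeff H X b \<in> S"
    "\<And>x. x \<in> X \<Longrightarrow> rel_gen H X x \<in> S"
  shows "carrier (rel_free H X) \<subseteq> S"
  unfolding rel_free_def
proof (rule free_product_generated[OF H group_free_group])
  interpret group_hom "free_group X" "rel_free H X" "free_product_inr H (free_group X)"
    unfolding rel_free_def
    by (intro group_homI free_product_inr_hom group_free_group group_free_product H)
  show "subgroup S (free_product H (free_group X))" using S(1) by (simp add: rel_free_def)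
  show "free_product_inl H (free_group X) b \<in> S" if "b \<in> carrier H" for b
    using S(2)[OF that] by (simp add: rel_coeff_def)
  have "carrier (free_group X) \<subseteq> {g \<in> carrier (free_group X). free_product_inr H (free_group X) g \<in> S}"
    using S(3) free_gen_closed
    by (intro free_group_generated subgroup_preimage S(1)) (auto simp: rel_gen_def)
  then show "free_product_inr H (free_group X) g \<in> S" if "g \<in> carrier (free_group X)" for g
    using that by blast
qed

end


section \<open>Substituting a relative word for a letter\<close>

locale substitution =
  fixes H :: "('h, 'm) monoid_scheme" and Xs Ys :: "'a set" and z :: 'a
    and S :: "('a \<times> int) list" and R :: "('a \<times> int \<times> 'h) list"
  assumes H: "group H" and R: "R \<in> lists (Xs \<times> {1, -1} \<times> carrier H)"
    and z: "z \<notin> Ys" and disjoint: "Xs \<inter> (Ys \<union> {z}) = {}"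
    and S: "S \<in> signed_words (Ys \<union> {z})"
begin

abbreviation "F \<equiv> rel_free H (Xs \<union> Ys)"
abbreviation "rel \<equiv> substituted_relator H Xs Ys z S R"
abbreviation "G \<equiv> rel_presented_group H (Xs \<union> Ys) rel"
abbreviation "K \<equiv> one_relator_group (Ys \<union> {z}) S"

text \<open>\<open>coeff\<close>, \<open>gen\<close> and \<open>kgen\<close> are the canonical
  images of coefficients and letters in \<open>G\<close> and \<open>K\<close>. Once the mapping
  properties and generation lemmas below are proved, arguments use these images instead of cosets
  and words.\<close>

definition coeff :: "'h \<Rightarrow> ('h + ('a \<times> int) list set) list set set" where
  "coeff b = normal_closure F {rel} #>\<^bsub>F\<^esub> rel_coeff H (Xs \<union> Ys) b"

definition gen :: "'a \<Rightarrow> ('h + ('a \<times> int) list set) list set set" where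
  "gen x = normal_closure F {rel} #>\<^bsub>F\<^esub> rel_gen H (Xs \<union> Ys) x"

definition kgen :: "'a \<Rightarrow> ('a \<times> int) list set set" where
  "kgen y = normal_closure (free_group (Ys \<union> {z}))
     {word_value (free_group (Ys \<union> {z})) (free_gen (Ys \<union> {z})) S} #>\<^bsub>free_group (Ys \<union> {z})\<^esub> free_gen (Ys \<union> {z}) y"

lemma hom_rel_expr_value:
  assumes "group Q" "h \<in> hom F Q"
  shows "rel_expr_value H (Xs \<union> Ys) R \<in> carrier F"
    "h (rel_expr_value H (Xs \<union> Ys) R) =
      rel_word_value Q (\<lambda>b. h (rel_coeff H (Xs \<union> Ys) b)) (\<lambda>x. h (rel_gen H (Xs \<union> Ys) x)) R"
proof -
  interpret group_hom F Q h using assms by (intro group_homI group_rel_free[OF H])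
  note * = hom_rel_word_value[where f = "rel_coeff H (Xs \<union> Ys)" and a = "rel_gen H (Xs \<union> Ys)", OF R
      hom_in_carrier[OF rel_coeff_hom[OF H]] rel_gen_closed[OF H UnI1]]
  show "rel_expr_value H (Xs \<union> Ys) R \<in> carrier F"
    "h (rel_expr_value H (Xs \<union> Ys) R) =
      rel_word_value Q (\<lambda>b. h (rel_coeff H (Xs \<union> Ys) b)) (\<lambda>x. h (rel_gen H (Xs \<union> Ys) x)) R"
    unfolding rel_expr_value_eq by (rule *, assumption+)+
qed

lemma hom_relator:
  assumes "group Q" "h \<in> hom F Q"
  shows "rel \<in> carrier F"
    "h rel = word_value Q ((\<lambda>y. h (rel_gen H (Xs \<union> Ys) y))(z := h (rel_expr_value H (Xs \<union> Ys) R))) S"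
proof -
  interpret group_hom F Q h using assms by (intro group_homI group_rel_free[OF H])
  have closed: "((rel_gen H (Xs \<union> Ys))(z := rel_expr_value H (Xs \<union> Ys) R)) a \<in> carrier F"
    if "a \<in> Ys \<union> {z}" for a
    using that hom_rel_expr_value(1)[OF assms] rel_gen_closed[OF H, of a "Xs \<union> Ys"] by auto
  show "rel \<in> carrier F"
    unfolding substituted_relator_def by (rule hom_word_value(1)[OF S]) (rule closed)
  show "h rel = word_value Q ((\<lambda>y. h (rel_gen H (Xs \<union> Ys) y))(z := h (rel_expr_value H (Xs \<union> Ys) R))) S"
    unfolding substituted_relator_def
    by (subst hom_word_value(2)[OF S closed]) (auto intro!: arg_cong[where f = "\<lambda>f. word_value Q f S"])
qed

lemma relator_closed: "rel \<in> carrier F"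
  by (rule hom_relator(1)[of F id, OF group_rel_free[OF H]]) (simp add: hom_def)

lemma group_G: "group G"
  unfolding rel_presented_group_def
  by (rule group.Mod_normal_closure(1)[OF group_rel_free[OF H] relator_closed])

lemma quotient_hom: "(\<lambda>g. normal_closure F {rel} #>\<^bsub>F\<^esub> g) \<in> hom F G"
  unfolding rel_presented_group_def
  by (rule group.Mod_normal_closure(2)[OF group_rel_free[OF H] relator_closed])

lemma coeff_hom: "coeff \<in> hom H G"
  using hom_compose[OF rel_coeff_hom[OF H] quotient_hom] by (simp add: coeff_def[abs_def] o_def)

lemma gen_closed: "x \<in> Xs \<union> Ys \<Longrightarrow> gen x \<in> carrier G"
  unfolding gen_def by (rule hom_in_carrier[OF quotient_hom rel_gen_closed[OF H]])

lemma G_generated: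
  assumes T: "subgroup T G" "\<And>b. b \<in> carrier H \<Longrightarrow> coeff b \<in> T" "\<And>x. x \<in> Xs \<union> Ys \<Longrightarrow> gen x \<in> T"
  shows "carrier G \<subseteq> T"
proof -
  interpret group_hom F G "\<lambda>g. normal_closure F {rel} #>\<^bsub>F\<^esub> g"
    by (intro group_homI group_rel_free[OF H] group_G quotient_hom)
  let ?T = "{g \<in> carrier F. normal_closure F {rel} #>\<^bsub>F\<^esub> g \<in> T}"
  have "carrier F \<subseteq> ?T"
  proof (rule rel_free_generated[OF H])
    show "subgroup ?T F" by (rule subgroup_preimage[OF T(1)])
    show "rel_coeff H (Xs \<union> Ys) b \<in> ?T" if "b \<in> carrier H" for b
      using T(2)[OF that] hom_in_carrier[OF rel_coeff_hom[OF H] that] by (simp add: coeff_def)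
    show "rel_gen H (Xs \<union> Ys) x \<in> ?T" if "x \<in> Xs \<union> Ys" for x
      using T(3)[OF that] rel_gen_closed[OF H that] by (simp add: gen_def)
  qed
  moreover have "carrier G = (\<lambda>g. normal_closure F {rel} #>\<^bsub>F\<^esub> g) ` carrier F"
    unfolding rel_presented_group_def
    by (rule group.Mod_normal_closure(4)[OF group_rel_free[OF H] relator_closed])
  ultimately show ?thesis by auto
qed

lemma K_relator_closed: "word_value (free_group (Ys \<union> {z})) (free_gen (Ys \<union> {z})) S \<in> carrier (free_group (Ys \<union> {z}))"
proof -
  interpret group_hom "free_group (Ys \<union> {z})" "free_group (Ys \<union> {z})" id
    by (intro group_homI group_free_group) (simp add: hom_def)
  show ?thesis by (rule hom_word_value(1)[OF S]) (rule free_gen_closed)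
qed

lemma group_K: "group K"
  unfolding one_relator_group_def by (rule group.Mod_normal_closure(1)[OF group_free_group K_relator_closed])

lemma K_quotient_hom: "(\<lambda>g. normal_closure (free_group (Ys \<union> {z}))
     {word_value (free_group (Ys \<union> {z})) (free_gen (Ys \<union> {z})) S} #>\<^bsub>free_group (Ys \<union> {z})\<^esub> g)
  \<in> hom (free_group (Ys \<union> {z})) K"
  unfolding one_relator_group_def by (rule group.Mod_normal_closure(2)[OF group_free_group K_relator_closed])

lemma kgen_closed: "y \<in> Ys \<union> {z} \<Longrightarrow> kgen y \<in> carrier K"
  unfolding kgen_def by (rule hom_in_carrier[OF K_quotient_hom free_gen_closed])

lemma kgen_relation: "word_value K kgen S = \<one>\<^bsub>K\<^esub>"
proof -
  interpret group_hom "free_group (Ys \<union> {z})" K "\<lambda>g. normal_closure (free_group (Ys \<union> {z}))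
     {word_value (free_group (Ys \<union> {z})) (free_gen (Ys \<union> {z})) S} #>\<^bsub>free_group (Ys \<union> {z})\<^esub> g"
    by (intro group_homI group_free_group group_K K_quotient_hom)
  have "word_value K kgen S = word_value K (\<lambda>y. normal_closure (free_group (Ys \<union> {z}))
     {word_value (free_group (Ys \<union> {z})) (free_gen (Ys \<union> {z})) S} #>\<^bsub>free_group (Ys \<union> {z})\<^esub> free_gen (Ys \<union> {z}) y) S"
    by (simp add: kgen_def[abs_def])
  also have "\<dots> = \<one>\<^bsub>K\<^esub>"
    using hom_word_value(2)[where f = "free_gen (Ys \<union> {z})", OF S free_gen_closed]
      group.Mod_normal_closure(3)[OF group_free_group K_relator_closed]
    by (simp add: one_relator_group_def)
  finally show ?thesis .
qed

lemma K_universal: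
  assumes Q: "group Q" and a: "\<And>y. y \<in> Ys \<union> {z} \<Longrightarrow> a y \<in> carrier Q" and rel: "word_value Q a S = \<one>\<^bsub>Q\<^esub>"
  obtains k where "k \<in> hom K Q" "\<And>y. y \<in> Ys \<union> {z} \<Longrightarrow> k (kgen y) = a y"
proof -
  obtain h where h: "h \<in> hom (free_group (Ys \<union> {z})) Q" "\<And>y. y \<in> Ys \<union> {z} \<Longrightarrow> h (free_gen (Ys \<union> {z}) y) = a y"
    using group.free_group_universal[OF Q, of "Ys \<union> {z}" a] a by blast
  interpret group_hom "free_group (Ys \<union> {z})" Q h by (intro group_homI group_free_group Q h)
  let ?r = "word_value (free_group (Ys \<union> {z})) (free_gen (Ys \<union> {z})) S"
  have "h ?r = \<one>\<^bsub>Q\<^esub>"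
    using hom_word_value(2)[where f = "free_gen (Ys \<union> {z})", OF S free_gen_closed]
      word_value_cong[where f = "\<lambda>y. h (free_gen (Ys \<union> {z}) y)" and g = a and G = Q, OF S h(2)] rel
    by simp
  then obtain k where k: "k \<in> hom K Q" "\<And>g. g \<in> carrier (free_group (Ys \<union> {z})) \<Longrightarrow>
      k (normal_closure (free_group (Ys \<union> {z})) {?r} #>\<^bsub>free_group (Ys \<union> {z})\<^esub> g) = h g"
    unfolding one_relator_group_def using Mod_normal_closure_universal[OF K_relator_closed] by blast
  show thesis
  proof (rule that[OF k(1)])
    fix y assume y: "y \<in> Ys \<union> {z}"
    show "k (kgen y) = a y"
      unfolding kgen_def k(2)[OF free_gen_closed[OF y]] by (rule h(2)[OF y])
  qed
qed

lemma K_generated: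
  assumes T: "subgroup T K" "\<And>y. y \<in> Ys \<union> {z} \<Longrightarrow> kgen y \<in> T"
  shows "carrier K \<subseteq> T"
proof -
  let ?q = "\<lambda>g. normal_closure (free_group (Ys \<union> {z}))
     {word_value (free_group (Ys \<union> {z})) (free_gen (Ys \<union> {z})) S} #>\<^bsub>free_group (Ys \<union> {z})\<^esub> g"
  interpret group_hom "free_group (Ys \<union> {z})" K ?q
    by (intro group_homI group_free_group group_K K_quotient_hom)
  have "carrier (free_group (Ys \<union> {z})) \<subseteq> {g \<in> carrier (free_group (Ys \<union> {z})). ?q g \<in> T}"
    using T(2) free_gen_closed[of _ "Ys \<union> {z}"]
    by (intro free_group_generated subgroup_preimage T(1)) (auto simp: kgen_def)
  moreover have "carrier K = ?q ` carrier (free_group (Ys \<union> {z}))"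
    unfolding one_relator_group_def
    by (rule group.Mod_normal_closure(4)[OF group_free_group K_relator_closed])
  ultimately show ?thesis by auto
qed

text \<open>The relator of \<open>G\<close> is \<open>S\<close> with \<open>R\<close> for
  \<open>z\<close>, so sending \<open>z\<close> to the value of \<open>R\<close> respects the
  relator of \<open>K\<close>.\<close>

lemma K_to_G:
  obtains \<kappa> where "\<kappa> \<in> hom K G" "\<And>y. y \<in> Ys \<Longrightarrow> \<kappa> (kgen y) = gen y"
    "\<kappa> (kgen z) = rel_word_value G coeff gen R"
proof -
  let ?a = "gen(z := rel_word_value G coeff gen R)"
  have r: "normal_closure F {rel} #>\<^bsub>F\<^esub> rel_expr_value H (Xs \<union> Ys) R = rel_word_value G coeff gen R"
    using hom_rel_expr_value(2)[OF group_G quotient_hom] by (simp add: coeff_def[abs_def] gen_def[abs_def])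
  have cl: "rel_word_value G coeff gen R \<in> carrier G"
    using hom_in_carrier[OF quotient_hom hom_rel_expr_value(1)[OF group_G quotient_hom]] unfolding r .
  have "normal_closure F {rel} #>\<^bsub>F\<^esub> rel = word_value G ?a S"
    using hom_relator(2)[OF group_G quotient_hom] unfolding r by (simp add: gen_def[abs_def])
  then have "word_value G ?a S = \<one>\<^bsub>G\<^esub>"
    using group.Mod_normal_closure(3)[OF group_rel_free[OF H] relator_closed]
    by (simp add: rel_presented_group_def)
  moreover have "?a y \<in> carrier G" if "y \<in> Ys \<union> {z}" for y
    using that cl gen_closed by auto
  ultimately obtain \<kappa> where \<kappa>: "\<kappa> \<in> hom K G" "\<And>y. y \<in> Ys \<union> {z} \<Longrightarrow> \<kappa> (kgen y) = ?a y"
    using K_universal[OF group_G] by metis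
  have "\<kappa> (kgen y) = gen y" if "y \<in> Ys" for y using \<kappa>(2)[of y] that z by auto
  then show thesis using that \<kappa> by simp
qed

text \<open>This is the mapping property of the quotient of \<open>H * K * F(Xs)\<close> by the
  relation \<open>R = z\<close>.\<close>

lemma G_universal:
  assumes Q: "group Q" and f: "f \<in> hom H Q" and k: "k \<in> hom K Q"
    and a: "\<And>x. x \<in> Xs \<Longrightarrow> a x \<in> carrier Q" and rel: "rel_word_value Q f a R = k (kgen z)"
  obtains \<Psi> where "\<Psi> \<in> hom G Q" "\<And>b. b \<in> carrier H \<Longrightarrow> \<Psi> (coeff b) = f b"
    "\<And>x. x \<in> Xs \<Longrightarrow> \<Psi> (gen x) = a x" "\<And>y. y \<in> Ys \<Longrightarrow> \<Psi> (gen y) = k (kgen y)"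
proof -
  interpret k: group_hom K Q k by (intro group_homI group_K Q k)
  define a' where "a' x = (if x \<in> Xs then a x else k (kgen x))" for x
  have a': "a' x \<in> carrier Q" if "x \<in> Xs \<union> Ys" for x using that a kgen_closed by (auto simp: a'_def)
  obtain h where h: "h \<in> hom F Q" "\<And>b. b \<in> carrier H \<Longrightarrow> h (rel_coeff H (Xs \<union> Ys) b) = f b"
    "\<And>x. x \<in> Xs \<union> Ys \<Longrightarrow> h (rel_gen H (Xs \<union> Ys) x) = a' x"
    using rel_free_universal[of H Q f "Xs \<union> Ys" a'] H Q f a' by metis
  interpret h: group_hom F Q h by (intro group_homI group_rel_free[OF H] Q h)
  have "h (rel_expr_value H (Xs \<union> Ys) R) = rel_word_value Q f a R"
    unfolding hom_rel_expr_value(2)[OF Q h(1)] by (rule rel_word_value_cong[OF R]) (simp_all add: h a'_def)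
  then have r: "h (rel_expr_value H (Xs \<union> Ys) R) = k (kgen z)" using rel by simp
  \<comment> \<open>As \<open>R\<close> takes the value of \<open>z\<close>, the relator evaluates
    to the image under \<open>k\<close> of the relator of \<open>K\<close>, which is
    trivial.\<close>
  have "h rel = word_value Q (\<lambda>y. k (kgen y)) S"
    unfolding hom_relator(2)[OF Q h(1)] using disjoint z
    by (intro word_value_cong[OF S]) (auto simp: h r a'_def)
  also have "\<dots> = k (word_value K kgen S)" by (rule k.hom_word_value(2)[OF S, symmetric]) (rule kgen_closed)
  finally have "h rel = \<one>\<^bsub>Q\<^esub>" unfolding kgen_relation k.hom_one .
  then obtain \<Psi> where \<Psi>: "\<Psi> \<in> hom G Q"
      "\<And>g. g \<in> carrier F \<Longrightarrow> \<Psi> (normal_closure F {rel} #>\<^bsub>F\<^esub> g) = h g"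
    unfolding rel_presented_group_def using h.Mod_normal_closure_universal[OF relator_closed] by blast
  have gen: "\<Psi> (gen x) = a' x" if "x \<in> Xs \<union> Ys" for x
    unfolding gen_def using \<Psi>(2) h(3) rel_gen_closed[OF H that] that by simp
  show thesis
  proof (rule that[OF \<Psi>(1)])
    show "\<Psi> (coeff b) = f b" if "b \<in> carrier H" for b
      unfolding coeff_def \<Psi>(2)[OF hom_in_carrier[OF rel_coeff_hom[OF H] that]] by (rule h(2)[OF that])
    show "\<Psi> (gen x) = a x" if "x \<in> Xs" for x using gen that by (simp add: a'_def)
    show "\<Psi> (gen y) = k (kgen y)" if "y \<in> Ys" for y using gen that disjoint by (auto simp: a'_def)
  qed
qed

end

section \<open>Finite quotients from periodic images in a wreath product\<close>

lemma periodic_mult: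
  fixes F :: "int \<Rightarrow> 'b"
  assumes "\<And>i. F (i + M) = F i"
  shows "F (i + k * M) = F i"
proof -
  have nat: "F (i + int n * M) = F i" for n i
  proof (induction n)
    case (Suc n)
    then show ?case using assms[of "i + int n * M"] by (simp add: algebra_simps)
  qed simp
  show ?thesis
  proof (cases "0 \<le> k")
    case True
    then show ?thesis using nat[of i "nat k"] by simp
  next
    case False
    then show ?thesis using nat[of "i + k * M" "nat (- k)"] by simp
  qed
qed

lemma map_wreath_hom:
  assumes "h \<in> hom Q Q'"
  shows "(\<lambda>x. (\<lambda>i. h (fst x i), snd x)) \<in> hom (wreath Q) (wreath Q')"
  using assms by (auto simp: hom_def Pi_iff)

text \<open>
  Constant functions \<open>1\<close> with a shift by a multiple of the period \<open>M\<close> commute with everything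
  \<open>M\<close>-periodic; modulo these, the image is finite.
\<close>

lemma periodic_wreath_separates:
  assumes G: "group G" and Q: "group Q" "finite (carrier Q)" and \<Psi>: "\<Psi> \<in> hom G (wreath Q)"
    and M: "M > 0" and per: "\<And>x i. x \<in> carrier G \<Longrightarrow> fst (\<Psi> x) (i + M) = fst (\<Psi> x) i"
    and g: "fst (\<Psi> g) j \<noteq> \<one>\<^bsub>Q\<^esub>"
  shows "\<exists>N. N \<lhd> G \<and> finite (rcosets\<^bsub>G\<^esub> N) \<and> g \<notin> N"
proof -
  interpret Q: group Q by fact
  interpret \<Psi>: group_hom G "wreath Q" \<Psi>
    by (intro group_homI G Q.group_wreath \<Psi>)
  let ?c = "\<lambda>x. fst (\<Psi> x)" and ?s = "\<lambda>x. snd (\<Psi> x)"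
  define N where "N = {x \<in> carrier G. (\<forall>i. ?c x i = \<one>\<^bsub>Q\<^esub>) \<and> M dvd ?s x}"
  have cl: "?c x i \<in> carrier Q" if "x \<in> carrier G" for x i
    using \<Psi>.hom_closed[OF that] by (cases "\<Psi> x") auto
  have mult: "?c (x \<otimes>\<^bsub>G\<^esub> y) i = ?c x i \<otimes>\<^bsub>Q\<^esub> ?c y (i + ?s x)" "?s (x \<otimes>\<^bsub>G\<^esub> y) = ?s x + ?s y"
    if "x \<in> carrier G" "y \<in> carrier G" for x y i
    using \<Psi>.hom_mult[OF that] by (cases "\<Psi> x"; cases "\<Psi> y"; simp)+
  have inv: "?c (inv\<^bsub>G\<^esub> x) i = inv\<^bsub>Q\<^esub> (?c x (i - ?s x))" "?s (inv\<^bsub>G\<^esub> x) = - ?s x" if "x \<in> carrier G" for x i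
    using \<Psi>.hom_inv[OF that] Q.inv_wreath[of "?c x" "?s x"] cl[OF that] by simp_all
  have perk: "?c x (i + t) = ?c x i" if "x \<in> carrier G" "M dvd t" for x i t
    using periodic_mult[of "?c x" M i] per that by (auto simp: dvd_def mult.commute)
  have "subgroup N G"
  proof (rule \<Psi>.G.subgroupI)
    show "N \<noteq> {}" by (auto simp: N_def intro!: exI[of _ "\<one>\<^bsub>G\<^esub>"])
  qed (auto simp: N_def inv mult simp del: \<Psi>.hom_mult \<Psi>.hom_inv)
  moreover have "x \<otimes>\<^bsub>G\<^esub> n \<otimes>\<^bsub>G\<^esub> inv\<^bsub>G\<^esub> x \<in> N" if x: "x \<in> carrier G" and n: "n \<in> N" for x n
  proof -
    have n': "n \<in> carrier G" "\<And>i. ?c n i = \<one>\<^bsub>Q\<^esub>" "M dvd ?s n" using n by (auto simp: N_def)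
    \<comment> \<open>The component of the conjugate at \<open>i\<close> is \<open>?c x i\<close>
      times the inverse of \<open>?c x (i + ?s n)\<close>, so these cancel by periodicity.\<close>
    have "?c x (i + ?s n) = ?c x i" for i using perk[OF x n'(3)] .
    then show ?thesis
      using x n' cl[OF x] by (simp add: N_def mult inv add.assoc del: \<Psi>.hom_mult \<Psi>.hom_inv)
  qed
  ultimately have normal: "N \<lhd> G" by (simp add: \<Psi>.G.normal_inv_iff)
  \<comment> \<open>One period of the function and the shift modulo \<open>M\<close> determine the
    coset.\<close>
  let ?\<tau> = "\<lambda>x. (map (\<lambda>t. ?c x (int t)) [0..<nat M], ?s x mod M)"
  have "?\<tau> ` carrier G \<subseteq> {xs. set xs \<subseteq> carrier Q \<and> length xs = nat M} \<times> {0..<M}"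
    using cl M by auto
  moreover have "finite ({xs. set xs \<subseteq> carrier Q \<and> length xs = nat M} \<times> {0..<M})"
    using finite_lists_length_eq[OF Q(2)] by simp
  ultimately have fin: "finite (?\<tau> ` carrier G)" by (rule finite_subset)
  have "finite (rcosets\<^bsub>G\<^esub> N)"
  proof (rule \<Psi>.G.finite_rcosets_if_separated[OF normal fin])
    fix x y assume x: "x \<in> carrier G" and y: "y \<in> carrier G" and eq: "?\<tau> x = ?\<tau> y"
    have "?c x i = ?c y i" for i
    proof -
      have "?c x (int (nat (i mod M))) = ?c y (int (nat (i mod M)))"
        using eq M by (auto simp: nat_less_iff dest!: bspec[of _ _ "nat (i mod M)"])
      then have "?c x (i mod M) = ?c y (i mod M)" using M by simp
      moreover have "?c w (i mod M) = ?c w i" if "w \<in> carrier G" for w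
        using perk[OF that, of "i div M * M" "i mod M"] by simp
      ultimately show ?thesis using x y by simp
    qed
    moreover have dvd: "M dvd ?s x - ?s y" using eq by (simp add: mod_eq_dvd_iff)
    moreover have "?c y (i + (?s x - ?s y)) = ?c y i" for i using perk[OF y dvd] .
    ultimately show "x \<otimes>\<^bsub>G\<^esub> inv\<^bsub>G\<^esub> y \<in> N"
      using x y cl[OF y] by (simp add: N_def mult inv add_diff_eq del: \<Psi>.hom_mult \<Psi>.hom_inv)
  qed
  moreover have "g \<notin> N" using g by (auto simp: N_def)
  ultimately show ?thesis using normal by blast
qed

section \<open>Comparing homomorphisms, and a residually finite cover\<close>

lemma subgroup_equalizer:
  assumes "group A" "group B" "h \<in> hom A B" "h' \<in> hom A B"
  shows "subgroup {g \<in> carrier A. h g = h' g} A"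
proof -
  interpret h: group_hom A B h using assms by (intro group_homI)
  interpret h': group_hom A B h' using assms by (intro group_homI)
  show ?thesis by (intro h.G.subgroupI) (auto intro!: exI[of _ "\<one>\<^bsub>A\<^esub>"])
qed

lemma DirProd_inl_hom: "group H \<Longrightarrow> group K \<Longrightarrow> (\<lambda>b. (b, \<one>\<^bsub>K\<^esub>)) \<in> hom H (H \<times>\<times> K)"
  by (auto simp: hom_def group.is_monoid monoid.one_closed monoid.l_one)

lemma DirProd_inr_hom: "group H \<Longrightarrow> group K \<Longrightarrow> (\<lambda>g. (\<one>\<^bsub>H\<^esub>, g)) \<in> hom K (H \<times>\<times> K)"
  by (auto simp: hom_def group.is_monoid monoid.one_closed monoid.l_one)

text \<open>The cover is a free product of copies of
  \<open>H \<times>\<times> (K \<times>\<times> integer_group)\<close>, one for every letter and one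
  each for \<open>H\<close> and \<open>K\<close>. It is larger than \<open>H * K * F(X)\<close>, but
  its factors are all the same group, so \<open>residually_finite_copower\<close> applies.\<close>

lemma free_product_cover:
  fixes H :: "('h, 'm) monoid_scheme" and K :: "('k, 'n) monoid_scheme" and G :: "('g, 'p) monoid_scheme"
    and X :: "'a set"
  assumes H: "group H" "residually_finite H" and K: "group K" "residually_finite K" and G: "group G"
    and \<iota>: "\<iota> \<in> hom H G" and \<kappa>: "\<kappa> \<in> hom K G" and \<gamma>: "\<forall>x\<in>X. \<gamma> x \<in> carrier G"
  obtains P :: "(('a + bool) \<times> ('h \<times> 'k \<times> int)) list set monoid" and f k \<xi> \<pi>
  where "group P" "residually_finite P" "f \<in> hom H P" "k \<in> hom K P" "\<And>x. \<xi> x \<in> carrier P" "\<pi> \<in> hom P G"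
    "\<And>b. b \<in> carrier H \<Longrightarrow> \<pi> (f b) = \<iota> b" "\<And>b. b \<in> carrier K \<Longrightarrow> \<pi> (k b) = \<kappa> b"
    "\<And>x. x \<in> X \<Longrightarrow> \<pi> (\<xi> x) = \<gamma> x"
proof -
  interpret H: group H by fact
  interpret K: group K by fact
  interpret G: group G by fact
  let ?A = "H \<times>\<times> (K \<times>\<times> integer_group)"
  interpret A: group ?A by (intro DirProd_group H K group_integer_group)
  let ?P = "copower UNIV ?A :: (('a + bool) \<times> ('h \<times> 'k \<times> int)) list set monoid"
  let ?j = "copower_in UNIV ?A :: ('a + bool) \<Rightarrow> _"
  define f where "f b = ?j (Inr False) (b, \<one>\<^bsub>K\<^esub>, 0)" for b
  define k where "k b = ?j (Inr True) (\<one>\<^bsub>H\<^esub>, b, 0)" for b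
  define \<xi> where "\<xi> x = ?j (Inl x) (\<one>\<^bsub>H\<^esub>, \<one>\<^bsub>K\<^esub>, 1)" for x
  \<comment> \<open>Each copy forgets all coordinates except the one it stands for; copies of
    letters outside \<open>X\<close> are killed.\<close>
  define m where "m i = (case i of
      Inl x \<Rightarrow> (\<lambda>(b, c, n :: int). if x \<in> X then \<gamma> x [^]\<^bsub>G\<^esub> n else \<one>\<^bsub>G\<^esub>)
    | Inr False \<Rightarrow> (\<lambda>(b, c, n). \<iota> b) | Inr True \<Rightarrow> (\<lambda>(b, c, n). \<kappa> c))" for i
  have "m i \<in> hom ?A G" for i
    using \<iota> \<kappa> \<gamma> by (cases i) (auto simp: m_def hom_def Pi_def G.int_pow_mult split: bool.splits)
  then obtain \<pi> where \<pi>: "\<pi> \<in> hom ?P G" "\<And>i a. a \<in> carrier ?A \<Longrightarrow> \<pi> (?j i a) = m i a"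
    using A.copower_universal[OF G, of UNIV m] by (metis UNIV_I)
  have j: "?j i \<in> hom ?A ?P" for i by (rule A.copower_in_hom) simp
  have i: "(\<lambda>b. (b, \<one>\<^bsub>K\<^esub>, 0)) \<in> hom H ?A" "(\<lambda>b. (\<one>\<^bsub>H\<^esub>, b, 0)) \<in> hom K ?A"
    by (auto simp: hom_def)
  have "f \<in> hom H ?P" "k \<in> hom K ?P"
    using hom_compose[OF i(1) j] hom_compose[OF i(2) j] unfolding f_def[abs_def] k_def[abs_def] o_def by blast+
  moreover have "\<xi> x \<in> carrier ?P" for x
    unfolding \<xi>_def by (rule hom_in_carrier[OF j]) simp
  moreover have "group ?P" by (rule A.group_copower)
  moreover have "residually_finite ?P"
    by (intro A.residually_finite_copower residually_finite_DirProd DirProd_group H K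
        group_integer_group residually_finite_integer_group)
  moreover have "\<pi> (f b) = \<iota> b" if "b \<in> carrier H" for b using \<pi>(2) that by (simp add: f_def m_def)
  moreover have "\<pi> (k b) = \<kappa> b" if "b \<in> carrier K" for b using \<pi>(2) that by (simp add: k_def m_def)
  moreover have "\<pi> (\<xi> x) = \<gamma> x" if "x \<in> X" for x using \<pi>(2) that \<gamma> by (simp add: \<xi>_def m_def)
  ultimately show thesis using that \<pi>(1) by blast
qed

lemma path_value_cong_fun:
  assumes "R \<in> lists (X \<times> {1, -1} \<times> B)" "\<And>b. b \<in> B \<Longrightarrow> f b = f' b" "\<And>x. x \<in> X \<Longrightarrow> a x = a' x"
  shows "path_value Q \<theta> f a R i = path_value Q \<theta> f' a' R i"
  using assms(1)
proof (induction R arbitrary: i)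
  case (Cons c R)
  then show ?case using assms(2,3) by (cases c) auto
qed simp

section \<open>Homomorphisms from \<open>G\<close> to wreath products\<close>

locale peaked_substitution = substitution H Xs Ys z S R + peaks \<theta> "skeleton R" jt jb D
  for H :: "('h, 'm) monoid_scheme" and Xs Ys :: "'a set" and z S and R :: "('a \<times> int \<times> 'h) list"
    and \<theta> jt jb D
begin

text \<open>The relations at all heights together say that \<open>R\<close> and \<open>z\<close>
  have the same image in the wreath product, the shift of \<open>R\<close> being 0 since the path is
  balanced. This is the condition of \<open>G_universal\<close>.\<close>

lemma sequence_wreath_hom:
  assumes Q: "group Q" and f: "f \<in> hom H Q" and k: "k \<in> hom K Q"
    and \<xi>: "\<And>x. x \<in> Xs \<Longrightarrow> \<xi> x \<in> carrier Q" and E: "range E \<subseteq> carrier Q"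
    and sat: "\<And>i. path_value Q \<theta> f (edges c \<xi> E) R i = k (kgen z)"
  obtains \<Psi> where "\<Psi> \<in> hom G (wreath Q)" "\<And>b. b \<in> carrier H \<Longrightarrow> \<Psi> (coeff b) = (\<lambda>_. f b, 0)"
    "\<And>x. x \<in> Xs \<Longrightarrow> \<Psi> (gen x) = (edges c \<xi> E x, \<theta> x)"
    "\<And>y. y \<in> Ys \<Longrightarrow> \<Psi> (gen y) = (\<lambda>_. k (kgen y), 0)"
    "\<Psi> (rel_word_value G coeff gen R) = (\<lambda>_. k (kgen z), 0)"
proof -
  interpret Q: group Q by fact
  let ?f = "\<lambda>b. (\<lambda>_ :: int. f b, 0 :: int)" and ?k = "\<lambda>g. (\<lambda>_ :: int. k g, 0 :: int)"
    and ?a = "\<lambda>x. (edges c \<xi> E x, \<theta> x)"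
  have const: "?f \<in> hom H (wreath Q)" "?k \<in> hom K (wreath Q)"
    using f k by (auto simp: hom_def)
  have closed: "edges c \<xi> E x n \<in> carrier Q" if "x \<in> Xs" for x n
    using edges_closed[OF E, of Xs \<xi> x] \<xi> that by blast
  have rel: "rel_word_value (wreath Q) ?f ?a R = ?k (kgen z)"
    using Q.rel_word_value_wreath[OF R, of f "edges c \<xi> E" \<theta>] closed hom_in_carrier[OF f] sat balanced
    by (simp add: fun_eq_iff)
  have a: "?a x \<in> carrier (wreath Q)" if "x \<in> Xs" for x using closed[OF that] by simp
  obtain \<Psi> where \<Psi>: "\<Psi> \<in> hom G (wreath Q)" "\<And>b. b \<in> carrier H \<Longrightarrow> \<Psi> (coeff b) = ?f b"
    "\<And>x. x \<in> Xs \<Longrightarrow> \<Psi> (gen x) = ?a x" "\<And>y. y \<in> Ys \<Longrightarrow> \<Psi> (gen y) = ?k (kgen y)"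
    using G_universal[OF Q.group_wreath const a rel] by metis
  interpret \<Psi>: group_hom G "wreath Q" \<Psi> by (intro group_homI group_G Q.group_wreath \<Psi>)
  have "\<Psi> (rel_word_value G coeff gen R) =
      rel_word_value (wreath Q) (\<lambda>b. \<Psi> (coeff b)) (\<lambda>x. \<Psi> (gen x)) R"
    by (rule \<Psi>.hom_rel_word_value(2)[OF R]) (auto intro: hom_in_carrier[OF coeff_hom] gen_closed)
  also have "\<dots> = rel_word_value (wreath Q) ?f ?a R"
    by (rule rel_word_value_cong[OF R]) (simp_all add: \<Psi>)
  finally show thesis using that[OF \<Psi>] rel by simp
qed

lemma skeleton_letter: "j < length (skeleton R) \<Longrightarrow> fst (skeleton R ! j) \<in> Xs"
proof -
  assume "j < length (skeleton R)"
  then have "R ! j \<in> Xs \<times> {1, -1} \<times> carrier H" and "fst (skeleton R ! j) = fst (R ! j)"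
    using bspec[OF in_listsD[OF R] nth_mem[of j R]] by (auto simp: skeleton_def split: prod.splits)
  then show ?thesis by auto
qed

text \<open>The recursion is solvable for any right hand side \<open>k (kgen z)\<close>, so
  arbitrary homomorphisms on \<open>H\<close> and \<open>K\<close> combine into one on
  \<open>G\<close>.\<close>

lemma wreath_hom_extending:
  assumes Q: "group Q" and f: "f \<in> hom H Q" and k: "k \<in> hom K Q" and \<kappa>: "\<kappa> \<in> hom K G"
    "\<And>y. y \<in> Ys \<Longrightarrow> \<kappa> (kgen y) = gen y" "\<kappa> (kgen z) = rel_word_value G coeff gen R"
  obtains \<Psi> where "\<Psi> \<in> hom G (wreath Q)" "\<And>b. b \<in> carrier H \<Longrightarrow> \<Psi> (coeff b) = (\<lambda>_. f b, 0)"
    "\<And>g. g \<in> carrier K \<Longrightarrow> \<Psi> (\<kappa> g) = (\<lambda>_. k g, 0)"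
proof -
  interpret Q: group Q by fact
  have kz: "k (kgen z) \<in> carrier Q" by (rule hom_in_carrier[OF k kgen_closed]) simp
  \<comment> \<open>\<open>2 * D + 1\<close> is the least delay that \<open>recursion\<close>
    admits; letters of all further kinds get the value \<open>\<one>\<close>.\<close>
  interpret two_sided_recursion "carrier Q" "edge_start \<theta> (skeleton R) jt"
    "edge_start \<theta> (skeleton R) jb - (2 * D + 1)"
    "\<lambda>i E. path_value Q \<theta> f (edges (2 * D + 1) (\<lambda>_. \<one>\<^bsub>Q\<^esub>) E) R i = k (kgen z)"
    by (rule recursion[OF Q R]) (simp_all add: kz hom_in_carrier[OF f])
  have one: "range (\<lambda>_ :: int. \<one>\<^bsub>Q\<^esub>) \<subseteq> carrier Q" by auto
  obtain E where E: "range E \<subseteq> carrier Q"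
    "\<And>i. path_value Q \<theta> f (edges (2 * D + 1) (\<lambda>_. \<one>\<^bsub>Q\<^esub>) E) R i = k (kgen z)"
    using solution_ex[OF one, of 0] by metis
  obtain \<Psi> where \<Psi>: "\<Psi> \<in> hom G (wreath Q)" "\<And>b. b \<in> carrier H \<Longrightarrow> \<Psi> (coeff b) = (\<lambda>_. f b, 0)"
    "\<And>y. y \<in> Ys \<Longrightarrow> \<Psi> (gen y) = (\<lambda>_. k (kgen y), 0)"
    "\<Psi> (rel_word_value G coeff gen R) = (\<lambda>_. k (kgen z), 0)"
    using sequence_wreath_hom[OF Q f k _ E] by (metis Q.one_closed)
  \<comment> \<open>Two homomorphisms on \<open>K\<close> are compared on its generators; at
    \<open>z\<close> the comparison is the value of \<open>R\<close>.\<close>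
  have "carrier K \<subseteq> {g \<in> carrier K. (\<Psi> \<circ> \<kappa>) g = (\<lambda>_. k g, 0)}"
  proof (rule K_generated)
    show "subgroup {g \<in> carrier K. (\<Psi> \<circ> \<kappa>) g = (\<lambda>_. k g, 0)} K"
      using hom_compose[OF \<kappa>(1) \<Psi>(1)] k
      by (intro subgroup_equalizer[OF group_K Q.group_wreath]) (auto simp: hom_def)
    show "kgen y \<in> {g \<in> carrier K. (\<Psi> \<circ> \<kappa>) g = (\<lambda>_. k g, 0)}" if "y \<in> Ys \<union> {z}" for y
      using that \<Psi>(3,4) \<kappa>(2,3) kgen_closed[OF that] by auto
  qed
  then have "\<Psi> (\<kappa> g) = (\<lambda>_. k g, 0)" if "g \<in> carrier K" for g using that by auto
  then show thesis using that \<Psi> by blast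
qed

section \<open>The two directions of the equivalence\<close>

lemma residually_finite_factors:
  assumes "residually_finite G"
  shows "residually_finite H \<and> residually_finite K"
proof -
  interpret H: group H by (rule H)
  interpret K: group K by (rule group_K)
  interpret HK: group "H \<times>\<times> K" by (rule DirProd_group[OF H group_K])
  obtain \<kappa> where \<kappa>: "\<kappa> \<in> hom K G" "\<And>y. y \<in> Ys \<Longrightarrow> \<kappa> (kgen y) = gen y"
    "\<kappa> (kgen z) = rel_word_value G coeff gen R"
    by (rule K_to_G) blast
  \<comment> \<open>With the two inclusions into \<open>H \<times>\<times> K\<close> as
    \<open>f\<close> and \<open>k\<close>, \<Psi> shows that \<open>coeff\<close> and
    \<open>\<kappa>\<close> are injective.\<close>
  obtain \<Psi> where \<Psi>: "\<Psi> \<in> hom G (wreath (H \<times>\<times> K))"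
    "\<And>b. b \<in> carrier H \<Longrightarrow> \<Psi> (coeff b) = (\<lambda>_. (b, \<one>\<^bsub>K\<^esub>), 0)"
    "\<And>g. g \<in> carrier K \<Longrightarrow> \<Psi> (\<kappa> g) = (\<lambda>_. (\<one>\<^bsub>H\<^esub>, g), 0)"
    using wreath_hom_extending[OF HK.is_group DirProd_inl_hom[OF H group_K] DirProd_inr_hom[OF H group_K] \<kappa>] by blast
  interpret \<Psi>: group_hom G "wreath (H \<times>\<times> K)" \<Psi>
    by (intro group_homI group_G HK.group_wreath \<Psi>)
  have "residually_finite H"
  proof (rule residually_finite_embed[OF H group_G coeff_hom assms])
    fix b assume "b \<in> carrier H" "coeff b = \<one>\<^bsub>G\<^esub>"
    then show "b = \<one>\<^bsub>H\<^esub>" using \<Psi>(2)[of b] \<Psi>.hom_one by (simp add: fun_eq_iff)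
  qed
  moreover have "residually_finite K"
  proof (rule residually_finite_embed[OF group_K group_G \<kappa>(1) assms])
    fix b assume "b \<in> carrier K" "\<kappa> b = \<one>\<^bsub>G\<^esub>"
    then show "b = \<one>\<^bsub>K\<^esub>" using \<Psi>(3)[of b] \<Psi>.hom_one by (simp add: fun_eq_iff)
  qed
  ultimately show ?thesis ..
qed

text \<open>
  \<open>\<Psi>\<close> is read through \<open>\<pi>\<close>, and is the constant embedding \<open>g \<mapsto> (\<lambda>_. g)\<close> on
  the generators at heights up to \<open>N\<close>.
\<close>

definition constant_up_to ::
  "('p, 'q) monoid_scheme \<Rightarrow> ('p \<Rightarrow> ('h + ('a \<times> int) list set) list set set) \<Rightarrow> ('a \<Rightarrow> int) \<Rightarrow> int \<Rightarrow>
   (('h + ('a \<times> int) list set) list set set \<Rightarrow> (int \<Rightarrow> 'p) \<times> int) \<Rightarrow> bool" where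
  "constant_up_to P \<pi> t N \<Psi> \<longleftrightarrow> \<Psi> \<in> hom G (wreath P) \<and>
    (\<forall>b\<in>carrier H. snd (\<Psi> (coeff b)) = 0 \<and> (\<forall>i. \<pi> (fst (\<Psi> (coeff b)) i) = coeff b)) \<and>
    (\<forall>x\<in>Xs \<union> Ys. snd (\<Psi> (gen x)) = t x \<and> (\<forall>i. \<bar>i\<bar> \<le> N \<longrightarrow> \<pi> (fst (\<Psi> (gen x)) i) = gen x))"

text \<open>An element is a word in the generators, so evaluating it at height \<open>i\<close>
  visits heights within some distance \<open>m\<close> of \<open>i\<close>. The shifts are
  prescribed by \<open>t\<close>, so \<open>m\<close> depends neither on \<open>N\<close> nor on
  \<open>\<Psi>\<close>; this allows \<open>N\<close> to be chosen from \<open>g\<close> before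
  \<open>\<Psi>\<close> is built.\<close>

lemma constant_up_to_elements:
  assumes P: "group P" and \<pi>: "\<pi> \<in> hom P G" and g: "g \<in> carrier G"
  obtains m where "m \<ge> 0" "\<And>N \<Psi> i. constant_up_to P \<pi> t N \<Psi> \<Longrightarrow> \<bar>i\<bar> + m \<le> N \<Longrightarrow> \<pi> (fst (\<Psi> g) i) = g"
proof -
  interpret \<pi>: group_hom P G \<pi> by (intro group_homI P group_G \<pi>)
  \<comment> \<open>The shift is bounded as well, so that the property passes to products, whose
    second factor is read at a shifted height.\<close>
  define near where "near m g \<longleftrightarrow> 0 \<le> m \<and> (\<forall>N \<Psi>. constant_up_to P \<pi> t N \<Psi> \<longrightarrow>
    \<bar>snd (\<Psi> g)\<bar> \<le> m \<and> (\<forall>i. \<bar>i\<bar> + m \<le> N \<longrightarrow> \<pi> (fst (\<Psi> g) i) = g))" for m :: int and g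
  let ?T = "{g \<in> carrier G. \<exists>m. near m g}"
  have \<Psi>hom: "group_hom G (wreath P) \<Psi>" if "constant_up_to P \<pi> t N \<Psi>" for N \<Psi>
    using that unfolding constant_up_to_def by (intro group_homI group_G \<pi>.G.group_wreath) blast
  have cl: "fst (\<Psi> x) i \<in> carrier P" if "constant_up_to P \<pi> t N \<Psi>" "x \<in> carrier G" for N \<Psi> x i
    using group_hom.hom_closed[OF \<Psi>hom[OF that(1)] that(2)] by (cases "\<Psi> x") auto
  have "carrier G \<subseteq> ?T"
  proof (rule G_generated)
    show "subgroup ?T G"
    proof (rule \<pi>.H.subgroupI)
      show "?T \<subseteq> carrier G" by blast
      have "near 0 \<one>\<^bsub>G\<^esub>"
        unfolding near_def
      proof (intro conjI allI impI)
        fix N \<Psi> i assume \<Psi>: "constant_up_to P \<pi> t N \<Psi>"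
        have "\<Psi> \<one>\<^bsub>G\<^esub> = (\<lambda>_. \<one>\<^bsub>P\<^esub>, 0)" using group_hom.hom_one[OF \<Psi>hom[OF \<Psi>]] by simp
        then show "\<bar>snd (\<Psi> \<one>\<^bsub>G\<^esub>)\<bar> \<le> 0" "\<pi> (fst (\<Psi> \<one>\<^bsub>G\<^esub>) i) = \<one>\<^bsub>G\<^esub>" by simp_all
      qed simp
      then show "?T \<noteq> {}" by blast
    next
      fix x assume "x \<in> ?T"
      then obtain m where x: "x \<in> carrier G" and m: "near m x" by blast
      \<comment> \<open>The inverse reads \<open>x\<close> at \<open>i - snd (\<Psi> x)\<close>,
        which costs another \<open>m\<close>.\<close>
      have "near (2 * m) (inv\<^bsub>G\<^esub> x)"
        unfolding near_def
      proof (intro conjI allI impI)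
        show "0 \<le> 2 * m" using m by (simp add: near_def)
        fix N \<Psi> assume \<Psi>: "constant_up_to P \<pi> t N \<Psi>"
        have s: "\<bar>snd (\<Psi> x)\<bar> \<le> m" and c: "\<And>i. \<bar>i\<bar> + m \<le> N \<Longrightarrow> \<pi> (fst (\<Psi> x) i) = x"
          using m \<Psi> unfolding near_def by blast+
        have inv: "\<Psi> (inv\<^bsub>G\<^esub> x) = (\<lambda>i. inv\<^bsub>P\<^esub> (fst (\<Psi> x) (i - snd (\<Psi> x))), - snd (\<Psi> x))"
          using group_hom.hom_inv[OF \<Psi>hom[OF \<Psi>] x] \<pi>.G.inv_wreath[where c = "fst (\<Psi> x)" and s = "snd (\<Psi> x)", OF cl[OF \<Psi> x]] by simp
        show "\<bar>snd (\<Psi> (inv\<^bsub>G\<^esub> x))\<bar> \<le> 2 * m" using s by (simp add: inv)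
        fix i assume "\<bar>i\<bar> + 2 * m \<le> N"
        then have "\<pi> (fst (\<Psi> x) (i - snd (\<Psi> x))) = x" using s by (intro c) linarith
        then show "\<pi> (fst (\<Psi> (inv\<^bsub>G\<^esub> x)) i) = inv\<^bsub>G\<^esub> x"
          using cl[OF \<Psi> x] by (simp add: inv)
      qed
      then show "inv\<^bsub>G\<^esub> x \<in> ?T" using x by blast
    next
      fix x y assume "x \<in> ?T" "y \<in> ?T"
      then obtain m n where x: "x \<in> carrier G" "near m x" and y: "y \<in> carrier G" "near n y" by blast
      have "near (m + n) (x \<otimes>\<^bsub>G\<^esub> y)"
        unfolding near_def
      proof (intro conjI allI impI)
        show "0 \<le> m + n" using x y by (simp add: near_def)
        fix N \<Psi> assume \<Psi>: "constant_up_to P \<pi> t N \<Psi>"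
        have s: "\<bar>snd (\<Psi> x)\<bar> \<le> m" "\<bar>snd (\<Psi> y)\<bar> \<le> n" "0 \<le> n"
          and c: "\<And>i. \<bar>i\<bar> + m \<le> N \<Longrightarrow> \<pi> (fst (\<Psi> x) i) = x" "\<And>i. \<bar>i\<bar> + n \<le> N \<Longrightarrow> \<pi> (fst (\<Psi> y) i) = y"
          using x(2) y(2) \<Psi> unfolding near_def by blast+
        have mult: "\<Psi> (x \<otimes>\<^bsub>G\<^esub> y) = (\<lambda>i. fst (\<Psi> x) i \<otimes>\<^bsub>P\<^esub> fst (\<Psi> y) (i + snd (\<Psi> x)), snd (\<Psi> x) + snd (\<Psi> y))"
          using group_hom.hom_mult[OF \<Psi>hom[OF \<Psi>] x(1) y(1)] by (cases "\<Psi> x"; cases "\<Psi> y") simp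
        show "\<bar>snd (\<Psi> (x \<otimes>\<^bsub>G\<^esub> y))\<bar> \<le> m + n" using s by (simp add: mult)
        fix i assume "\<bar>i\<bar> + (m + n) \<le> N"
        then have "\<pi> (fst (\<Psi> x) i) = x" "\<pi> (fst (\<Psi> y) (i + snd (\<Psi> x))) = y"
          using s by (intro c; linarith)+
        then show "\<pi> (fst (\<Psi> (x \<otimes>\<^bsub>G\<^esub> y)) i) = x \<otimes>\<^bsub>G\<^esub> y"
          using cl[OF \<Psi> x(1)] cl[OF \<Psi> y(1)] by (simp add: mult)
      qed
      then show "x \<otimes>\<^bsub>G\<^esub> y \<in> ?T" using x y by blast
    qed
  next
    fix b assume b: "b \<in> carrier H"
    then have "near 0 (coeff b)" unfolding near_def constant_up_to_def by auto
    then show "coeff b \<in> ?T" using hom_in_carrier[OF coeff_hom b] by blast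
  next
    fix x assume x: "x \<in> Xs \<union> Ys"
    have "near \<bar>t x\<bar> (gen x)"
      unfolding near_def
    proof (intro conjI allI impI)
      fix N \<Psi> i assume \<Psi>: "constant_up_to P \<pi> t N \<Psi>"
      then have gx: "snd (\<Psi> (gen x)) = t x" "\<And>i. \<bar>i\<bar> \<le> N \<Longrightarrow> \<pi> (fst (\<Psi> (gen x)) i) = gen x"
        using x unfolding constant_up_to_def by blast+
      show "\<bar>snd (\<Psi> (gen x))\<bar> \<le> \<bar>t x\<bar>" by (simp add: gx(1))
      assume "\<bar>i\<bar> + \<bar>t x\<bar> \<le> N"
      then show "\<pi> (fst (\<Psi> (gen x)) i) = gen x" by (intro gx(2)) linarith
    qed simp
    then show "gen x \<in> ?T" using gen_closed[OF x] by blast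
  qed
  then obtain m where m: "near m g" using g by blast
  show thesis
  proof (rule that)
    show "0 \<le> m" using m unfolding near_def by blast
    show "\<pi> (fst (\<Psi> g) i) = g" if "constant_up_to P \<pi> t N \<Psi>" "\<bar>i\<bar> + m \<le> N" for N \<Psi> i
      using m that unfolding near_def by blast
  qed
qed

text \<open>The role of \<open>\<pi>\<close> is to certify that the value of \<open>g\<close> in
  \<open>P\<close> is not \<open>\<one>\<close>; the finite quotient of \<open>G\<close> is then
  built from a finite quotient of \<open>P\<close>.\<close>

lemma separates_if_covered:
  fixes P :: "('p, 'q) monoid_scheme"
  assumes P: "group P" "residually_finite P" and f: "f \<in> hom H P" and k: "k \<in> hom K P"
    and \<xi>: "\<And>x. \<xi> x \<in> carrier P" and \<pi>: "\<pi> \<in> hom P G" and \<kappa>: "\<kappa> \<in> hom K G"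
    and \<pi>f: "\<And>b. b \<in> carrier H \<Longrightarrow> \<pi> (f b) = coeff b" and \<pi>k: "\<And>b. b \<in> carrier K \<Longrightarrow> \<pi> (k b) = \<kappa> b"
    and \<pi>\<xi>: "\<And>x. x \<in> Xs \<Longrightarrow> \<pi> (\<xi> x) = gen x"
    and \<kappa>y: "\<And>y. y \<in> Ys \<Longrightarrow> \<kappa> (kgen y) = gen y" and \<kappa>R: "\<kappa> (kgen z) = rel_word_value G coeff gen R"
    and g: "g \<in> carrier G" "g \<noteq> \<one>\<^bsub>G\<^esub>"
  shows "\<exists>N. N \<lhd> G \<and> finite (rcosets\<^bsub>G\<^esub> N) \<and> g \<notin> N"
proof -
  let ?n = "edge_start \<theta> (skeleton R)" and ?xt = "fst (skeleton R ! jt)" and ?xb = "fst (skeleton R ! jb)"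
  have genX: "gen x \<in> carrier G" if "x \<in> Xs" for x using gen_closed that by blast
  interpret P: group P by fact
  interpret \<pi>: group_hom P G \<pi> by (intro group_homI P group_G \<pi>)
  \<comment> \<open>Letters of \<open>Ys\<close> come from \<open>K\<close>, which is mapped to
    constants with shift 0.\<close>
  define t where "t x = (if x \<in> Xs then \<theta> x else 0)" for x
  obtain N where N: "N \<ge> 0" "\<And>M \<Psi> i. constant_up_to P \<pi> t M \<Psi> \<Longrightarrow> \<bar>i\<bar> + N \<le> M \<Longrightarrow> \<pi> (fst (\<Psi> g) i) = g"
    using constant_up_to_elements[OF P(1) \<pi> g(1)] by metis
  \<comment> \<open>With these values, a relation whose window lies in \<open>{s..N}\<close> has its
    undelayed indices above \<open>B\<close> and its delayed ones at most \<open>B\<close>. For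
    \<bar>i\<bar> \<le> N the indices \<open>i\<close> and \<open>i - c\<close> lie in
    \<open>{s..N}\<close>, on either side of this cut.\<close>
  define c where "c = 2 * N + 4 * D + 1"
  define B where "B = - N - 2 * D - 1"
  define s where "s = - N - c"
  have n: "- D \<le> ?n j" "?n j \<le> D" if "j < length (skeleton R)" for j using bound[OF that] by linarith+
  have D: "0 \<le> D" using n[OF jt] by linarith
  have c: "2 * D < c" using N D by (simp add: c_def)
  have kz: "k (kgen z) \<in> carrier P" by (rule hom_in_carrier[OF k kgen_closed]) simp
  interpret rP: two_sided_recursion "carrier P" "?n jt" "?n jb - c"
    "\<lambda>i E. path_value P \<theta> f (edges c \<xi> E) R i = k (kgen z)"
    by (rule recursion[OF P(1) R]) (simp_all add: kz hom_in_carrier[OF f] \<xi> c)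
  \<comment> \<open>The initial data are the letters themselves: the second kind up to the cut
    \<open>B\<close>, the first kind above it.\<close>
  let ?E0 = "\<lambda>n. if n \<le> B then \<xi> ?xb else \<xi> ?xt"
  have "range ?E0 \<subseteq> carrier P" using \<xi> by auto
  then obtain E where E: "range E \<subseteq> carrier P"
    and sat: "\<And>i. path_value P \<theta> f (edges c \<xi> E) R i = k (kgen z)"
    and init: "\<And>n. s \<le> n \<Longrightarrow> n < s + (?n jt - (?n jb - c)) \<Longrightarrow> E n = ?E0 n"
    by (rule rP.solution_ex[of ?E0 s]) blast
  have Ecl: "E n \<in> carrier P" for n using E by blast
  have edcl: "edges c \<xi> E x n \<in> carrier P" for x n
    using edges_closed[OF E, of UNIV \<xi>] \<xi> by blast

  have \<kappa>z: "\<kappa> (kgen z) \<in> carrier G" by (rule hom_in_carrier[OF \<kappa> kgen_closed]) simp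
  interpret rG: two_sided_recursion "carrier G" "?n jt" "?n jb - c"
    "\<lambda>i E. path_value G \<theta> coeff (edges c gen E) R i = \<kappa> (kgen z)"
    by (rule recursion[OF group_G R]) (simp_all add: \<kappa>z hom_in_carrier[OF coeff_hom] genX c)
  let ?EG = "\<lambda>n. if n \<le> B then gen ?xb else gen ?xt"
  have x: "?xt \<in> Xs" "?xb \<in> Xs" using skeleton_letter jt jb by blast+
  \<comment> \<open>The step function \<open>?EG\<close> solves the relations with windows in
    \<open>{s..N}\<close>: all edges they see carry their own letters, so the path value is that of
    \<open>R\<close>. The image of \<open>E\<close> solves them too and has the same initial data,
    so the two agree up to \<open>N\<close>.\<close>
  have \<pi>E: "\<pi> (E n) = ?EG n" if "s \<le> n" "n \<le> N" for n
  proof (rule rG.unique_up[OF _ _ _ _ that])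
    show "range (\<lambda>n. \<pi> (E n)) \<subseteq> carrier G" using Ecl by auto
    show "range ?EG \<subseteq> carrier G" using genX x by auto
    show "\<pi> (E m) = ?EG m" if "s \<le> m" "m < s + (?n jt - (?n jb - c))" for m
      using init[OF that] \<pi>\<xi> x by simp
    fix i assume i: "s \<le> i + (?n jb - c)" "i + ?n jt \<le> N"
    have "path_value G \<theta> coeff (edges c gen (\<lambda>n. \<pi> (E n))) R i =
        path_value G \<theta> (\<lambda>b. \<pi> (f b)) (\<lambda>x n. \<pi> (edges c \<xi> E x n)) R i"
      by (rule path_value_cong_fun[OF R])
        (auto simp: \<pi>f edges_def linked_edges_def \<pi>\<xi> fun_eq_iff)
    also have "\<dots> = \<pi> (path_value P \<theta> f (edges c \<xi> E) R i)"
      by (rule hom_path_value[OF P(1) group_G \<pi> R, symmetric]) (auto intro: hom_in_carrier[OF f] edcl)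
    also have "\<dots> = \<kappa> (kgen z)" unfolding sat by (rule \<pi>k[OF kgen_closed]) simp
    finally have 1: "path_value G \<theta> coeff (edges c gen (\<lambda>n. \<pi> (E n))) R i = \<kappa> (kgen z)" .
    have "path_value G \<theta> coeff (edges c gen ?EG) R i = path_value G \<theta> coeff (\<lambda>x _. gen x) R i"
    proof (rule path_value_cong)
      fix j assume "j < length R"
      then have j: "j < length (skeleton R)" by simp
      have "B < i + ?n j" "i + ?n j - c \<le> B"
        using i n[OF j] n[OF jt] n[OF jb] by (simp_all add: s_def B_def c_def)
      then show "edges c gen ?EG (fst (skeleton R ! j)) (i + ?n j) = gen (fst (skeleton R ! j))"
        by (auto simp: edges_def linked_edges_def)
    qed
    then have "path_value G \<theta> coeff (edges c gen ?EG) R i = \<kappa> (kgen z)"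
      by (simp add: path_value_const \<kappa>R)
    with 1 show "path_value G \<theta> coeff (edges c gen (\<lambda>n. \<pi> (E n))) R i = \<kappa> (kgen z) \<and>
      path_value G \<theta> coeff (edges c gen ?EG) R i = \<kappa> (kgen z)" by blast
  qed

  obtain \<Psi> where \<Psi>: "\<Psi> \<in> hom G (wreath P)" and \<Psi>c: "\<And>b. b \<in> carrier H \<Longrightarrow> \<Psi> (coeff b) = (\<lambda>_. f b, 0)"
    and \<Psi>x: "\<And>x. x \<in> Xs \<Longrightarrow> \<Psi> (gen x) = (edges c \<xi> E x, \<theta> x)"
    and \<Psi>y: "\<And>y. y \<in> Ys \<Longrightarrow> \<Psi> (gen y) = (\<lambda>_. k (kgen y), 0)"
    using sequence_wreath_hom[OF P(1) f k \<xi> E sat] by metis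
  have "constant_up_to P \<pi> t N \<Psi>"
    unfolding constant_up_to_def
  proof (intro conjI ballI allI impI \<Psi>)
    fix b assume "b \<in> carrier H"
    then show "snd (\<Psi> (coeff b)) = 0" "\<pi> (fst (\<Psi> (coeff b)) i) = coeff b" for i
      by (simp_all add: \<Psi>c \<pi>f)
  next
    fix x assume xy: "x \<in> Xs \<union> Ys"
    then show "snd (\<Psi> (gen x)) = t x" using disjoint by (auto simp: t_def \<Psi>x \<Psi>y)
    fix i :: int assume i: "\<bar>i\<bar> \<le> N"
    show "\<pi> (fst (\<Psi> (gen x)) i) = gen x"
    proof (cases "x \<in> Xs")
      case True
      have "s \<le> i" "i \<le> N" "\<not> i \<le> B" "s \<le> i - c" "i - c \<le> N" "i - c \<le> B"
        using i D N(1) unfolding s_def c_def B_def by linarith+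
      then have "\<pi> (E i) = gen ?xt" "\<pi> (E (i - c)) = gen ?xb"
        using \<pi>E[of i] \<pi>E[of "i - c"] by simp_all
      then show ?thesis using True by (simp add: \<Psi>x edges_def linked_edges_def \<pi>\<xi>)
    next
      case False
      then have "x \<in> Ys" using xy by blast
      then show ?thesis using \<kappa>y \<pi>k[OF kgen_closed[of x]] by (simp add: \<Psi>y)
    qed
  qed
  \<comment> \<open>Height 0 is within the range of constancy, so the value of \<open>g\<close>
    there maps back to \<open>g\<close> and cannot be \<open>\<one>\<close>.\<close>
  from N(2)[OF this, of 0] have \<pi>v: "\<pi> (fst (\<Psi> g) 0) = g" using N(1) by simp
  let ?v = "fst (\<Psi> g) 0"
  have v: "?v \<in> carrier P" using hom_in_carrier[OF \<Psi> g(1)] by (cases "\<Psi> g") simp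
  have "?v \<noteq> \<one>\<^bsub>P\<^esub>"
  proof
    assume "?v = \<one>\<^bsub>P\<^esub>"
    then show False using \<pi>v g(2) \<pi>.hom_one by (simp only:)
  qed
  then obtain L where L: "L \<lhd> P" "finite (rcosets\<^bsub>P\<^esub> L)" "?v \<notin> L"
    using P(2) v unfolding residually_finite_def by blast
  interpret L: normal L P by fact
  let ?Q = "P Mod L" and ?q = "\<lambda>a. L #>\<^bsub>P\<^esub> a"
  have Q: "group ?Q" by (rule L.factorgroup_is_group)
  have finQ: "finite (carrier ?Q)" using L(2) by (simp add: FactGroup_def)
  have q: "?q \<in> hom P ?Q" by (rule L.r_coset_hom_Mod)
  have qv: "?q ?v \<noteq> \<one>\<^bsub>?Q\<^esub>"
    using L(3) P.rcos_self[OF v L.subgroup_axioms] by (auto simp: FactGroup_def)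

  have qf: "?q (f b) \<in> carrier ?Q" if "b \<in> carrier H" for b
    by (rule hom_in_carrier[OF q hom_in_carrier[OF f that]])
  \<comment> \<open>The image of \<open>E\<close> solves the same recursion over the finite group
    \<open>?Q\<close>, hence is periodic.\<close>
  interpret rQ: two_sided_recursion "carrier ?Q" "?n jt" "?n jb - c"
    "\<lambda>i E. path_value ?Q \<theta> (\<lambda>b. ?q (f b)) (edges c (\<lambda>x. ?q (\<xi> x)) E) R i = ?q (k (kgen z))"
    by (rule recursion[OF Q R])
      (use qf hom_in_carrier[OF q kz] hom_in_carrier[OF q \<xi>] c in auto)
  have "path_value ?Q \<theta> (\<lambda>b. ?q (f b)) (edges c (\<lambda>x. ?q (\<xi> x)) (\<lambda>n. ?q (E n))) R i = ?q (k (kgen z))" for i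
    using hom_path_value[OF P(1) Q q R, of f "edges c \<xi> E" \<theta> i] hom_in_carrier[OF f] edcl sat
    by (simp add: edges_hom[of ?q, abs_def])
  moreover have "range (\<lambda>n. ?q (E n)) \<subseteq> carrier ?Q" using hom_in_carrier[OF q Ecl] by blast
  ultimately obtain M where M: "M > 0" "\<And>n. ?q (E (n + M)) = ?q (E n)"
    using rQ.solution_periodic[OF finQ, of "\<lambda>n. ?q (E n)"] unfolding path_value_edges_shift by metis

  let ?\<Phi> = "\<lambda>x. (\<lambda>i. ?q (fst (\<Psi> x) i), snd (\<Psi> x))"
  have \<Phi>: "?\<Phi> \<in> hom G (wreath ?Q)"
    using hom_compose[OF \<Psi> map_wreath_hom[OF q]] by (simp add: o_def)
  interpret \<Phi>: group_hom G "wreath ?Q" ?\<Phi>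
    by (intro group_homI group_G group.group_wreath Q \<Phi>)
  interpret \<Psi>: group_hom G "wreath P" \<Psi>
    by (intro group_homI group_G P.group_wreath \<Psi>)
  interpret q: group_hom P ?Q ?q by (intro group_homI P Q q)
  have cl: "fst (\<Psi> x) i \<in> carrier P" if "x \<in> carrier G" for x i
    using \<Psi>.hom_closed[OF that] by (cases "\<Psi> x") auto
  \<comment> \<open>Products and inverses only shift functions and combine them pointwise, so
    periodicity spreads from the generators to all of \<open>G\<close>.\<close>
  let ?T = "{x \<in> carrier G. \<forall>i. ?q (fst (\<Psi> x) (i + M)) = ?q (fst (\<Psi> x) i)}"
  have "carrier G \<subseteq> ?T"
  proof (rule G_generated)
    show "subgroup ?T G"
    proof (rule \<pi>.H.subgroupI)
      show "?T \<noteq> {}" by (auto intro!: exI[of _ "\<one>\<^bsub>G\<^esub>"])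
    next
      fix x assume x: "x \<in> ?T"
      have inv: "fst (\<Psi> (inv\<^bsub>G\<^esub> x)) i = inv\<^bsub>P\<^esub> (fst (\<Psi> x) (i - snd (\<Psi> x)))" for i
        using \<Psi>.hom_inv[of x] x P.inv_wreath[where c = "fst (\<Psi> x)" and s = "snd (\<Psi> x)", OF cl] by simp
      have per: "?q (fst (\<Psi> x) (i + M - snd (\<Psi> x))) = ?q (fst (\<Psi> x) (i - snd (\<Psi> x)))" for i
        using x by (simp add: diff_add_eq[symmetric])
      have xG: "x \<in> carrier G" using x by blast
      have "?q (fst (\<Psi> (inv\<^bsub>G\<^esub> x)) (i + M)) = ?q (fst (\<Psi> (inv\<^bsub>G\<^esub> x)) i)" for i
        unfolding inv q.hom_inv[OF cl[OF xG]] per ..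
      then show "inv\<^bsub>G\<^esub> x \<in> ?T" using xG by blast
    next
      fix x y assume x: "x \<in> ?T" and y: "y \<in> ?T"
      have mult: "fst (\<Psi> (x \<otimes>\<^bsub>G\<^esub> y)) i = fst (\<Psi> x) i \<otimes>\<^bsub>P\<^esub> fst (\<Psi> y) (i + snd (\<Psi> x))" for i
        using \<Psi>.hom_mult[of x y] x y by (cases "\<Psi> x"; cases "\<Psi> y") simp
      have per: "?q (fst (\<Psi> y) (i + M + snd (\<Psi> x))) = ?q (fst (\<Psi> y) (i + snd (\<Psi> x)))" for i
        using y by (simp add: add.commute[of M] add.assoc) (metis add.assoc add.commute)
      have xG: "x \<in> carrier G" "y \<in> carrier G" using x y by blast+
      have "?q (fst (\<Psi> x) (i + M)) = ?q (fst (\<Psi> x) i)" for i using x by blast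
      then have "?q (fst (\<Psi> (x \<otimes>\<^bsub>G\<^esub> y)) (i + M)) = ?q (fst (\<Psi> (x \<otimes>\<^bsub>G\<^esub> y)) i)" for i
        unfolding mult q.hom_mult[OF cl[OF xG(1)] cl[OF xG(2)]] per by simp
      then show "x \<otimes>\<^bsub>G\<^esub> y \<in> ?T" using xG by blast
    qed auto
    show "coeff b \<in> ?T" if "b \<in> carrier H" for b
      using that hom_in_carrier[OF coeff_hom that] by (simp add: \<Psi>c)
    fix x assume xy: "x \<in> Xs \<union> Ys"
    show "gen x \<in> ?T"
    proof (cases "x \<in> Xs")
      case True
      have "?q (E (i + M - c)) = ?q (E (i - c))" for i using M(2)[of "i - c"] by (simp add: algebra_simps)
      then show ?thesis
        using True M(2) gen_closed[OF xy] by (simp add: \<Psi>x edges_def linked_edges_def)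
    next
      case False
      then show ?thesis using xy gen_closed[OF xy] by (simp add: \<Psi>y)
    qed
  qed
  then have "fst (?\<Phi> x) (i + M) = fst (?\<Phi> x) i" if "x \<in> carrier G" for x i
    using that by auto
  then show "\<exists>N. N \<lhd> G \<and> finite (rcosets\<^bsub>G\<^esub> N) \<and> g \<notin> N"
    using periodic_wreath_separates[OF group_G Q finQ \<Phi> M(1), of g 0] qv by simp
qed

lemma residually_finite_G:
  assumes "residually_finite H" "residually_finite K"
  shows "residually_finite G"
  unfolding residually_finite_def
proof (intro ballI impI)
  fix g assume g: "g \<in> carrier G" "g \<noteq> \<one>\<^bsub>G\<^esub>"
  obtain \<kappa> where \<kappa>: "\<kappa> \<in> hom K G" "\<And>y. y \<in> Ys \<Longrightarrow> \<kappa> (kgen y) = gen y"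
    "\<kappa> (kgen z) = rel_word_value G coeff gen R"
    by (rule K_to_G) blast
  have gen: "\<forall>x\<in>Xs. gen x \<in> carrier G" using gen_closed by blast
  show "\<exists>N. N \<lhd> G \<and> finite (rcosets\<^bsub>G\<^esub> N) \<and> g \<notin> N"
  proof (rule free_product_cover[OF H assms(1) group_K assms(2) group_G coeff_hom \<kappa>(1) gen], goal_cases)
    case (1 P f k \<xi> \<pi>)
    show ?case
      by (rule separates_if_covered[OF 1(1-6) \<kappa>(1) 1(7-9) \<kappa>(2,3) g])
  qed
qed

end

theorem theorem2:
  fixes H :: "('h, 'm) monoid_scheme"
    and Xs Ys :: "'a set" and z :: 'a
    and S :: "('a \<times> int) list"
    and R :: "('a \<times> int \<times> 'h) list"
  assumes "M_presentation Xs H R"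
    and "z \<notin> Ys"
    and "Xs \<inter> (Ys \<union> {z}) = {}"
    and "S \<in> signed_words (Ys \<union> {z})"
  shows "residually_finite (rel_presented_group H (Xs \<union> Ys) (substituted_relator H Xs Ys z S R)) \<longleftrightarrow>
    residually_finite H \<and> residually_finite (one_relator_group (Ys \<union> {z}) S)"
proof -
  have H: "group H" and R: "R \<in> lists (Xs \<times> {1, -1} \<times> carrier H)" and umm: "unique_max_min Xs (skeleton R)"
    using assms(1) by (auto simp: M_presentation_def one_relator_rel_presentation_def)
  have "skeleton R \<in> lists (UNIV \<times> {1, -1})" using R
  proof (induction R)
    case (Cons c R)
    then show ?case by (cases c) auto
  qed simp
  then obtain \<theta> jt jb D where "peaks \<theta> (skeleton R) jt jb D"
    using unique_max_min_peaks[OF umm] by blast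
  then interpret peaked_substitution H Xs Ys z S R \<theta> jt jb D
    unfolding peaked_substitution_def substitution_def using H R assms by blast
  show ?thesis using residually_finite_factors residually_finite_G by blast
qed

end
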